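(* Assume, in the setting of the context, that the tail function satisfies $h\equiv1$ (so that one may take $d_n=n^{1/\beta}$) and that $E(\tau_0^p)<\infty$ for some $p\in(1,2]$. Then there is absence of localization for $\mathcal X$: for almost every realization of $\tau$, $\sup_{i\in\mathbb Z}P(\mathcal X_t=i\mid\tau)\to0$ as $t\to\infty$.
   Context: Let $\beta\in(1,2]$. Let $(\varepsilon_j)_{j\ge1}$ be i.i.d. integer-valued random variables with $E\varepsilon_1=0$ and $E(e^{it\varepsilon_1})=1$ iff $t\in2\pi\mathbb Z$, in the domain of attraction of a $\beta$-stable law with $P(\varepsilon_1<-x)\sim x^{-\beta}(c^-+o(1))h(x)$, $P(\varepsilon_1>x)\sim x^{-\beta}(c^++o(1))h(x)$, $c^\pm>0$, $h$ slowly varying. Let $X_0=0$, $X_n=\sum_{j\le n}\varepsilon_j$. Let $\tau=(\tau_i)_{i\in\mathbb Z}$ be i.i.d. positive random variables, independent of $X$. The trap model $\mathcal X$ is the continuous-time random walk on $\mathbb Z$ with $\mathcal X_0=0$, embedded chain $X$, and jump rate $\tau_i^{-1}$ at site $i$ (holding times exponential with mean $\tau_i$, conditionally independent given $X,\tau$). *)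

theory Defs
  imports "HOL-Probability.Probability"
begin

text \<open>Embedded random walk: X_0 = 0, X_n = eps_1 + ... + eps_n
  (the increments are indexed from 0 here).\<close>
definition rw_pos :: "(nat \<Rightarrow> int) \<Rightarrow> nat \<Rightarrow> int" where
  "rw_pos eps n = (\<Sum>j<n. eps j)"

text \<open>Time of the n-th jump of the trap model: the k-th holding time is
  tau(X_k) * e_k with e_k i.i.d. standard exponential, i.e. exponential with
  mean tau(X_k).\<close>
definition jump_time :: "(int \<Rightarrow> real) \<Rightarrow> (nat \<Rightarrow> int) \<Rightarrow> (nat \<Rightarrow> real) \<Rightarrow> nat \<Rightarrow> real" where
  "jump_time tau eps e n = (\<Sum>k<n. tau (rw_pos eps k) * e k)"

definition walk_clock_space :: "int pmf \<Rightarrow> ((nat \<Rightarrow> int) \<times> (nat \<Rightarrow> real)) measure" where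
  "walk_clock_space \<mu> =
     (PiM UNIV (\<lambda>_::nat. measure_pmf \<mu>)) \<Otimes>\<^sub>M
     (PiM UNIV (\<lambda>_::nat. density lborel (exponential_density 1)))"

definition trap_quenched :: "int pmf \<Rightarrow> (int \<Rightarrow> real) \<Rightarrow> real \<Rightarrow> int \<Rightarrow> real" where
  "trap_quenched \<mu> tau t i = measure (walk_clock_space \<mu>)
     {(eps, e). \<exists>n. rw_pos eps n = i \<and> jump_time tau eps e n \<le> t \<and> t < jump_time tau eps e (Suc n)}"

end

theory Submission
  imports Defs "HOL-Real_Asymp.Real_Asymp"
begin

text \<open>
  Write \<open>P\<close> for the transition operator of the embedded walk and run the trap model inside a box
  \<open>[-R, R]\<close> with \<open>R\<close> a power of \<open>t\<close> slightly larger than \<open>t\<^bsup>1/\<beta>\<^esup>\<close>.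

  Inside the box, \<open>x \<mapsto> P\<^sub>x(X\<^sub>t = i)\<close> has nonincreasing supremum, nonincreasing \<open>L\<^sup>1(\<tau>)\<close> norm (initially
  \<open>\<tau>\<^sub>i\<close>), and the time integral of its Dirichlet form \<open>\<langle>f, (I - P) f\<rangle>\<close> is at most \<open>\<tau>\<^sub>i\<close>; so at some time before \<open>t\<close>
  the form is \<open>O(\<tau>\<^sub>i / t)\<close>. The form does not involve \<open>\<tau>\<close>, and by the tail assumption it controls the
  Hoelder seminorm of order about \<open>(\<beta> - 1) / 2\<close>. Hence if the supremum is at least \<open>\<eta>\<close>, the function exceeds
  \<open>\<eta>/2\<close> on an interval of length \<open>\<rho> \<gg> \<tau>\<^sub>i\<close>. Such intervals have \<open>\<tau>\<close>-mass of order \<open>\<rho>\<close>, contradicting the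
  \<open>L\<^sup>1(\<tau>)\<close> bound. This works as long as \<open>\<tau>\<^sub>i \<lless> t\<^bsup>1/\<beta>\<^esup>\<close>, which the moment of order \<open>p > 1\<close> guarantees
  throughout the box.

  The walk leaves the box before time \<open>t\<close> with probability at most \<open>O(R\<^bsup>-\<gamma>\<^esup>)\<close> (\<open>\<gamma> < \<beta>\<close>) times the expected
  number of jumps. Stationarity of the environment seen from the walker under the size-biased law bounds the
  latter, on average, by a multiple of \<open>t\<close>.

  The almost sure bounds on the environment follow from Borel-Cantelli along \<open>t = 2\<^sup>n\<close>.
\<close>

subsection \<open>Dirichlet form and lazy chain in a box\<close>

text \<open>The threshold t^(1/\<beta>) comes from balancing two lengths. A target trap of depth M =
  t^a leaves energy of order M/t, hence an oscillation of about the square root of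
  \<rho>^(\<beta>-1) M/t over distance \<rho>, while the mass argument needs \<rho> beyond M. Both
  fit exactly when t^(a\<beta>-1) tends to 0, that is a < 1/\<beta>. The box radius t^r needs r >
  1/\<beta>, and a moment of order p keeps its traps below t^a once r < p a; p > 1 leaves room for
  both. The walk need not be reversible. Counting measure is invariant for every
  \<open>\<mu>\<close>, so the weight \<open>tau\<close> cancels the rate 1/\<open>tau\<close>, and
  the quadratic form sees only the real part of the characteristic function. Contraction and
  dissipation are proved for a lazy discrete chain, where they are statements about finite sums; a
  Poisson mixture then returns to continuous time. The auxiliary rate \<open>c\<close> cancels:
  about c t/4 steps share an energy budget of c \<open>tau i\<close>.\<close>

definition box_avg :: "int pmf \<Rightarrow> int set \<Rightarrow> (int \<Rightarrow> real) \<Rightarrow> int \<Rightarrow> real" where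
  "box_avg \<mu> L f x = (\<Sum>y\<in>L. pmf \<mu> (y - x) * f y)"

text \<open>The sum runs against counting measure, not against \<open>tau\<close>: the invariant
  weight \<open>tau\<close> cancels the jump rate of the trap model. Killing at the boundary of
  \<open>L\<close> contributes as well, because \<open>box_avg\<close> loses the mass sent
  outside.\<close>

definition energy :: "int pmf \<Rightarrow> int set \<Rightarrow> (int \<Rightarrow> real) \<Rightarrow> real" where
  "energy \<mu> L f = (\<Sum>x\<in>L. f x * (f x - box_avg \<mu> L f x))"

text \<open>An explicit Euler step of length 1/c for the backward equation of the trap model, that
  is, one step of a chain that moves from x with probability 1/(c \<open>tau x\<close>). The value 0
  outside \<open>L\<close> encodes killing.\<close>

definition lazy_step ::
  "int pmf \<Rightarrow> int set \<Rightarrow> (int \<Rightarrow> real) \<Rightarrow> real \<Rightarrow> (int \<Rightarrow> real) \<Rightarrow> int \<Rightarrow> real" where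
  "lazy_step \<mu> L tau c f x =
     (if x \<in> L then f x + (box_avg \<mu> L f x - f x) / (c * tau x) else 0)"

definition lazy_iter ::
  "int pmf \<Rightarrow> int set \<Rightarrow> (int \<Rightarrow> real) \<Rightarrow> real \<Rightarrow> int \<Rightarrow> nat \<Rightarrow> int \<Rightarrow> real" where
  "lazy_iter \<mu> L tau c i m = (lazy_step \<mu> L tau c ^^ m) (\<lambda>x. if x = i then 1 else 0)"

section \<open>Contraction properties of the killed transition operator\<close>

lemma sum_pmf_image_le_1:
  assumes "finite L" "inj_on g L"
  shows "(\<Sum>y\<in>L. pmf \<mu> (g y)) \<le> 1"
proof -
  have "(\<Sum>y\<in>L. pmf \<mu> (g y)) = (\<Sum>z\<in>g ` L. pmf \<mu> z)"
    using assms by (simp add: sum.reindex)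
  also have "\<dots> = measure_pmf.prob \<mu> (g ` L)"
    using assms by (simp add: measure_measure_pmf_finite)
  finally show ?thesis by simp
qed

lemma box_avg_nonneg: "(\<And>y. y \<in> L \<Longrightarrow> 0 \<le> f y) \<Longrightarrow> 0 \<le> box_avg \<mu> L f x"
  unfolding box_avg_def by (intro sum_nonneg) auto

lemma box_avg_le:
  assumes "finite L" "\<And>y. y \<in> L \<Longrightarrow> f y \<le> M" "0 \<le> M"
  shows "box_avg \<mu> L f x \<le> M"
proof -
  have "box_avg \<mu> L f x \<le> (\<Sum>y\<in>L. pmf \<mu> (y - x) * M)"
    unfolding box_avg_def using assms by (intro sum_mono mult_left_mono) auto
  also have "\<dots> = (\<Sum>y\<in>L. pmf \<mu> (y - x)) * M" by (simp add: sum_distrib_right)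
  also have "\<dots> \<le> 1 * M"
    using assms by (intro mult_right_mono sum_pmf_image_le_1) (auto simp: inj_on_def)
  finally show ?thesis by simp
qed

text \<open>Not only the row sums but also the column sums of the killed kernel are at most 1, by
  translation invariance. This subinvariance of counting measure takes the place of
  reversibility.\<close>

lemma sum_box_avg_le:
  assumes "finite L" "\<And>y. y \<in> L \<Longrightarrow> 0 \<le> f y"
  shows "(\<Sum>x\<in>L. box_avg \<mu> L f x) \<le> (\<Sum>y\<in>L. f y)"
proof -
  have "(\<Sum>x\<in>L. box_avg \<mu> L f x) = (\<Sum>y\<in>L. (\<Sum>x\<in>L. pmf \<mu> (y - x)) * f y)"
    unfolding box_avg_def by (subst sum.swap) (simp add: sum_distrib_right)
  also have "\<dots> \<le> (\<Sum>y\<in>L. 1 * f y)"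
    using assms by (intro sum_mono mult_right_mono sum_pmf_image_le_1) (auto simp: inj_on_def)
  finally show ?thesis by simp
qed

text \<open>Jensen's inequality for a kernel of total mass q at most 1: expand the nonnegative
  weighted sum of squares around m. The missing mass 1 - q only helps.\<close>

lemma box_avg_square_le:
  assumes "finite L"
  shows "(box_avg \<mu> L f x)\<^sup>2 \<le> box_avg \<mu> L (\<lambda>y. (f y)\<^sup>2) x"
proof -
  define q where "q = (\<Sum>y\<in>L. pmf \<mu> (y - x))"
  define m where "m = box_avg \<mu> L f x"
  have q: "q \<le> 1" unfolding q_def
    using assms by (intro sum_pmf_image_le_1) (auto simp: inj_on_def)
  have "0 \<le> (\<Sum>y\<in>L. pmf \<mu> (y - x) * (f y - m)\<^sup>2)"
    by (intro sum_nonneg) auto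
  also have "\<dots> = (\<Sum>y\<in>L. pmf \<mu> (y - x) * (f y)\<^sup>2 - 2 * m * (pmf \<mu> (y - x) * f y) + m\<^sup>2 * pmf \<mu> (y - x))"
    by (intro sum.cong) (auto simp: power2_eq_square algebra_simps)
  also have "\<dots> = box_avg \<mu> L (\<lambda>y. (f y)\<^sup>2) x - 2 * m * m + m\<^sup>2 * q"
    unfolding q_def m_def box_avg_def
    by (simp add: sum.distrib sum_subtractf sum_distrib_left)
  also have "\<dots> \<le> box_avg \<mu> L (\<lambda>y. (f y)\<^sup>2) x - 2 * m * m + m\<^sup>2 * 1"
    using q by (intro add_left_mono mult_left_mono) auto
  finally show ?thesis by (simp add: m_def power2_eq_square)
qed

text \<open>The condition \<open>2 \<le> c * tau x\<close> makes the lazy chain move with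
  probability at most 1/2; this is what lets \<open>sum_tau_K_square_le\<close> absorb its second
  order term.\<close>

locale trap_box =
  fixes \<mu> :: "int pmf" and L :: "int set" and tau :: "int \<Rightarrow> real" and c :: real
  assumes fin: "finite L" and tau_pos: "\<And>x. x \<in> L \<Longrightarrow> 0 < tau x"
    and c_ge_1: "1 \<le> c" and c_tau: "\<And>x. x \<in> L \<Longrightarrow> 2 \<le> c * tau x"
begin

abbreviation "K \<equiv> lazy_step \<mu> L tau c"
abbreviation "A \<equiv> box_avg \<mu> L"

lemma K_eq:
  assumes "x \<in> L"
  shows "K f x = (1 - 1 / (c * tau x)) * f x + (1 / (c * tau x)) * A f x"
    and "0 < 1 / (c * tau x)" "1 / (c * tau x) \<le> 1/2"
proof -
  show "K f x = (1 - 1 / (c * tau x)) * f x + (1 / (c * tau x)) * A f x"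
    using assms by (simp add: lazy_step_def left_diff_distrib diff_divide_distrib)
  show "0 < 1 / (c * tau x)" "1 / (c * tau x) \<le> 1/2"
    using c_tau[OF assms] by (auto simp: field_simps)
qed

lemma K_nonneg:
  assumes "\<And>y. y \<in> L \<Longrightarrow> 0 \<le> f y"
  shows "0 \<le> K f x"
proof (cases "x \<in> L")
  case True
  show ?thesis unfolding K_eq(1)[OF True]
    using K_eq(2,3)[OF True] assms True
    by (intro add_nonneg_nonneg mult_nonneg_nonneg box_avg_nonneg) auto
qed (simp add: lazy_step_def)

lemma K_le:
  assumes "\<And>y. y \<in> L \<Longrightarrow> f y \<le> M" "0 \<le> M"
  shows "K f x \<le> M"
proof (cases "x \<in> L")
  case True
  have "K f x \<le> (1 - 1 / (c * tau x)) * M + (1 / (c * tau x)) * M"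
    unfolding K_eq(1)[OF True]
    using K_eq(2,3)[OF True] assms True fin
    by (intro add_mono mult_left_mono box_avg_le) auto
  then show ?thesis by (simp add: algebra_simps)
qed (use assms in \<open>simp add: lazy_step_def\<close>)

lemma sum_tau_K_le:
  assumes "\<And>y. y \<in> L \<Longrightarrow> 0 \<le> f y"
  shows "(\<Sum>x\<in>L. tau x * K f x) \<le> (\<Sum>x\<in>L. tau x * f x)"
proof -
  have "(\<Sum>x\<in>L. tau x * K f x) = (\<Sum>x\<in>L. tau x * f x + (A f x - f x) / c)"
  proof (intro sum.cong refl)
    fix x assume x: "x \<in> L"
    have "tau x * (z / (c * tau x)) = z / c" for z using tau_pos[OF x] by simp
    then show "tau x * K f x = tau x * f x + (A f x - f x) / c"
      using x by (simp add: lazy_step_def distrib_left)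
  qed
  also have "\<dots> = (\<Sum>x\<in>L. tau x * f x) + ((\<Sum>x\<in>L. A f x) - (\<Sum>x\<in>L. f x)) / c"
    by (simp add: sum.distrib sum_subtractf flip: sum_divide_distrib)
  also have "\<dots> \<le> (\<Sum>x\<in>L. tau x * f x) + 0"
    using sum_box_avg_le[OF fin assms] c_ge_1
    by (intro add_left_mono divide_nonpos_nonneg) auto
  finally show ?thesis by simp
qed

text \<open>Energy dissipation in one step. Writing K f = f - b d with \<open>tau\<close> b = 1/c,
  the square produces -2/c times the energy plus 1/c times the sum of b d^2. Laziness (b at most
  1/2) and Jensen bound that last sum by the energy, so one of the two copies survives.\<close>

lemma sum_tau_K_square_le:
  "(\<Sum>x\<in>L. tau x * (K f x)\<^sup>2) \<le> (\<Sum>x\<in>L. tau x * (f x)\<^sup>2) - energy \<mu> L f / c"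
proof -
  define d where "d x = f x - A f x" for x
  define b where "b x = 1 / (c * tau x)" for x
  have b: "b x \<le> 1/2" "0 < b x" if "x \<in> L" for x
    unfolding b_def using K_eq[OF that] by auto
  have bt: "tau x * b x = 1 / c" if "x \<in> L" for x
    using tau_pos[OF that] by (simp add: b_def)
  have "(\<Sum>x\<in>L. b x * (d x)\<^sup>2) \<le> (\<Sum>x\<in>L. 1/2 * (d x)\<^sup>2)"
    using b by (intro sum_mono mult_right_mono) auto
  also have "\<dots> = (\<Sum>x\<in>L. 1/2 * (f x)\<^sup>2 - f x * A f x + 1/2 * (A f x)\<^sup>2)"
    by (intro sum.cong refl) (simp add: d_def power2_eq_square field_simps)
  also have "\<dots> \<le> (\<Sum>x\<in>L. 1/2 * (f x)\<^sup>2 - f x * A f x + 1/2 * A (\<lambda>y. (f y)\<^sup>2) x)"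
    using box_avg_square_le[OF fin] by (intro sum_mono add_left_mono mult_left_mono) auto
  also have "\<dots> = (\<Sum>x\<in>L. 1/2 * (f x)\<^sup>2 - f x * A f x) + 1/2 * (\<Sum>x\<in>L. A (\<lambda>y. (f y)\<^sup>2) x)"
    by (simp add: sum.distrib sum_distrib_left)
  also have "\<dots> \<le> (\<Sum>x\<in>L. 1/2 * (f x)\<^sup>2 - f x * A f x) + 1/2 * (\<Sum>x\<in>L. (f x)\<^sup>2)"
    using sum_box_avg_le[OF fin, of "\<lambda>y. (f y)\<^sup>2"] by simp
  also have "\<dots> = energy \<mu> L f"
    unfolding energy_def sum_distrib_left sum.distrib[symmetric]
    by (intro sum.cong refl) (simp add: power2_eq_square algebra_simps)
  finally have bd: "(\<Sum>x\<in>L. b x * (d x)\<^sup>2) \<le> energy \<mu> L f" .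
  have "(\<Sum>x\<in>L. tau x * (K f x)\<^sup>2) = (\<Sum>x\<in>L. tau x * (f x)\<^sup>2 - 2 / c * (f x * d x) + 1 / c * (b x * (d x)\<^sup>2))"
  proof (intro sum.cong refl)
    fix x assume x: "x \<in> L"
    have "K f x = f x - b x * d x"
      using x by (simp add: lazy_step_def b_def d_def algebra_simps diff_divide_distrib)
    have "tau x * (f x - b x * d x)\<^sup>2 = tau x * (f x)\<^sup>2 - 2 * (tau x * b x) * (f x * d x) + (tau x * b x) * (b x * (d x)\<^sup>2)"
      by (simp add: power2_eq_square algebra_simps)
    with \<open>K f x = f x - b x * d x\<close> show "tau x * (K f x)\<^sup>2 = tau x * (f x)\<^sup>2 - 2 / c * (f x * d x) + 1 / c * (b x * (d x)\<^sup>2)"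
      using bt[OF x] by simp
  qed
  also have "\<dots> = (\<Sum>x\<in>L. tau x * (f x)\<^sup>2) - 2 / c * energy \<mu> L f + 1 / c * (\<Sum>x\<in>L. b x * (d x)\<^sup>2)"
    by (simp add: sum.distrib sum_subtractf sum_distrib_left energy_def d_def)
  also have "\<dots> \<le> (\<Sum>x\<in>L. tau x * (f x)\<^sup>2) - 2 / c * energy \<mu> L f + 1 / c * energy \<mu> L f"
    using bd c_ge_1 by (intro add_left_mono mult_left_mono) auto
  finally show ?thesis by (simp add: algebra_simps)
qed

section \<open>Iterates of the lazy step for a fixed target site\<close>

abbreviation "k \<equiv> lazy_iter \<mu> L tau c"

lemma k_0: "k i 0 = (\<lambda>x. if x = i then 1 else 0)"
  and k_Suc: "k i (Suc m) = K (k i m)"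
  by (simp_all add: lazy_iter_def)

lemma k_nonneg: "0 \<le> k i m x"
  by (induction m arbitrary: x) (simp_all add: k_0 k_Suc K_nonneg)

text \<open>Maximum principle: a step never raises a nonnegative upper bound that holds on all of
  \<open>L\<close>. One good time therefore controls every later time.\<close>

lemma k_le_later:
  assumes "\<And>y. y \<in> L \<Longrightarrow> k i m y \<le> M" "0 \<le> M" "m \<le> n" "x \<in> L"
  shows "k i n x \<le> M"
  using assms(3,4)
proof (induction n arbitrary: x rule: dec_induct)
  case base then show ?case using assms by auto
next
  case (step n) then show ?case using assms(2) by (simp add: k_Suc K_le)
qed

lemma k_le_1: "x \<in> L \<Longrightarrow> k i m x \<le> 1"
  by (rule k_le_later[of i 0]) (auto simp: k_0)

lemma sum_tau_k_le: "i \<in> L \<Longrightarrow> (\<Sum>x\<in>L. tau x * k i m x) \<le> tau i"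
proof (induction m)
  case 0
  have "(\<Sum>x\<in>L. tau x * k i 0 x) = (\<Sum>x\<in>L. if x = i then tau x else 0)"
    by (intro sum.cong) (auto simp: k_0)
  then show ?case using fin 0 by (simp add: sum.delta)
next
  case (Suc m)
  have "(\<Sum>x\<in>L. tau x * k i (Suc m) x) \<le> (\<Sum>x\<in>L. tau x * k i m x)"
    unfolding k_Suc by (intro sum_tau_K_le k_nonneg)
  with Suc show ?case by simp
qed

text \<open>The \<open>tau\<close>-weighted sum of squares starts at \<open>tau i\<close>, stays
  nonnegative, and drops by at least energy/c in each step.\<close>

lemma sum_energy_k_le:
  assumes "i \<in> L"
  shows "(\<Sum>m<n. energy \<mu> L (k i m)) \<le> c * tau i"
proof -
  have "(\<Sum>x\<in>L. tau x * (k i n x)\<^sup>2) + (\<Sum>m<n. energy \<mu> L (k i m)) / c \<le> tau i"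
  proof (induction n)
    case 0
    have "(\<Sum>x\<in>L. tau x * (k i 0 x)\<^sup>2) = (\<Sum>x\<in>L. if x = i then tau x else 0)"
      by (intro sum.cong) (auto simp: k_0)
    then show ?case using fin assms by (simp add: sum.delta)
  next
    case (Suc n)
    then show ?case
      using sum_tau_K_square_le[of "k i n"] by (simp add: k_Suc add_divide_distrib)
  qed
  moreover have "0 \<le> (\<Sum>x\<in>L. tau x * (k i n x)\<^sup>2)"
    using tau_pos by (intro sum_nonneg) (auto simp: less_imp_le)
  ultimately have "(\<Sum>m<n. energy \<mu> L (k i m)) / c \<le> tau i" by linarith
  then show ?thesis using c_ge_1 by (simp add: field_simps)
qed

lemma exists_small_energy:
  assumes "i \<in> L" "0 < n"
  obtains m where "m < n" "energy \<mu> L (k i m) \<le> c * tau i / n"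
proof -
  have "\<exists>m<n. energy \<mu> L (k i m) \<le> c * tau i / n"
  proof (rule ccontr)
    assume "\<not> ?thesis"
    then have "(\<Sum>m<n. c * tau i / n) < (\<Sum>m<n. energy \<mu> L (k i m))"
      using assms by (intro sum_strict_mono) (auto simp: not_le)
    then show False using sum_energy_k_le[OF assms(1), of n] assms by simp
  qed
  then show ?thesis using that by blast
qed

text \<open>Poissonisation of the lazy chain: the heat kernel of the trap model killed outside the box.\<close>

definition v :: "int \<Rightarrow> real \<Rightarrow> int \<Rightarrow> real" where
  "v i t x = exp (- c * t) * (\<Sum>m. k i m x * c ^ m / fact m * t ^ m)"

lemma k_abs_le_1: "x \<in> L \<Longrightarrow> \<bar>k i m x\<bar> \<le> 1"
  using k_nonneg[of i m x] k_le_1[of x i m] by simp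

lemma summable_k:
  assumes "x \<in> L"
  shows "summable (\<lambda>m. k i m x * c ^ m / fact m * t ^ m)"
proof (rule summable_comparison_test')
  show "summable (\<lambda>m. inverse (fact m) * \<bar>c * t\<bar> ^ m)"
    by (rule summable_exp)
  fix m
  have "norm (k i m x * c ^ m / fact m * t ^ m) = \<bar>k i m x\<bar> * (inverse (fact m) * \<bar>c * t\<bar> ^ m)"
    by (simp add: abs_mult power_abs power_mult_distrib field_simps)
  also have "\<dots> \<le> 1 * (inverse (fact m) * \<bar>c * t\<bar> ^ m)"
    using k_abs_le_1[OF assms] by (intro mult_right_mono) auto
  finally show "norm (k i m x * c ^ m / fact m * t ^ m) \<le> inverse (fact m) * \<bar>c * t\<bar> ^ m" by simp
qed

lemma v_0: "v i 0 x = (if x = i then 1 else 0)"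
  unfolding v_def by (subst powser_zero) (simp add: k_0)

lemma v_nonneg: "x \<in> L \<Longrightarrow> 0 \<le> t \<Longrightarrow> 0 \<le> v i t x"
  unfolding v_def using c_ge_1
  by (intro mult_nonneg_nonneg suminf_nonneg summable_k) (auto intro!: k_nonneg mult_nonneg_nonneg divide_nonneg_nonneg)

text \<open>Kolmogorov's backward equation for the killed trap model. Differentiating the power
  series shifts the index by one; the lazy recursion turns c times the shifted iterate into c times
  the iterate plus the generator, and the prefactor exp(-ct) cancels the former.\<close>

lemma v_deriv:
  assumes x: "x \<in> L"
  shows "((\<lambda>t. v i t x) has_real_derivative (A (v i t) x - v i t x) / tau x) (at t)"
proof -
  define a where "a m = k i m x * c ^ m / fact m" for m
  define F where "F = (\<lambda>t. \<Sum>m. a m * t ^ m)"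
  have F: "(F has_real_derivative (\<Sum>m. diffs a m * t ^ m)) (at t)"
    unfolding F_def
    using summable_k[OF x] by (intro termdiffs_strong_converges_everywhere) (auto simp: a_def)
  have tx: "tau x > 0" "c > 0" using tau_pos x c_ge_1 by auto
  have d: "diffs a m = c * (k i (Suc m) x * c ^ m / fact m)" for m
    by (simp add: diffs_def a_def fact_Suc del: of_nat_Suc)
  have sm: "(\<lambda>m. k i m y * c ^ m / fact m * t ^ m) sums (exp (c * t) * v i t y)" if "y \<in> L" for y
    using summable_sums[OF summable_k[OF that, of i t]] by (simp add: v_def exp_minus_inverse flip: mult.assoc)
  have "(\<Sum>m. diffs a m * t ^ m) =
    (\<Sum>m. c * (k i m x * c ^ m / fact m * t ^ m) + 1 / tau x *
      ((\<Sum>y\<in>L. pmf \<mu> (y - x) * (k i m y * c ^ m / fact m * t ^ m)) - k i m x * c ^ m / fact m * t ^ m))"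
  proof (intro suminf_cong)
    fix m
    have "(\<Sum>y\<in>L. pmf \<mu> (y - x) * (k i m y * c ^ m / fact m * t ^ m)) = A (k i m) x * (c ^ m / fact m * t ^ m)"
      unfolding box_avg_def sum_distrib_right by (intro sum.cong) auto
    moreover have "c * k i (Suc m) x = c * k i m x + (A (k i m) x - k i m x) / tau x"
      using x tx by (simp add: k_Suc lazy_step_def field_simps)
    moreover have "diffs a m * t ^ m = (c * k i (Suc m) x) * (c ^ m / fact m * t ^ m)"
      unfolding d by simp
    moreover have "k i m x * c ^ m / fact m * t ^ m = k i m x * (c ^ m / fact m * t ^ m)"
      by simp
    ultimately show "diffs a m * t ^ m = c * (k i m x * c ^ m / fact m * t ^ m) + 1 / tau x *
      ((\<Sum>y\<in>L. pmf \<mu> (y - x) * (k i m y * c ^ m / fact m * t ^ m)) - k i m x * c ^ m / fact m * t ^ m)"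
      by (simp only: distrib_right left_diff_distrib mult.assoc times_divide_eq_left mult_1 diff_divide_distrib)
  qed
  also have "\<dots> = c * (exp (c * t) * v i t x) + 1 / tau x *
      ((\<Sum>y\<in>L. pmf \<mu> (y - x) * (exp (c * t) * v i t y)) - exp (c * t) * v i t x)"
    using sm x by (intro sums_unique[symmetric] sums_add sums_mult sums_diff sums_sum)
  also have "\<dots> = exp (c * t) * (c * v i t x + (A (v i t) x - v i t x) / tau x)"
    by (simp add: box_avg_def sum_distrib_left sum_divide_distrib algebra_simps diff_divide_distrib)
  finally have F': "(F has_real_derivative exp (c * t) * (c * v i t x + (A (v i t) x - v i t x) / tau x)) (at t)"
    using F by simp
  have v: "(\<lambda>t. v i t x) = (\<lambda>t. exp (- c * t) * F t)"
    by (simp add: v_def F_def a_def)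
  have E: "exp (- c * t) * exp (c * t) = 1"
    by (simp flip: exp_add)
  have Ft: "exp (- c * t) * F t = v i t x"
    using fun_cong[OF v] by simp
  have "((\<lambda>t. exp (- c * t) * F t) has_real_derivative
      exp (- c * t) * (- c) * F t + exp (- c * t) * (exp (c * t) * (c * v i t x + (A (v i t) x - v i t x) / tau x))) (at t)"
    by (rule derivative_eq_intros refl F' | simp)+
  also have "exp (- c * t) * (- c) * F t + exp (- c * t) * (exp (c * t) * (c * v i t x + (A (v i t) x - v i t x) / tau x))
    = - c * (exp (- c * t) * F t) + (exp (- c * t) * exp (c * t)) * (c * v i t x + (A (v i t) x - v i t x) / tau x)"
    by (simp only: mult.assoc mult.left_commute mult.commute)
  also have "\<dots> = (A (v i t) x - v i t x) / tau x"
    unfolding E Ft by simp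
  finally show ?thesis unfolding v .
qed

text \<open>The number of lazy steps by time t is Poisson with mean ct. At least N steps cost M;
  fewer than N steps have probability at most 2^N exp(-ct/2) by a Chernoff bound, and this is at
  most exp(-ct/4) since 2 is below e and N is at most ct/4.\<close>

lemma v_le:
  assumes "x \<in> L" "0 \<le> t" "\<And>m. N \<le> m \<Longrightarrow> k i m x \<le> M" "0 \<le> M" "real N \<le> c * t / 4"
  shows "v i t x \<le> exp (- t / 4) + M"
proof -
  have c0: "0 \<le> c * t" "0 \<le> c" using assms c_ge_1 by auto
  have sm: "summable (\<lambda>m. inverse (fact m) * (c * t / 2) ^ m)" "summable (\<lambda>m. inverse (fact m) * (c * t) ^ m)"
    by (rule summable_exp)+
  have ex: "(\<Sum>m. inverse (fact m) * y ^ m) = exp y" for y :: real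
    by (simp add: exp_def divide_inverse mult.commute)
  have "(\<Sum>m. k i m x * c ^ m / fact m * t ^ m) \<le>
    (\<Sum>m. 2 ^ N * (inverse (fact m) * (c * t / 2) ^ m) + M * (inverse (fact m) * (c * t) ^ m))"
  proof (intro suminf_le summable_k summable_add summable_mult sm assms)
    fix m
    have eq: "k i m x * c ^ m / fact m * t ^ m = k i m x * (inverse (fact m) * (c * t) ^ m)"
      by (simp add: power_mult_distrib field_simps)
    have nn: "0 \<le> inverse (fact m) * (c * t / 2) ^ m" "0 \<le> inverse (fact m) * (c * t) ^ m"
      using c0 by auto
    show "k i m x * c ^ m / fact m * t ^ m \<le>
       2 ^ N * (inverse (fact m) * (c * t / 2) ^ m) + M * (inverse (fact m) * (c * t) ^ m)"
    proof (cases "N \<le> m")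
      case True
      have "k i m x * (inverse (fact m) * (c * t) ^ m) \<le> M * (inverse (fact m) * (c * t) ^ m)"
        using assms(3)[OF True] nn by (intro mult_right_mono) auto
      then show ?thesis unfolding eq using nn by (simp add: add_increasing)
    next
      case False
      have "k i m x * (inverse (fact m) * (c * t) ^ m) \<le> 1 * (inverse (fact m) * (c * t) ^ m)"
        using k_le_1[OF assms(1)] nn by (intro mult_right_mono) auto
      \<comment> \<open>Chernoff tilting by 1/2: the factor 2^m is then enlarged to 2^N, which is
        allowed for m < N.\<close>
      also have "\<dots> = 2 ^ m * (inverse (fact m) * (c * t / 2) ^ m)"
        by (simp add: power_divide)
      also have "\<dots> \<le> 2 ^ N * (inverse (fact m) * (c * t / 2) ^ m)"
        using False nn by (intro mult_right_mono power_increasing) auto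
      finally show ?thesis unfolding eq using nn assms(4) by (simp add: add_increasing2)
    qed
  qed
  also have "\<dots> = 2 ^ N * exp (c * t / 2) + M * exp (c * t)"
    by (simp add: suminf_add[symmetric] suminf_mult summable_mult sm ex)
  finally have "v i t x \<le> exp (- c * t) * (2 ^ N * exp (c * t / 2) + M * exp (c * t))"
    unfolding v_def by (intro mult_left_mono) auto
  also have "\<dots> = 2 ^ N * exp (- c * t + c * t / 2) + M"
    unfolding exp_add by (simp add: distrib_left exp_minus)
  also have "2 ^ N * exp (- c * t + c * t / 2) \<le> exp (c * t / 4) * exp (- c * t + c * t / 2)"
  proof (intro mult_right_mono)
    have "(2::real) ^ N \<le> exp 1 ^ N"
      using exp_ge_add_one_self[of 1] by (intro power_mono) auto
    also have "\<dots> = exp (real N)" by (simp add: exp_of_nat_mult[symmetric])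
    also have "\<dots> \<le> exp (c * t / 4)" using assms by simp
    finally show "(2::real) ^ N \<le> exp (c * t / 4)" .
  qed auto
  also have "exp (c * t / 4) * exp (- c * t + c * t / 2) = exp (- c * t / 4)"
    by (simp add: field_simps flip: exp_add)
  also have "exp (- c * t / 4) \<le> exp (- t / 4)"
    using mult_right_mono[OF c_ge_1 assms(2)] by simp
  finally show ?thesis by simp
qed

end

subsection \<open>Hoelder bound from the characteristic function\<close>

text \<open>Normalised Lebesgue measure on the half circle; all integrands below are even trigonometric
  expressions, so it plays the role of Haar measure on the circle.\<close>

definition half_circle :: "real measure" where
  "half_circle = density lborel (\<lambda>\<theta>. ennreal (indicator {0..pi} \<theta> / pi))"

lemma sets_half_circle [simp, measurable_cong]: "sets half_circle = sets borel"
  and space_half_circle [simp]: "space half_circle = UNIV"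
  by (simp_all add: half_circle_def)

lemma integral_half_circle:
  fixes g :: "real \<Rightarrow> real"
  assumes [measurable]: "g \<in> borel_measurable borel"
  shows "(\<integral>\<theta>. g \<theta> \<partial>half_circle) = (\<integral>\<theta>. indicator {0..pi} \<theta> * g \<theta> \<partial>lborel) / pi"
proof -
  have "(\<integral>\<theta>. g \<theta> \<partial>half_circle) = (\<integral>\<theta>. (indicator {0..pi} \<theta> / pi) * g \<theta> \<partial>lborel)"
    unfolding half_circle_def by (subst integral_real_density) auto
  then show ?thesis by (simp add: field_simps)
qed

lemma prob_space_half_circle: "prob_space half_circle"
proof
  have "emeasure half_circle UNIV = (\<integral>\<^sup>+\<theta>. ennreal (1 / pi) * indicator {0..pi} \<theta> \<partial>lborel)"
    unfolding half_circle_def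
    by (subst emeasure_density) (auto intro!: nn_integral_cong split: split_indicator)
  also have "\<dots> = ennreal (1 / pi) * ennreal pi"
    by (subst nn_integral_cmult_indicator) auto
  also have "\<dots> = 1" by (simp flip: ennreal_mult)
  finally show "emeasure half_circle (space half_circle) = 1" by simp
qed

interpretation half_circle: prob_space half_circle
  by (rule prob_space_half_circle)

lemma AE_half_circle: "AE \<theta> in half_circle. 0 \<le> \<theta> \<and> \<theta> \<le> pi"
  unfolding half_circle_def
  by (subst AE_density) (auto intro!: AE_I2 split: split_indicator)

lemma integrable_half_circle_bounded:
  fixes g :: "real \<Rightarrow> real"
  assumes "g \<in> borel_measurable borel" "\<And>\<theta>. \<bar>g \<theta>\<bar> \<le> B"
  shows "integrable half_circle g"
  using assms by (intro half_circle.integrable_const_bound[where B=B] AE_I2) auto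

section \<open>Cosine orthogonality and the spectral form of the energy\<close>

lemma integral_cos_half_circle:
  "(\<integral>\<theta>. cos (real_of_int m * \<theta>) \<partial>half_circle) = (if m = 0 then 1 else 0)"
proof (cases "m = 0")
  case False
  have "(\<integral>\<theta>. indicator {0..pi} \<theta> *\<^sub>R cos (real_of_int m * \<theta>) \<partial>lborel)
      = sin (real_of_int m * pi) / m - sin (real_of_int m * 0) / m"
    using False
    by (intro integral_FTC_atLeastAtMost)
      (auto intro!: derivative_eq_intros continuous_intros
        simp flip: has_real_derivative_iff_has_vector_derivative)
  then show ?thesis using False
    by (simp add: integral_half_circle sin_integer_2pi sin_zero_iff_int2)
qed (simp add: half_circle.prob_space[simplified])

lemma integral_cos_cos_half_circle:
  "(\<integral>\<theta>. cos (real_of_int m * \<theta>) * cos (real_of_int n * \<theta>) \<partial>half_circle) =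
     ((if m = n then 1 else 0) + (if m = - n then 1 else 0)) / 2"
proof -
  have "(\<integral>\<theta>. cos (real_of_int m * \<theta>) * cos (real_of_int n * \<theta>) \<partial>half_circle) =
    (\<integral>\<theta>. (cos (real_of_int (m - n) * \<theta>) + cos (real_of_int (m + n) * \<theta>)) / 2 \<partial>half_circle)"
    by (intro Bochner_Integration.integral_cong) (auto simp: cos_times_cos algebra_simps)
  also have "\<dots> = ((if m - n = 0 then 1 else 0) + (if m + n = 0 then 1 else 0)) / 2"
    unfolding integral_cos_half_circle[symmetric]
    by (subst Bochner_Integration.integral_divide_zero, subst Bochner_Integration.integral_add)
      (auto intro!: integrable_half_circle_bounded[where B=1])
  finally show ?thesis by (auto simp: eq_neg_iff_add_eq_0)
qed

text \<open>The squared modulus of the Fourier transform of f, kept in real form so that all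
  integrals stay real.\<close>

definition fourier_sq :: "int set \<Rightarrow> (int \<Rightarrow> real) \<Rightarrow> real \<Rightarrow> real" where
  "fourier_sq L f \<theta> = (\<Sum>x\<in>L. f x * cos (real_of_int x * \<theta>))\<^sup>2 + (\<Sum>x\<in>L. f x * sin (real_of_int x * \<theta>))\<^sup>2"

text \<open>One minus the real part of the characteristic function of \<open>\<mu>\<close>.\<close>

definition cf_gap :: "int pmf \<Rightarrow> real \<Rightarrow> real" where
  "cf_gap \<mu> \<theta> = (\<integral>k. 1 - cos (real_of_int k * \<theta>) \<partial>measure_pmf \<mu>)"

lemma fourier_sq_eq:
  "fourier_sq L f \<theta> = (\<Sum>x\<in>L. \<Sum>y\<in>L. f x * f y * cos (real_of_int (x - y) * \<theta>))"
  unfolding fourier_sq_def power2_eq_square sum_product sum.distrib[symmetric]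
  by (intro sum.cong refl) (simp add: left_diff_distrib cos_diff algebra_simps)

lemma fourier_sq_nonneg: "0 \<le> fourier_sq L f \<theta>"
  by (simp add: fourier_sq_def)

lemma fourier_sq_measurable [measurable]: "fourier_sq L f \<in> borel_measurable borel"
  unfolding fourier_sq_def[abs_def] by measurable

lemma fourier_sq_le: "fourier_sq L f \<theta> \<le> (\<Sum>x\<in>L. \<Sum>y\<in>L. \<bar>f x * f y\<bar>)"
proof -
  have "f x * f y * cos (real_of_int (x - y) * \<theta>) \<le> \<bar>f x * f y\<bar>" for x y
  proof -
    have "f x * f y * cos (real_of_int (x - y) * \<theta>) \<le> \<bar>f x * f y * cos (real_of_int (x - y) * \<theta>)\<bar>"
      by simp
    also have "\<dots> \<le> \<bar>f x * f y\<bar> * 1"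
      unfolding abs_mult by (intro mult_left_mono) auto
    finally show ?thesis by simp
  qed
  then show ?thesis unfolding fourier_sq_eq by (intro sum_mono)
qed

lemma cf_gap_integrable: "integrable (measure_pmf \<mu>) (\<lambda>k. 1 - cos (real_of_int k * \<theta>))"
proof (rule measure_pmf.integrable_const_bound[where B=2], rule AE_I2)
  fix k
  show "norm (1 - cos (real_of_int k * \<theta>)) \<le> 2"
    using cos_ge_minus_one[of "real_of_int k * \<theta>"] cos_le_one[of "real_of_int k * \<theta>"] by auto
qed simp

text \<open>Parseval's identity for a single displacement k: what remains is the sum of squares
  minus the autocorrelation of f averaged over the lags k and -k.\<close>

lemma fourier_cos:
  assumes "finite L"
  shows "(\<integral>\<theta>. fourier_sq L f \<theta> * (1 - cos (real_of_int k * \<theta>)) \<partial>half_circle) =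
    (\<Sum>x\<in>L. (f x)\<^sup>2 - (\<Sum>y\<in>L. f x * f y * ((if x - y = k then 1 else 0) + (if x - y = - k then 1 else 0)) / 2))"
proof -
  have I: "integrable half_circle (\<lambda>\<theta>. f x * f y * cos (real_of_int (x - y) * \<theta>) * (1 - cos (real_of_int k * \<theta>)))" for x y
  proof (rule integrable_half_circle_bounded)
    show "\<bar>f x * f y * cos (real_of_int (x - y) * \<theta>) * (1 - cos (real_of_int k * \<theta>))\<bar> \<le> \<bar>f x * f y\<bar> * 1 * 2" for \<theta>
      unfolding abs_mult
      by (intro mult_mono)
        (use cos_ge_minus_one[of "real_of_int k * \<theta>"] cos_le_one[of "real_of_int k * \<theta>"] in auto)
  qed simp
  have J: "(\<integral>\<theta>. f x * f y * cos (real_of_int (x - y) * \<theta>) * (1 - cos (real_of_int k * \<theta>)) \<partial>half_circle)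
    = f x * f y * ((if x = y then 1 else 0) - ((if x - y = k then 1 else 0) + (if x - y = - k then 1 else 0)) / 2)" for x y
  proof -
    have "(\<integral>\<theta>. f x * f y * cos (real_of_int (x - y) * \<theta>) * (1 - cos (real_of_int k * \<theta>)) \<partial>half_circle)
      = (\<integral>\<theta>. f x * f y * (cos (real_of_int (x - y) * \<theta>) - cos (real_of_int (x - y) * \<theta>) * cos (real_of_int k * \<theta>)) \<partial>half_circle)"
      by (intro Bochner_Integration.integral_cong refl) (simp only: right_diff_distrib mult.assoc mult_1_right)
    also have "\<dots> = f x * f y * ((\<integral>\<theta>. cos (real_of_int (x - y) * \<theta>) \<partial>half_circle)
        - (\<integral>\<theta>. cos (real_of_int (x - y) * \<theta>) * cos (real_of_int k * \<theta>) \<partial>half_circle))"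
      by (subst Bochner_Integration.integral_mult_right_zero, subst Bochner_Integration.integral_diff)
        (auto intro!: integrable_half_circle_bounded[where B=1] simp: abs_mult mult_le_one)
    finally show ?thesis
      unfolding integral_cos_half_circle integral_cos_cos_half_circle by simp
  qed
  have "(\<integral>\<theta>. fourier_sq L f \<theta> * (1 - cos (real_of_int k * \<theta>)) \<partial>half_circle) =
    (\<integral>\<theta>. (\<Sum>x\<in>L. \<Sum>y\<in>L. f x * f y * cos (real_of_int (x - y) * \<theta>) * (1 - cos (real_of_int k * \<theta>))) \<partial>half_circle)"
    unfolding fourier_sq_eq by (simp only: sum_distrib_right)
  also have "\<dots> = (\<Sum>x\<in>L. \<Sum>y\<in>L. f x * f y * ((if x = y then 1 else 0) - ((if x - y = k then 1 else 0) + (if x - y = - k then 1 else 0)) / 2))"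
    by (subst Bochner_Integration.integral_sum, (intro Bochner_Integration.integrable_sum I)[],
        intro sum.cong refl, subst Bochner_Integration.integral_sum, (intro I)[], intro sum.cong refl J)
  also have "\<dots> = (\<Sum>x\<in>L. (\<Sum>y\<in>L. if x = y then f x * f y else 0) - (\<Sum>y\<in>L. f x * f y * ((if x - y = k then 1 else 0) + (if x - y = - k then 1 else 0)) / 2))"
    unfolding sum_subtractf[symmetric]
    by (intro sum.cong refl) (simp add: right_diff_distrib)
  also have "\<dots> = (\<Sum>x\<in>L. (f x)\<^sup>2 - (\<Sum>y\<in>L. f x * f y * ((if x - y = k then 1 else 0) + (if x - y = - k then 1 else 0)) / 2))"
    using assms by (intro sum.cong refl) (simp add: power2_eq_square sum.delta')
  finally show ?thesis .
qed

text \<open>Average \<open>fourier_cos\<close> over k under \<open>\<mu>\<close>. Fubini applies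
  because the integrand is bounded on a product of probability spaces.\<close>

lemma energy_eq_fourier:
  assumes L: "finite L"
  shows "energy \<mu> L f = (\<integral>\<theta>. fourier_sq L f \<theta> * cf_gap \<mu> \<theta> \<partial>half_circle)"
    and "integrable half_circle (\<lambda>\<theta>. fourier_sq L f \<theta> * cf_gap \<mu> \<theta>)"
proof -
  define g where "g k \<theta> = fourier_sq L f \<theta> * (1 - cos (real_of_int k * \<theta>))" for k \<theta>
  interpret P: pair_prob_space "measure_pmf \<mu>" half_circle ..
  have g_meas: "case_prod g \<in> borel_measurable (measure_pmf \<mu> \<Otimes>\<^sub>M half_circle)"
    unfolding g_def by measurable
  define B where "B = (\<Sum>x\<in>L. \<Sum>y\<in>L. \<bar>f x * f y\<bar>)"
  have "norm (g k \<theta>) \<le> B * 2" for k \<theta>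
    unfolding g_def real_norm_def abs_mult[of "fourier_sq L f \<theta>"] B_def
    by (intro mult_mono)
      (use fourier_sq_le fourier_sq_nonneg cos_ge_minus_one[of "real_of_int k * \<theta>"] cos_le_one[of "real_of_int k * \<theta>"]
        in \<open>auto intro!: sum_nonneg\<close>)
  then have g_int: "integrable (measure_pmf \<mu> \<Otimes>\<^sub>M half_circle) (case_prod g)"
    using g_meas by (intro P.P.integrable_const_bound[where B="B * 2"] AE_I2) auto
  have gap: "(\<integral>k. g k \<theta> \<partial>measure_pmf \<mu>) = fourier_sq L f \<theta> * cf_gap \<mu> \<theta>" for \<theta>
    unfolding g_def cf_gap_def by simp
  show "integrable half_circle (\<lambda>\<theta>. fourier_sq L f \<theta> * cf_gap \<mu> \<theta>)"
    using P.integrable_snd[OF g_int] unfolding gap .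
  have pmf_int: "integrable (measure_pmf \<mu>) (\<lambda>k. if a = k then 1 else (0::real))" for a :: int
    by (rule measure_pmf.integrable_const_bound[where B=1]) auto
  have pmf_ind: "(\<integral>k. (if a = k then 1 else (0::real)) \<partial>measure_pmf \<mu>) = pmf \<mu> a" for a :: int
  proof -
    have "(\<integral>k. (if a = k then 1 else (0::real)) \<partial>measure_pmf \<mu>) = (\<integral>k. indicator {a} k \<partial>measure_pmf \<mu>)"
      by (intro Bochner_Integration.integral_cong) (auto simp: indicator_def)
    then show ?thesis by (simp add: measure_pmf_single)
  qed
  have "(\<integral>\<theta>. fourier_sq L f \<theta> * cf_gap \<mu> \<theta> \<partial>half_circle) = (\<integral>k. (\<integral>\<theta>. g k \<theta> \<partial>half_circle) \<partial>measure_pmf \<mu>)"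
    unfolding gap[symmetric] by (rule P.Fubini_integral[OF g_int])
  also have "\<dots> = (\<integral>k. (\<Sum>x\<in>L. (f x)\<^sup>2 - (\<Sum>y\<in>L. f x * f y * ((if x - y = k then 1 else 0) + (if y - x = k then 1 else 0)) / 2)) \<partial>measure_pmf \<mu>)"
    unfolding g_def fourier_cos[OF L]
    by (intro Bochner_Integration.integral_cong refl sum.cong arg_cong2[where f="(-)"] arg_cong2[where f="(/)"] arg_cong2[where f="(*)"]) auto
  also have "\<dots> = (\<Sum>x\<in>L. (f x)\<^sup>2 - (\<Sum>y\<in>L. f x * f y * (pmf \<mu> (x - y) + pmf \<mu> (y - x)) / 2))"
    unfolding pmf_ind[symmetric]
    by (simp add: pmf_int Bochner_Integration.integral_sum Bochner_Integration.integral_diff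
        Bochner_Integration.integral_add measure_pmf.prob_space[simplified])
  also have "\<dots> = (\<Sum>x\<in>L. (f x)\<^sup>2) - ((\<Sum>x\<in>L. \<Sum>y\<in>L. f x * f y * pmf \<mu> (x - y)) + (\<Sum>x\<in>L. \<Sum>y\<in>L. f x * f y * pmf \<mu> (y - x))) / 2"
    by (simp add: sum_subtractf sum.distrib distrib_left flip: sum_divide_distrib)
  \<comment> \<open>Exchanging x and y merges the two lags; the antisymmetric part of
    \<open>\<mu>\<close> drops out here.\<close>
  also have "(\<Sum>x\<in>L. \<Sum>y\<in>L. f x * f y * pmf \<mu> (x - y)) = (\<Sum>x\<in>L. \<Sum>y\<in>L. f x * f y * pmf \<mu> (y - x))"
    by (subst sum.swap) (simp add: mult.commute)
  also have "(\<Sum>x\<in>L. (f x)\<^sup>2) - ((\<Sum>x\<in>L. \<Sum>y\<in>L. f x * f y * pmf \<mu> (y - x)) + (\<Sum>x\<in>L. \<Sum>y\<in>L. f x * f y * pmf \<mu> (y - x))) / 2 = energy \<mu> L f"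
    by (simp add: energy_def box_avg_def right_diff_distrib sum_subtractf sum_distrib_left power2_eq_square mult_ac)
  finally show "energy \<mu> L f = (\<integral>\<theta>. fourier_sq L f \<theta> * cf_gap \<mu> \<theta> \<partial>half_circle)" by simp
qed


section \<open>Lower bounds for the gap of the characteristic function\<close>

lemma isCont_cf_gap: "isCont (cf_gap \<mu>) \<theta>"
proof (rule continuous_at_sequentiallyI)
  fix u :: "nat \<Rightarrow> real" assume u: "u \<longlonglongrightarrow> \<theta>"
  show "(\<lambda>n. cf_gap \<mu> (u n)) \<longlonglongrightarrow> cf_gap \<mu> \<theta>"
    unfolding cf_gap_def
  proof (rule integral_dominated_convergence[where w="\<lambda>_. 2"])
    show "AE k in measure_pmf \<mu>. (\<lambda>n. 1 - cos (real_of_int k * u n)) \<longlonglongrightarrow> 1 - cos (real_of_int k * \<theta>)"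
      using u by (intro AE_I2 tendsto_intros)
    show "AE k in measure_pmf \<mu>. norm (1 - cos (real_of_int k * u n)) \<le> 2" for n
    proof (rule AE_I2)
      fix k show "norm (1 - cos (real_of_int k * u n)) \<le> 2"
        using cos_ge_minus_one[of "real_of_int k * u n"] cos_le_one[of "real_of_int k * u n"] by auto
    qed
  qed auto
qed

lemma cf_gap_measurable [measurable]: "cf_gap \<mu> \<in> borel_measurable borel"
  by (intro borel_measurable_continuous_onI continuous_at_imp_continuous_on ballI isCont_cf_gap)

lemma cf_gap_nonneg: "0 \<le> cf_gap \<mu> \<theta>"
  unfolding cf_gap_def by (intro integral_nonneg_AE AE_I2) auto

text \<open>A vanishing gap forces the cosine, hence \<open>cis\<close>, to equal 1 almost surely,
  so the characteristic function is 1 at \<open>\<theta>\<close>. Aperiodicity would put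
  \<open>\<theta>\<close> in 2 pi Z, which misses the interval (0, pi].\<close>

lemma cf_gap_pos:
  fixes \<mu> :: "int pmf"
  assumes aperiodic: "\<And>t::real. measure_pmf.expectation \<mu> (\<lambda>k. cis (t * real_of_int k)) = 1
                      \<Longrightarrow> (\<exists>m::int. t = 2 * pi * real_of_int m)"
    and \<theta>: "0 < \<theta>" "\<theta> \<le> pi"
  shows "0 < cf_gap \<mu> \<theta>"
proof (rule ccontr)
  assume "\<not> 0 < cf_gap \<mu> \<theta>"
  then have "cf_gap \<mu> \<theta> = 0" using cf_gap_nonneg[of \<mu> \<theta>] by simp
  then have "AE k in measure_pmf \<mu>. 1 - cos (real_of_int k * \<theta>) = 0"
    unfolding cf_gap_def
    by (subst (asm) integral_nonneg_eq_0_iff_AE) (auto intro: cf_gap_integrable)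
  then have "AE k in measure_pmf \<mu>. cis (\<theta> * real_of_int k) = 1"
  proof eventually_elim
    case (elim k)
    then have "cos (\<theta> * real_of_int k) = 1" by (simp add: mult.commute)
    moreover from this have "sin (\<theta> * real_of_int k) = 0"
      using sin_cos_squared_add[of "\<theta> * real_of_int k"] by simp
    ultimately show ?case by (simp add: complex_eq_iff)
  qed
  then have "measure_pmf.expectation \<mu> (\<lambda>k. cis (\<theta> * real_of_int k)) = measure_pmf.expectation \<mu> (\<lambda>k. 1)"
    by (intro integral_cong_AE) auto
  then obtain m :: int where m: "\<theta> = 2 * pi * real_of_int m"
    using aperiodic[of \<theta>] by auto
  with \<theta> have "0 < real_of_int m" "2 * real_of_int m \<le> 1"
    by (auto simp: zero_less_mult_iff)
  then have "0 < m" "2 * m \<le> 1" by linarith+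
  then show False by presburger
qed

text \<open>Keep only the displacements k with k\<open>\<theta>\<close> in [1, 2]. That interval
  lies in [0, pi], where cosine decreases, so each of them contributes at least 1 - cos 1.\<close>

lemma cf_gap_ge_prob:
  fixes \<mu> :: "int pmf"
  assumes \<theta>: "0 < \<theta>"
  shows "(1 - cos 1) * measure_pmf.prob \<mu> {k. 1 / \<theta> < real_of_int k \<and> real_of_int k \<le> 2 / \<theta>} \<le> cf_gap \<mu> \<theta>"
proof -
  let ?S = "{k. 1 / \<theta> < real_of_int k \<and> real_of_int k \<le> 2 / \<theta>}"
  have "(1 - cos 1) * measure_pmf.prob \<mu> ?S = (\<integral>k. (1 - cos 1) * indicator ?S k \<partial>measure_pmf \<mu>)"
    by simp
  also have "\<dots> \<le> cf_gap \<mu> \<theta>"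
    unfolding cf_gap_def
  proof (intro integral_mono cf_gap_integrable)
    show "integrable (measure_pmf \<mu>) (\<lambda>k. (1 - cos (1::real)) * indicator ?S k)"
      by (intro integrable_mult_right measure_pmf.integrable_const_bound[where B=1]) (auto split: split_indicator)
    fix k :: int
    show "(1 - cos 1) * indicator ?S k \<le> 1 - cos (real_of_int k * \<theta>)"
    proof (cases "k \<in> ?S")
      case True
      then have "1 \<le> real_of_int k * \<theta>" "real_of_int k * \<theta> \<le> 2" using \<theta> by (auto simp: field_simps)
      then have "cos (real_of_int k * \<theta>) \<le> cos 1"
        using pi_ge_two by (intro cos_monotone_0_pi_le) auto
      then show ?thesis using True by simp
    qed simp
  qed
  finally show ?thesis .
qed

text \<open>Near 0 the tail puts mass of order \<open>\<theta>\<close>^\<beta> on the block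
  (1/\<open>\<theta>\<close>, 2/\<open>\<theta>\<close>], which suffices by
  \<open>cf_gap_ge_prob\<close>. Away from 0 a continuous positive function on a compact interval
  has a positive minimum.\<close>

lemma cf_gap_lower_bound:
  fixes \<mu> :: "int pmf"
  assumes beta: "0 < \<beta>" and cpos: "0 < c_plus"
    and aperiodic: "\<And>t::real. measure_pmf.expectation \<mu> (\<lambda>k. cis (t * real_of_int k)) = 1
                      \<Longrightarrow> (\<exists>m::int. t = 2 * pi * real_of_int m)"
    and right_tail: "((\<lambda>x::real. x powr \<beta> * measure_pmf.prob \<mu> {k. real_of_int k > x})
                      \<longlongrightarrow> c_plus) at_top"
  obtains c where "0 < c" "\<And>\<theta>. 0 \<le> \<theta> \<Longrightarrow> \<theta> \<le> pi \<Longrightarrow> c * \<theta> powr \<beta> \<le> cf_gap \<mu> \<theta>"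
proof -
  define Q where "Q x = measure_pmf.prob \<mu> {k. real_of_int k > x}" for x
  have T1: "((\<lambda>x. x powr \<beta> * Q x) \<longlongrightarrow> c_plus) at_top"
    using right_tail unfolding Q_def .
  have "((\<lambda>x. (2 * x) powr \<beta> * Q (2 * x)) \<longlongrightarrow> c_plus) at_top"
    by (rule filterlim_compose[OF T1])
      (auto intro!: filterlim_tendsto_pos_mult_at_top[OF tendsto_const] filterlim_ident)
  then have "((\<lambda>x. 2 powr (-\<beta>) * ((2 * x) powr \<beta> * Q (2 * x))) \<longlongrightarrow> 2 powr (-\<beta>) * c_plus) at_top"
    by (intro tendsto_intros)
  then have T2: "((\<lambda>x. x powr \<beta> * Q x - 2 powr (-\<beta>) * ((2 * x) powr \<beta> * Q (2 * x))) \<longlongrightarrow> c_plus - 2 powr (-\<beta>) * c_plus) at_top"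
    by (intro tendsto_diff T1)
  \<comment> \<open>Half the limit of x^\<beta> (Q x - Q (2 x)), positive because
    \<open>\<beta>\<close> is.\<close>
  define d where "d = (c_plus - 2 powr (-\<beta>) * c_plus) / 2"
  have "2 powr (-\<beta>) < 1" using beta by (simp add: powr_less_one)
  then have d: "0 < d" using cpos by (simp add: d_def)
  then have "d < c_plus - 2 powr (-\<beta>) * c_plus" by (simp add: d_def mult.commute)
  then have "eventually (\<lambda>x. d < x powr \<beta> * Q x - 2 powr (-\<beta>) * ((2 * x) powr \<beta> * Q (2 * x))) at_top"
    by (rule order_tendstoD(1)[OF T2])
  moreover have "eventually (\<lambda>x::real. 0 < x) at_top" by (rule eventually_gt_at_top)
  ultimately have "eventually (\<lambda>x. d < x powr \<beta> * (Q x - Q (2 * x)) \<and> 0 < x) at_top"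
  proof eventually_elim
    case (elim x)
    then have "2 powr (-\<beta>) * ((2 * x) powr \<beta> * Q (2 * x)) = (2 powr (-\<beta>) * 2 powr \<beta>) * x powr \<beta> * Q (2 * x)"
      by (simp add: powr_mult)
    also have "\<dots> = x powr \<beta> * Q (2 * x)" by (simp flip: powr_add)
    finally show ?case using elim by (simp only: right_diff_distrib simp_thms)
  qed
  then obtain X where X: "\<And>x. X \<le> x \<Longrightarrow> d < x powr \<beta> * (Q x - Q (2 * x)) \<and> 0 < x"
    by (auto simp: eventually_at_top_linorder)
  have X0: "0 < X" using X[of X] by simp
  have near: "(1 - cos 1) * d * \<theta> powr \<beta> \<le> cf_gap \<mu> \<theta>" if "0 < \<theta>" "\<theta> \<le> 1 / X" for \<theta>
  proof -
    have "X \<le> 1 / \<theta>" using that X0 by (simp add: field_simps)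
    then have "d < (1 / \<theta>) powr \<beta> * (Q (1 / \<theta>) - Q (2 / \<theta>))" using X[of "1 / \<theta>"] by simp
    then have "d * \<theta> powr \<beta> \<le> Q (1 / \<theta>) - Q (2 / \<theta>)"
      using that by (simp add: powr_divide field_simps)
    also have "\<dots> = measure_pmf.prob \<mu> ({k. real_of_int k > 1 / \<theta>} - {k. real_of_int k > 2 / \<theta>})"
      unfolding Q_def using that
      by (subst measure_pmf.finite_measure_Diff) (auto simp: field_simps)
    also have "{k::int. real_of_int k > 1 / \<theta>} - {k. real_of_int k > 2 / \<theta>} = {k. 1 / \<theta> < real_of_int k \<and> real_of_int k \<le> 2 / \<theta>}"
      by auto
    finally have "(1 - cos 1) * (d * \<theta> powr \<beta>) \<le> (1 - cos 1) * measure_pmf.prob \<mu> {k. 1 / \<theta> < real_of_int k \<and> real_of_int k \<le> 2 / \<theta>}"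
      by (intro mult_left_mono) auto
    also have "\<dots> \<le> cf_gap \<mu> \<theta>" by (rule cf_gap_ge_prob) fact
    finally show ?thesis by simp
  qed
  define \<theta>\<^sub>0 where "\<theta>\<^sub>0 = min (1 / X) pi"
  have \<theta>0: "0 < \<theta>\<^sub>0" "\<theta>\<^sub>0 \<le> pi" using X0 by (auto simp: \<theta>\<^sub>0_def)
  have "continuous_on {\<theta>\<^sub>0..pi} (cf_gap \<mu>)"
    by (intro continuous_at_imp_continuous_on ballI isCont_cf_gap)
  then obtain \<theta>1 where \<theta>1: "\<theta>1 \<in> {\<theta>\<^sub>0..pi}" "\<And>\<theta>. \<theta> \<in> {\<theta>\<^sub>0..pi} \<Longrightarrow> cf_gap \<mu> \<theta>1 \<le> cf_gap \<mu> \<theta>"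
    using continuous_attains_inf[of "{\<theta>\<^sub>0..pi}" "cf_gap \<mu>"] \<theta>0
    by (auto simp del: atLeastAtMost_iff)
  define m where "m = cf_gap \<mu> \<theta>1"
  have m: "0 < m" unfolding m_def using \<theta>0 \<theta>1 by (intro cf_gap_pos aperiodic) auto
  define c where "c = min ((1 - cos 1) * d) (m / pi powr \<beta>)"
  have "cos (1::real) < cos 0" by (rule cos_monotone_0_pi) (use pi_ge_two in auto)
  then have c0: "0 < c" using d m by (simp add: c_def)
  have "c * \<theta> powr \<beta> \<le> cf_gap \<mu> \<theta>" if \<theta>: "0 \<le> \<theta>" "\<theta> \<le> pi" for \<theta>
  proof -
    consider "\<theta> = 0" | "0 < \<theta>" "\<theta> \<le> \<theta>\<^sub>0" | "\<theta>\<^sub>0 \<le> \<theta>" using \<theta> by linarith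
    then show ?thesis
    proof cases
      case 1 then show ?thesis using beta cf_gap_nonneg by simp
    next
      case 2
      have "c * \<theta> powr \<beta> \<le> (1 - cos 1) * d * \<theta> powr \<beta>"
        by (intro mult_right_mono) (auto simp: c_def)
      also have "\<dots> \<le> cf_gap \<mu> \<theta>" using 2 by (intro near) (auto simp: \<theta>\<^sub>0_def)
      finally show ?thesis .
    next
      case 3
      have "c * \<theta> powr \<beta> \<le> (m / pi powr \<beta>) * pi powr \<beta>"
        using beta \<theta> c0 m by (intro mult_mono powr_mono2) (auto simp: c_def)
      also have "\<dots> = m" by simp
      also have "\<dots> \<le> cf_gap \<mu> \<theta>" unfolding m_def using 3 \<theta> by (intro \<theta>1) auto
      finally show ?thesis .
    qed
  qed
  with c0 show ?thesis using that by blast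
qed

text \<open>Interpolation between the bounds 4 and u^2: the first serves for |u| at least 1, the
  second is below |u|^\<kappa> for smaller u because \<open>\<kappa>\<close> is at most 2.\<close>

lemma one_minus_cos_le_powr:
  fixes u \<kappa> :: real
  assumes "0 \<le> \<kappa>" "\<kappa> \<le> 2"
  shows "2 - 2 * cos u \<le> 4 * \<bar>u\<bar> powr \<kappa>"
proof (cases "1 \<le> \<bar>u\<bar>")
  case True
  then have "1 \<le> \<bar>u\<bar> powr \<kappa>" using assms by (simp add: ge_one_powr_ge_zero)
  then show ?thesis using cos_ge_minus_one[of u] by linarith
next
  case False
  have "(sin (u/2))\<^sup>2 \<le> (u/2)\<^sup>2"
    using abs_sin_x_le_abs_x[of "u/2"] unfolding abs_le_square_iff .
  moreover have "cos u = 1 - 2 * (sin (u/2))\<^sup>2"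
    using cos_double_sin[of "u/2"] by simp
  ultimately have "2 - 2 * cos u \<le> \<bar>u\<bar>\<^sup>2" by (simp add: power_divide)
  also have "\<bar>u\<bar>\<^sup>2 \<le> \<bar>u\<bar> powr \<kappa>"
  proof (cases "u = 0")
    case False
    then have "\<bar>u\<bar>\<^sup>2 = \<bar>u\<bar> powr 2" by (simp add: powr_numeral)
    also have "\<dots> \<le> \<bar>u\<bar> powr \<kappa>"
      using \<open>\<not> 1 \<le> \<bar>u\<bar>\<close> assms False by (intro powr_mono') auto
    finally show ?thesis .
  qed simp
  also have "\<dots> \<le> 4 * \<bar>u\<bar> powr \<kappa>" by simp
  finally show ?thesis .
qed

lemma integrable_half_circle_powr:
  assumes "-1 < a"
  shows "integrable half_circle (\<lambda>\<theta>. \<theta> powr a)"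
proof -
  have "integrable lborel (\<lambda>x. indicator {0..pi} x * x powr a)"
  proof (rule integrableI_nonneg)
    have "(\<integral>\<^sup>+x. ennreal (indicator {0..pi} x * x powr a) \<partial>lborel) = ennreal (pi powr (a + 1) / (a + 1))"
      using assms by (intro nn_integral_has_integral_lebesgue has_integral_powr_from_0) auto
    then show "(\<integral>\<^sup>+x. ennreal (indicator {0..pi} x * x powr a) \<partial>lborel) < \<infinity>" by simp
  qed auto
  then have "integrable lborel (\<lambda>x. (1 / pi) * (indicator {0..pi} x * x powr a))"
    by (rule integrable_mult_right)
  then show ?thesis
    unfolding half_circle_def by (subst integrable_real_density) (auto simp: field_simps)
qed

text \<open>Young's inequality with a free weight, read off from the square of 2 q u - a.\<close>

lemma mult_le_weighted_squares:
  fixes u a q :: real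
  assumes "0 < q"
  shows "u * a \<le> q * u\<^sup>2 + a\<^sup>2 / (4 * q)"
proof -
  have "0 \<le> (2 * q * u - a)\<^sup>2" by simp
  then have "4 * q * (u * a) \<le> 4 * q * (q * u\<^sup>2 + a\<^sup>2 / (4 * q))"
    using assms by (simp add: power2_eq_square algebra_simps)
  then show ?thesis using assms by (subst (asm) mult_le_cancel_left_pos) auto
qed

text \<open>Fourier inversion expresses f x - f y as an integral of the transform against a
  difference of characters. Young's inequality with weight s times the gap splits it into s times
  the energy and a multiple of the integral of \<open>\<theta>\<close>^(\<kappa>-\<beta>), finite
  exactly because \<open>\<kappa>\<close> exceeds \<beta> - 1. Optimising s would give a Hoelder
  seminorm of order \<kappa>/2; leaving s free avoids square roots. The constant depends neither on
  \<open>L\<close> nor on f.\<close>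

lemma holder_energy:
  fixes \<mu> :: "int pmf"
  assumes c: "0 < c" "\<And>\<theta>. 0 \<le> \<theta> \<Longrightarrow> \<theta> \<le> pi \<Longrightarrow> c * \<theta> powr \<beta> \<le> cf_gap \<mu> \<theta>"
    and \<kappa>: "\<beta> - 1 < \<kappa>" "0 \<le> \<kappa>" "\<kappa> \<le> 2"
  obtains C where "0 \<le> C"
    "\<And>L f x y s. finite L \<Longrightarrow> (\<And>z. z \<notin> L \<Longrightarrow> f z = 0) \<Longrightarrow> 0 < s \<Longrightarrow>
      f x - f y \<le> s * energy \<mu> L f + C * \<bar>real_of_int (x - y)\<bar> powr \<kappa> / s"
proof
  define I0 where "I0 = (\<integral>\<theta>. \<theta> powr (\<kappa> - \<beta>) \<partial>half_circle)"
  have int0: "integrable half_circle (\<lambda>\<theta>. \<theta> powr (\<kappa> - \<beta>))"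
    using \<kappa> by (intro integrable_half_circle_powr) auto
  show "0 \<le> I0 / c" using c unfolding I0_def by (intro divide_nonneg_pos integral_nonneg_AE) auto
  fix L :: "int set" and f :: "int \<Rightarrow> real" and x y :: int and s :: real
  assume L: "finite L" and f: "\<And>z. z \<notin> L \<Longrightarrow> f z = 0" and s: "0 < s"
  have int_cos: "integrable half_circle (\<lambda>\<theta>. \<Sum>z\<in>L. f z * cos (real_of_int (z - w) * \<theta>))" for w
    by (intro Bochner_Integration.integrable_sum integrable_mult_right integrable_half_circle_bounded[where B=1]) auto
  have inv: "f w = (\<integral>\<theta>. (\<Sum>z\<in>L. f z * cos (real_of_int (z - w) * \<theta>)) \<partial>half_circle)" for w
  proof -
    have "(\<integral>\<theta>. (\<Sum>z\<in>L. f z * cos (real_of_int (z - w) * \<theta>)) \<partial>half_circle) = (\<Sum>z\<in>L. f z * (if z - w = 0 then 1 else 0))"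
      unfolding integral_cos_half_circle[symmetric]
      by (subst Bochner_Integration.integral_sum)
        (auto intro!: integrable_mult_right integrable_half_circle_bounded[where B=1])
    also have "\<dots> = (\<Sum>z\<in>L. if z = w then f z else 0)" by (intro sum.cong) auto
    also have "\<dots> = f w" using L f by (simp add: sum.delta)
    finally show ?thesis by simp
  qed
  have "f x - f y = (\<integral>\<theta>. (\<Sum>z\<in>L. f z * cos (real_of_int (z - x) * \<theta>)) - (\<Sum>z\<in>L. f z * cos (real_of_int (z - y) * \<theta>)) \<partial>half_circle)"
    by (subst (1 2) inv, rule Bochner_Integration.integral_diff[symmetric]) (rule int_cos)+
  also have "\<dots> \<le> (\<integral>\<theta>. s * (fourier_sq L f \<theta> * cf_gap \<mu> \<theta>) + \<bar>real_of_int (x - y)\<bar> powr \<kappa> / (s * c) * \<theta> powr (\<kappa> - \<beta>) \<partial>half_circle)"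
  proof (rule integral_mono_AE)
    show "integrable half_circle (\<lambda>\<theta>. (\<Sum>z\<in>L. f z * cos (real_of_int (z - x) * \<theta>)) - (\<Sum>z\<in>L. f z * cos (real_of_int (z - y) * \<theta>)))"
      by (intro Bochner_Integration.integrable_diff int_cos)
    show "integrable half_circle (\<lambda>\<theta>. s * (fourier_sq L f \<theta> * cf_gap \<mu> \<theta>) + \<bar>real_of_int (x - y)\<bar> powr \<kappa> / (s * c) * \<theta> powr (\<kappa> - \<beta>))"
      by (intro Bochner_Integration.integrable_add integrable_mult_right energy_eq_fourier(2) L int0)
    show "AE \<theta> in half_circle. (\<Sum>z\<in>L. f z * cos (real_of_int (z - x) * \<theta>)) - (\<Sum>z\<in>L. f z * cos (real_of_int (z - y) * \<theta>))
      \<le> s * (fourier_sq L f \<theta> * cf_gap \<mu> \<theta>) + \<bar>real_of_int (x - y)\<bar> powr \<kappa> / (s * c) * \<theta> powr (\<kappa> - \<beta>)"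
      using AE_half_circle
    proof eventually_elim
      case (elim \<theta>)
      define p q where "p = (\<Sum>z\<in>L. f z * cos (real_of_int z * \<theta>))" and "q = (\<Sum>z\<in>L. f z * sin (real_of_int z * \<theta>))"
      define a b where "a = cos (real_of_int x * \<theta>) - cos (real_of_int y * \<theta>)"
        and "b = sin (real_of_int x * \<theta>) - sin (real_of_int y * \<theta>)"
      have tr: "(\<Sum>z\<in>L. f z * cos (real_of_int (z - w) * \<theta>)) = p * cos (real_of_int w * \<theta>) + q * sin (real_of_int w * \<theta>)" for w
        unfolding p_def q_def sum_distrib_right sum.distrib[symmetric]
        by (intro sum.cong refl) (simp add: left_diff_distrib cos_diff algebra_simps)
      have lhs: "(\<Sum>z\<in>L. f z * cos (real_of_int (z - x) * \<theta>)) - (\<Sum>z\<in>L. f z * cos (real_of_int (z - y) * \<theta>)) = p * a + q * b"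
        unfolding tr a_def b_def by (simp add: algebra_simps)
      have fs: "fourier_sq L f \<theta> = p\<^sup>2 + q\<^sup>2" by (simp add: fourier_sq_def p_def q_def)
      show ?case
      \<comment> \<open>The Young weight \<open>s * w\<close> may vanish at \<open>\<theta>\<close>
        = 0, but there both characters agree and the left side is 0.\<close>
      proof (cases "\<theta> = 0")
        case True
        then have "p * a + q * b = 0" by (simp add: a_def b_def)
        then show ?thesis unfolding lhs using s c fourier_sq_nonneg cf_gap_nonneg by simp
      next
        case False
        then have th: "0 < \<theta>" "0 < c * \<theta> powr \<beta>" using elim c by auto
        define w where "w = cf_gap \<mu> \<theta>"
        have w: "c * \<theta> powr \<beta> \<le> w" "0 < w" unfolding w_def using c(2)[of \<theta>] elim th by auto
        have sw: "0 < s * w" using s w by simp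
        \<comment> \<open>The squared distance between the characters of x and y at
          \<open>\<theta>\<close>.\<close>
        have "a\<^sup>2 + b\<^sup>2 = ((cos (real_of_int x * \<theta>))\<^sup>2 + (sin (real_of_int x * \<theta>))\<^sup>2)
            + ((cos (real_of_int y * \<theta>))\<^sup>2 + (sin (real_of_int y * \<theta>))\<^sup>2)
            - 2 * (cos (real_of_int x * \<theta>) * cos (real_of_int y * \<theta>) + sin (real_of_int x * \<theta>) * sin (real_of_int y * \<theta>))"
          unfolding a_def b_def by (simp only: power2_diff) (simp add: algebra_simps)
        also have "\<dots> = 2 - 2 * cos (real_of_int (x - y) * \<theta>)"
          by (simp add: left_diff_distrib cos_diff)
        also have "\<dots> \<le> 4 * \<bar>real_of_int (x - y) * \<theta>\<bar> powr \<kappa>"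
          using \<kappa> by (intro one_minus_cos_le_powr) auto
        also have "\<dots> = 4 * (\<bar>real_of_int (x - y)\<bar> powr \<kappa> * \<theta> powr \<kappa>)"
          using th by (simp add: abs_mult powr_mult)
        finally have ab: "a\<^sup>2 + b\<^sup>2 \<le> 4 * (\<bar>real_of_int (x - y)\<bar> powr \<kappa> * \<theta> powr \<kappa>)" .
        have "p * a + q * b \<le> ((s * w) * p\<^sup>2 + a\<^sup>2 / (4 * (s * w))) + ((s * w) * q\<^sup>2 + b\<^sup>2 / (4 * (s * w)))"
          by (intro add_mono mult_le_weighted_squares sw)
        also have "\<dots> = s * (fourier_sq L f \<theta> * w) + (a\<^sup>2 + b\<^sup>2) / (4 * (s * w))"
          by (simp add: fs algebra_simps add_divide_distrib)
        also have "(a\<^sup>2 + b\<^sup>2) / (4 * (s * w)) \<le> 4 * (\<bar>real_of_int (x - y)\<bar> powr \<kappa> * \<theta> powr \<kappa>) / (4 * (s * (c * \<theta> powr \<beta>)))"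
          using ab w s th by (intro frac_le mult_left_mono) auto
        also have "\<dots> = \<bar>real_of_int (x - y)\<bar> powr \<kappa> / (s * c) * \<theta> powr (\<kappa> - \<beta>)"
          by (simp add: powr_diff)
        finally show ?thesis unfolding lhs w_def by simp
      qed
    qed
  qed
  also have "\<dots> = s * energy \<mu> L f + \<bar>real_of_int (x - y)\<bar> powr \<kappa> / (s * c) * I0"
    unfolding I0_def energy_eq_fourier(1)[OF L]
    by (subst Bochner_Integration.integral_add)
      (auto intro!: integrable_mult_right energy_eq_fourier(2) L int0)
  finally show "f x - f y \<le> s * energy \<mu> L f + I0 / c * \<bar>real_of_int (x - y)\<bar> powr \<kappa> / s"
    by (simp add: field_simps)
qed

subsection \<open>First-step decomposition\<close>

abbreviation expo :: "real measure" where
  "expo \<equiv> density lborel (exponential_density 1)"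

lemma prob_space_expo: "prob_space expo"
  by (rule prob_space_exponential_density) simp

lemma nn_integral_expo:
  assumes [measurable]: "F \<in> borel_measurable borel"
  shows "(\<integral>\<^sup>+u. F u \<partial>expo) = (\<integral>\<^sup>+u. ennreal (exp (- u)) * indicator {0..} u * F u \<partial>lborel)"
  by (subst nn_integral_density)
    (auto intro!: nn_integral_cong simp: exponential_density_def split: split_indicator)

lemma nn_integral_exp_minus_atLeast:
  assumes "0 < (b::real)"
  shows "(\<integral>\<^sup>+u. ennreal (exp (- b * u)) * indicator {a..} u \<partial>lborel) = ennreal (exp (- b * a) / b)"
proof -
  have "((\<lambda>u. exp (- b * u)) \<longlongrightarrow> 0) at_top"
    using assms
    by (intro filterlim_compose[OF exp_at_bot] filterlim_tendsto_neg_mult_at_bot[OF tendsto_const]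
        filterlim_ident) auto
  then have "((\<lambda>u. - exp (- b * u) / b) \<longlongrightarrow> - 0 / b) at_top"
    using assms by (intro tendsto_intros) auto
  then have "(\<integral>\<^sup>+u. ennreal (exp (- b * u)) * indicator {a..} u \<partial>lborel) = ennreal (- 0 / b - - exp (- b * a) / b)"
    using assms by (intro nn_integral_FTC_atLeast) (auto intro!: derivative_eq_intros)
  then show ?thesis by simp
qed

lemma nn_integral_expo_tail:
  assumes "0 \<le> a"
  shows "(\<integral>\<^sup>+u. indicator {a..} u \<partial>expo) = ennreal (exp (- a))"
proof -
  have "(\<integral>\<^sup>+u. indicator {a..} u \<partial>expo) = (\<integral>\<^sup>+u. ennreal (exp (- 1 * u)) * indicator {a..} u \<partial>lborel)"
    using assms by (subst nn_integral_expo) (auto intro!: nn_integral_cong split: split_indicator)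
  also have "\<dots> = ennreal (exp (- a))"
    by (subst nn_integral_exp_minus_atLeast) auto
  finally show ?thesis .
qed

lemma nn_integral_expo_exp:
  assumes "0 \<le> q"
  shows "(\<integral>\<^sup>+u. ennreal (exp (- q * u)) \<partial>expo) = inverse (1 + ennreal q)"
proof -
  have "(\<integral>\<^sup>+u. ennreal (exp (- q * u)) \<partial>expo) = (\<integral>\<^sup>+u. ennreal (exp (- (1 + q) * u)) * indicator {0..} u \<partial>lborel)"
    by (subst nn_integral_expo)
      (auto intro!: nn_integral_cong simp: algebra_simps exp_add ennreal_mult exp_diff split: split_indicator
        simp flip: ennreal_mult exp_add)
  also have "\<dots> = ennreal (inverse (1 + q))"
    using assms by (subst nn_integral_exp_minus_atLeast) (auto simp: inverse_eq_divide)
  also have "\<dots> = inverse (1 + ennreal q)"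
    using assms by (subst inverse_ennreal[symmetric]) (auto simp: ennreal_plus simp del: ennreal_plus[symmetric])
  finally show ?thesis .
qed

lemma nn_integral_sequence_space:
  fixes M :: "'a measure"
  assumes "prob_space M" and [measurable]: "f \<in> borel_measurable (PiM (UNIV::nat set) (\<lambda>_. M))"
  shows "(\<integral>\<^sup>+\<omega>. f \<omega> \<partial>PiM (UNIV::nat set) (\<lambda>_. M)) =
    (\<integral>\<^sup>+s. (\<integral>\<^sup>+\<omega>. f (case_nat s \<omega>) \<partial>PiM (UNIV::nat set) (\<lambda>_. M)) \<partial>M)"
proof -
  interpret M: prob_space M by fact
  interpret S: sequence_space M ..
  show ?thesis
    by (subst S.PiM_iter[symmetric])
      (simp add: nn_integral_distr S.P.nn_integral_fst[symmetric] case_prod_beta')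
qed


abbreviation steps_space :: "int pmf \<Rightarrow> (nat \<Rightarrow> int) measure" where
  "steps_space \<mu> \<equiv> PiM UNIV (\<lambda>_::nat. measure_pmf \<mu>)"

abbreviation clocks_space :: "(nat \<Rightarrow> real) measure" where
  "clocks_space \<equiv> PiM UNIV (\<lambda>_::nat. expo)"

lemma prob_space_steps: "prob_space (steps_space \<mu>)"
  by (intro prob_space_PiM measure_pmf.prob_space_axioms)

lemma prob_space_clocks: "prob_space clocks_space"
  by (intro prob_space_PiM prob_space_expo)

lemma prob_space_walk_clock: "prob_space (walk_clock_space \<mu>)"
proof -
  interpret steps: prob_space "steps_space \<mu>" by (rule prob_space_steps)
  interpret clocks: prob_space clocks_space by (rule prob_space_clocks)
  interpret P: pair_prob_space "steps_space \<mu>" clocks_space ..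
  show ?thesis unfolding walk_clock_space_def by (rule P.P.prob_space_axioms)
qed

lemma space_walk_clock [simp]: "space (walk_clock_space \<mu>) = UNIV"
  by (simp add: walk_clock_space_def space_pair_measure space_PiM)

text \<open>Markov property at the first jump: split off the first clock u and the first
  displacement k; the remaining steps and clocks are again distributed as
  \<open>walk_clock_space \<mu>\<close>.\<close>

lemma nn_integral_first_step:
  assumes f [measurable]: "f \<in> borel_measurable (walk_clock_space \<mu>)"
  shows "(\<integral>\<^sup>+\<omega>. f \<omega> \<partial>walk_clock_space \<mu>) =
    (\<integral>\<^sup>+u. (\<integral>\<^sup>+k. (\<integral>\<^sup>+\<omega>. f (case_nat k (fst \<omega>), case_nat u (snd \<omega>)) \<partial>walk_clock_space \<mu>) \<partial>measure_pmf \<mu>) \<partial>expo)"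
proof -
  interpret steps: prob_space "steps_space \<mu>" by (rule prob_space_steps)
  interpret clocks: prob_space clocks_space by (rule prob_space_clocks)
  interpret E: prob_space expo by (rule prob_space_expo)
  interpret P: pair_sigma_finite "steps_space \<mu>" clocks_space ..
  interpret Q: pair_sigma_finite expo "steps_space \<mu>" ..
  have f' [measurable]: "f \<in> borel_measurable (steps_space \<mu> \<Otimes>\<^sub>M clocks_space)"
    using f unfolding walk_clock_space_def .
  have "(\<integral>\<^sup>+\<omega>. f \<omega> \<partial>walk_clock_space \<mu>) = (\<integral>\<^sup>+\<epsilon>. (\<integral>\<^sup>+e. f (\<epsilon>, e) \<partial>clocks_space) \<partial>steps_space \<mu>)"
    unfolding walk_clock_space_def by (simp add: clocks.nn_integral_fst)
  also have "\<dots> = (\<integral>\<^sup>+\<epsilon>. (\<integral>\<^sup>+u. (\<integral>\<^sup>+e. f (\<epsilon>, case_nat u e) \<partial>clocks_space) \<partial>expo) \<partial>steps_space \<mu>)"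
    by (intro nn_integral_cong nn_integral_sequence_space prob_space_expo)
      (rule measurable_compose[OF _ f'], simp add: space_PiM)
  also have "\<dots> = (\<integral>\<^sup>+u. (\<integral>\<^sup>+\<epsilon>. (\<integral>\<^sup>+e. f (\<epsilon>, case_nat u e) \<partial>clocks_space) \<partial>steps_space \<mu>) \<partial>expo)"
    by (rule Q.Fubini') measurable
  also have "\<dots> = (\<integral>\<^sup>+u. (\<integral>\<^sup>+k. (\<integral>\<^sup>+\<epsilon>. (\<integral>\<^sup>+e. f (case_nat k \<epsilon>, case_nat u e) \<partial>clocks_space) \<partial>steps_space \<mu>) \<partial>measure_pmf \<mu>) \<partial>expo)"
    by (intro nn_integral_cong nn_integral_sequence_space measure_pmf.prob_space_axioms) measurable
  also have "\<dots> = (\<integral>\<^sup>+u. (\<integral>\<^sup>+k. (\<integral>\<^sup>+\<omega>. f (case_nat k (fst \<omega>), case_nat u (snd \<omega>)) \<partial>walk_clock_space \<mu>) \<partial>measure_pmf \<mu>) \<partial>expo)"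
    unfolding walk_clock_space_def
    by (intro nn_integral_cong, subst clocks.nn_integral_fst[symmetric]) (auto simp: case_prod_beta')
  finally show ?thesis .
qed

lemma emeasure_first_step:
  assumes A: "A \<in> sets (walk_clock_space \<mu>)"
  shows "emeasure (walk_clock_space \<mu>) A =
    (\<integral>\<^sup>+u. (\<integral>\<^sup>+k. emeasure (walk_clock_space \<mu>) {\<omega>. (case_nat k (fst \<omega>), case_nat u (snd \<omega>)) \<in> A} \<partial>measure_pmf \<mu>) \<partial>expo)"
proof -
  have "emeasure (walk_clock_space \<mu>) A = (\<integral>\<^sup>+\<omega>. indicator A \<omega> \<partial>walk_clock_space \<mu>)"
    using A by simp
  also have "\<dots> = (\<integral>\<^sup>+u. (\<integral>\<^sup>+k. (\<integral>\<^sup>+\<omega>. indicator A (case_nat k (fst \<omega>), case_nat u (snd \<omega>)) \<partial>walk_clock_space \<mu>) \<partial>measure_pmf \<mu>) \<partial>expo)"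
    using A by (intro nn_integral_first_step) auto
  also have "\<dots> = (\<integral>\<^sup>+u. (\<integral>\<^sup>+k. (\<integral>\<^sup>+\<omega>. indicator {\<omega>. (case_nat k (fst \<omega>), case_nat u (snd \<omega>)) \<in> A} \<omega> \<partial>walk_clock_space \<mu>) \<partial>measure_pmf \<mu>) \<partial>expo)"
    by (simp add: indicator_def)
  also have "\<dots> = (\<integral>\<^sup>+u. (\<integral>\<^sup>+k. emeasure (walk_clock_space \<mu>) {\<omega>. (case_nat k (fst \<omega>), case_nat u (snd \<omega>)) \<in> A} \<partial>measure_pmf \<mu>) \<partial>expo)"
  proof (intro nn_integral_cong nn_integral_indicator)
    fix u :: real and k :: int
    have "(\<lambda>\<omega>. (case_nat k (fst \<omega>), case_nat u (snd \<omega>))) \<in> walk_clock_space \<mu> \<rightarrow>\<^sub>M walk_clock_space \<mu>"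
      unfolding walk_clock_space_def by measurable
    from measurable_sets[OF this A] show "{\<omega>. (case_nat k (fst \<omega>), case_nat u (snd \<omega>)) \<in> A} \<in> sets (walk_clock_space \<mu>)"
      by (simp add: vimage_def)
  qed
  finally show ?thesis .
qed

lemma measurable_int_add:
  fixes f g :: "'a \<Rightarrow> int"
  assumes [measurable]: "f \<in> M \<rightarrow>\<^sub>M count_space UNIV" "g \<in> M \<rightarrow>\<^sub>M count_space UNIV"
  shows "(\<lambda>x. f x + g x) \<in> M \<rightarrow>\<^sub>M count_space UNIV"
  by (rule measurable_compose_countable[where f="\<lambda>i x. i + g x"]) measurable

lemma measurable_rw_pos [measurable]:
  "(\<lambda>\<omega>. rw_pos (fst \<omega>) n) \<in> walk_clock_space \<mu> \<rightarrow>\<^sub>M count_space UNIV"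
proof (induction n)
  case (Suc n)
  have [measurable]: "(\<lambda>\<omega>. fst \<omega> n) \<in> walk_clock_space \<mu> \<rightarrow>\<^sub>M count_space UNIV"
  proof -
    have "(\<lambda>\<omega>. fst \<omega> n) \<in> walk_clock_space \<mu> \<rightarrow>\<^sub>M measure_pmf \<mu>"
      unfolding walk_clock_space_def by measurable
    then show ?thesis
      using measurable_cong_sets[OF refl sets_measure_pmf_count_space] by blast
  qed
  show ?case unfolding rw_pos_def sum.lessThan_Suc
    using Suc unfolding rw_pos_def by (intro measurable_int_add) auto
qed (simp add: rw_pos_def)

lemma measurable_snd_clock [measurable]:
  "(\<lambda>\<omega>. snd \<omega> n) \<in> borel_measurable (walk_clock_space \<mu>)"
proof -
  have "(\<lambda>\<omega>. snd \<omega> n) \<in> walk_clock_space \<mu> \<rightarrow>\<^sub>M expo"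
    unfolding walk_clock_space_def by measurable
  then show ?thesis by simp
qed

lemma measurable_jump_time [measurable]:
  "(\<lambda>\<omega>. jump_time tau (fst \<omega>) (snd \<omega>) n) \<in> borel_measurable (walk_clock_space \<mu>)"
  unfolding jump_time_def
  by (intro borel_measurable_sum borel_measurable_times measurable_snd_clock
      measurable_compose[OF measurable_rw_pos]) simp

text \<open>Clocks range over all reals, and negative values are excluded only up to a null set.
  Monotonicity of the jump times in n depends on their sign.\<close>

lemma AE_clocks_nonneg: "AE \<omega> in walk_clock_space \<mu>. \<forall>n. 0 \<le> snd \<omega> n"
proof -
  interpret steps: prob_space "steps_space \<mu>" by (rule prob_space_steps)
  interpret clocks: prob_space clocks_space by (rule prob_space_clocks)
  interpret P: pair_sigma_finite "steps_space \<mu>" clocks_space ..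
  have "AE u in expo. 0 \<le> u"
    by (subst AE_density) (auto simp: exponential_density_def intro!: AE_I2)
  then have "AE e in clocks_space. 0 \<le> e n" for n
    by (intro AE_PiM_component prob_space_expo) auto
  then have "AE e in clocks_space. \<forall>n. 0 \<le> e n"
    by (simp add: AE_all_countable)
  then show ?thesis
    unfolding walk_clock_space_def
    by (intro P.AE_pair_measure) (auto intro: AE_I2)
qed

lemma rw_pos_simps [simp]:
  "rw_pos eps 0 = 0" "rw_pos (case_nat k eps) (Suc n) = k + rw_pos eps n"
  by (simp_all add: rw_pos_def sum.lessThan_Suc_shift del: sum.lessThan_Suc)

text \<open>After the first jump the environment is seen from the new position. This is why the
  events below carry a starting point x and use \<open>tau\<close> recentred at x.\<close>

lemma jump_time_simps [simp]:
  "jump_time tau eps e 0 = 0"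
  "jump_time tau (case_nat k eps) (case_nat u e) (Suc n) = tau 0 * u + jump_time (\<lambda>y. tau (k + y)) eps e n"
  by (simp_all add: jump_time_def sum.lessThan_Suc_shift del: sum.lessThan_Suc)

lemma jump_time_mono:
  assumes "\<And>x. 0 \<le> tau x" "\<And>n. 0 \<le> e n" "m \<le> n"
  shows "jump_time tau eps e m \<le> jump_time tau eps e n"
  unfolding jump_time_def using assms by (intro sum_mono2) auto

lemma jump_time_nonneg:
  assumes "\<And>x. 0 \<le> tau x" "\<And>n. 0 \<le> e n"
  shows "0 \<le> jump_time tau eps e n"
  unfolding jump_time_def using assms by (intro sum_nonneg) auto

subsection \<open>Killed heat kernel\<close>

text \<open>Here and in \<open>exit_event\<close> the bound n < N makes induction on the number of
  jumps possible, and requiring nonnegative clocks inside the event makes the first-step inclusions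
  hold pointwise rather than almost surely.\<close>

definition stay_event ::
  "(int \<Rightarrow> real) \<Rightarrow> int set \<Rightarrow> int \<Rightarrow> nat \<Rightarrow> int \<Rightarrow> real \<Rightarrow> ((nat \<Rightarrow> int) \<times> (nat \<Rightarrow> real)) set" where
  "stay_event tau L i N x t = {\<omega>. (\<forall>n. 0 \<le> snd \<omega> n) \<and> (\<exists>n<N. x + rw_pos (fst \<omega>) n = i \<and>
     (\<forall>m\<le>n. x + rw_pos (fst \<omega>) m \<in> L) \<and>
     jump_time (\<lambda>y. tau (x + y)) (fst \<omega>) (snd \<omega>) n \<le> t \<and>
     t < jump_time (\<lambda>y. tau (x + y)) (fst \<omega>) (snd \<omega>) (Suc n))}"

definition exit_event ::
  "(int \<Rightarrow> real) \<Rightarrow> int set \<Rightarrow> nat \<Rightarrow> int \<Rightarrow> real \<Rightarrow> ((nat \<Rightarrow> int) \<times> (nat \<Rightarrow> real)) set" where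
  "exit_event tau L N x t = {\<omega>. (\<forall>n. 0 \<le> snd \<omega> n) \<and> (\<exists>n<N. x + rw_pos (fst \<omega>) n \<notin> L \<and>
     jump_time (\<lambda>y. tau (x + y)) (fst \<omega>) (snd \<omega>) n \<le> t)}"

lemma measurable_rw_pos_pred [measurable]:
  "Measurable.pred (walk_clock_space \<mu>) (\<lambda>\<omega>. P (rw_pos (fst \<omega>) n))"
  by (rule measurable_compose[OF measurable_rw_pos]) simp

lemma stay_event_sets [measurable]: "stay_event tau L i N x t \<in> sets (walk_clock_space \<mu>)"
proof -
  have "Measurable.pred (walk_clock_space \<mu>) (\<lambda>\<omega>. (\<forall>n. 0 \<le> snd \<omega> n) \<and> (\<exists>n<N. x + rw_pos (fst \<omega>) n = i \<and>
     (\<forall>m\<le>n. x + rw_pos (fst \<omega>) m \<in> L) \<and>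
     jump_time (\<lambda>y. tau (x + y)) (fst \<omega>) (snd \<omega>) n \<le> t \<and>
     t < jump_time (\<lambda>y. tau (x + y)) (fst \<omega>) (snd \<omega>) (Suc n)))"
    by measurable
  then show ?thesis by (simp add: pred_def stay_event_def)
qed

lemma exit_event_sets [measurable]: "exit_event tau L N x t \<in> sets (walk_clock_space \<mu>)"
proof -
  have "Measurable.pred (walk_clock_space \<mu>) (\<lambda>\<omega>. (\<forall>n. 0 \<le> snd \<omega> n) \<and> (\<exists>n<N. x + rw_pos (fst \<omega>) n \<notin> L \<and>
     jump_time (\<lambda>y. tau (x + y)) (fst \<omega>) (snd \<omega>) n \<le> t))"
    by measurable
  then show ?thesis by (simp add: pred_def exit_event_def)
qed

lemma case_nat_nonneg_iff: "(\<forall>n. 0 \<le> case_nat u e n) \<longleftrightarrow> 0 \<le> (u::real) \<and> (\<forall>n. 0 \<le> e n)"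
proof safe
  assume h: "\<forall>n. 0 \<le> case_nat u e n"
  show "0 \<le> u" using spec[OF h, of 0] by simp
  show "0 \<le> e n" for n using spec[OF h, of "Suc n"] by simp
qed (auto split: nat.split)

text \<open>Either the first holding time outlasts t, which forces x = i, or the walk jumps at time
  \<open>tau x * u\<close> to a site of \<open>L\<close> and must stay and reach i in the remaining
  time.\<close>

lemma stay_event_Suc_subset:
  assumes tau: "\<And>x. 0 < tau x"
  shows "{\<omega>. (case_nat k (fst \<omega>), case_nat u (snd \<omega>)) \<in> stay_event tau L i (Suc N) x t} \<subseteq>
    (if x = i \<and> t < tau x * u then UNIV else {}) \<union>
    (if 0 \<le> u \<and> tau x * u \<le> t \<and> x + k \<in> L then stay_event tau L i N (x + k) (t - tau x * u) else {})"
proof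
  fix \<omega> assume "\<omega> \<in> {\<omega>. (case_nat k (fst \<omega>), case_nat u (snd \<omega>)) \<in> stay_event tau L i (Suc N) x t}"
  then obtain n where n: "n < Suc N" and u: "0 \<le> u" and e: "\<And>n. 0 \<le> snd \<omega> n"
    and at: "x + rw_pos (case_nat k (fst \<omega>)) n = i"
    and stay: "\<And>m. m \<le> n \<Longrightarrow> x + rw_pos (case_nat k (fst \<omega>)) m \<in> L"
    and lo: "jump_time (\<lambda>y. tau (x + y)) (case_nat k (fst \<omega>)) (case_nat u (snd \<omega>)) n \<le> t"
    and hi: "t < jump_time (\<lambda>y. tau (x + y)) (case_nat k (fst \<omega>)) (case_nat u (snd \<omega>)) (Suc n)"
    by (auto simp: stay_event_def case_nat_nonneg_iff simp del: jump_time_simps)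
  show "\<omega> \<in> (if x = i \<and> t < tau x * u then UNIV else {}) \<union>
    (if 0 \<le> u \<and> tau x * u \<le> t \<and> x + k \<in> L then stay_event tau L i N (x + k) (t - tau x * u) else {})"
  proof (cases n)
    case 0
    then show ?thesis using at hi by simp
  next
    case (Suc m)
    have "0 \<le> jump_time (\<lambda>y. tau (x + (k + y))) (fst \<omega>) (snd \<omega>) m"
      using tau e by (intro jump_time_nonneg) (auto simp: less_imp_le)
    moreover have "x + k \<in> L" using stay[of "Suc 0"] Suc by simp
    moreover have "x + k + rw_pos (fst \<omega>) l \<in> L" if "l \<le> m" for l
      using stay[of "Suc l"] that Suc by (simp add: add.assoc)
    ultimately show ?thesis
      using n at lo hi u e Suc by (auto simp: stay_event_def add.assoc intro!: exI[of _ m])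
  qed
qed

text \<open>From a start inside \<open>L\<close> the exit index cannot be 0, so the first jump has
  already happened.\<close>

lemma exit_event_Suc_subset:
  assumes tau: "\<And>x. 0 < tau x" and x: "x \<in> L"
  shows "{\<omega>. (case_nat k (fst \<omega>), case_nat u (snd \<omega>)) \<in> exit_event tau L (Suc N) x t} \<subseteq>
    (if 0 \<le> u \<and> tau x * u \<le> t then exit_event tau L N (x + k) (t - tau x * u) else {})"
proof
  fix \<omega> assume "\<omega> \<in> {\<omega>. (case_nat k (fst \<omega>), case_nat u (snd \<omega>)) \<in> exit_event tau L (Suc N) x t}"
  then obtain n where n: "n < Suc N" and u: "0 \<le> u" and e: "\<And>n. 0 \<le> snd \<omega> n"
    and out: "x + rw_pos (case_nat k (fst \<omega>)) n \<notin> L"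
    and lo: "jump_time (\<lambda>y. tau (x + y)) (case_nat k (fst \<omega>)) (case_nat u (snd \<omega>)) n \<le> t"
    by (auto simp: exit_event_def case_nat_nonneg_iff simp del: jump_time_simps)
  obtain m where Suc: "n = Suc m" using out x by (cases n) auto
  have "0 \<le> jump_time (\<lambda>y. tau (x + (k + y))) (fst \<omega>) (snd \<omega>) m"
    using tau e by (intro jump_time_nonneg) (auto simp: less_imp_le)
  then show "\<omega> \<in> (if 0 \<le> u \<and> tau x * u \<le> t then exit_event tau L N (x + k) (t - tau x * u) else {})"
    using n out lo u e Suc by (auto simp: exit_event_def add.assoc intro!: exI[of _ m])
qed

lemma nn_integral_pmf_box:
  assumes L: "finite L" and g: "\<And>y. y \<in> L \<Longrightarrow> 0 \<le> g y"
  shows "(\<integral>\<^sup>+k. indicator L (x + k) * ennreal (g (x + k)) \<partial>measure_pmf \<mu>) = ennreal (box_avg \<mu> L g x)"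
proof -
  have "(\<integral>\<^sup>+k. indicator L (x + k) * ennreal (g (x + k)) \<partial>measure_pmf \<mu>) =
    (\<integral>\<^sup>+k. (\<Sum>y\<in>L. ennreal (g y) * indicator {y - x} k) \<partial>measure_pmf \<mu>)"
  proof (intro nn_integral_cong)
    fix k
    have "(\<Sum>y\<in>L. ennreal (g y) * indicator {y - x} k) = (\<Sum>y\<in>L. if y = x + k then ennreal (g y) else 0)"
      by (intro sum.cong) (auto simp: indicator_def)
    also have "\<dots> = indicator L (x + k) * ennreal (g (x + k))"
      using L by (simp add: sum.delta indicator_def)
    finally show "indicator L (x + k) * ennreal (g (x + k)) = (\<Sum>y\<in>L. ennreal (g y) * indicator {y - x} k)" by simp
  qed
  also have "\<dots> = (\<Sum>y\<in>L. ennreal (g y) * ennreal (pmf \<mu> (y - x)))"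
    by (subst nn_integral_sum) (auto simp: emeasure_pmf_single nn_integral_cmult_indicator)
  also have "\<dots> = ennreal (box_avg \<mu> L g x)"
    unfolding box_avg_def using g
    by (subst sum_ennreal[symmetric]) (auto intro!: sum.cong simp: mult.commute ennreal_mult)
  finally show ?thesis .
qed

text \<open>Induction on the number of jumps. The first-step bound is exp(-b) for surviving at x =
  i, plus the integral over [0, b] of exp(-u) times the average of \<open>v\<close> at the remaining
  time. By \<open>v_deriv\<close> this integrand is the derivative of -exp(-u)
  \<open>v i (t - tau x * u) x\<close>, so the total is exactly \<open>v i t x\<close>.\<close>

lemma (in trap_box) emeasure_stay_event_le:
  assumes tau: "\<And>x. 0 < tau x"
  shows "x \<in> L \<Longrightarrow> 0 \<le> t \<Longrightarrow> emeasure (walk_clock_space \<mu>) (stay_event tau L i N x t) \<le> ennreal (v i t x)"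
proof (induction N arbitrary: x t)
  case 0
  then show ?case by (simp add: stay_event_def)
next
  case (Suc N)
  let ?W = "walk_clock_space \<mu>"
  interpret W: prob_space ?W by (rule prob_space_walk_clock)
  \<comment> \<open>The remaining time measured in units of the mean holding time at x.\<close>
  define b where "b = t / tau x"
  have tx: "0 < tau x" by (rule tau)
  have b: "0 \<le> b" "\<And>u. tau x * u \<le> t \<longleftrightarrow> u \<le> b"
    using Suc.prems tx by (auto simp: b_def field_simps)
  define f where "f u = exp (- u) * A (v i (t - tau x * u)) x" for u
  have cont_v: "continuous_on UNIV (\<lambda>u. v i (t - tau x * u) y)" if "y \<in> L" for y
  proof (rule continuous_on_compose2[of UNIV "\<lambda>t. v i t y"])
    show "continuous_on UNIV (\<lambda>t. v i t y)"
      by (intro continuous_at_imp_continuous_on ballI DERIV_isCont[OF v_deriv[OF that]])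
  qed (auto intro!: continuous_intros)
  then have "continuous_on UNIV (\<lambda>u. A (v i (t - tau x * u)) x)"
    unfolding box_avg_def by (intro continuous_intros) auto
  then have A_meas [measurable]: "(\<lambda>u. A (v i (t - tau x * u)) x) \<in> borel_measurable borel"
    by (rule borel_measurable_continuous_onI)
  have A_nonneg: "0 \<le> A (v i (t - tau x * u)) x" if "u \<le> b" for u
    using that b by (intro box_avg_nonneg v_nonneg) (auto simp: algebra_simps)
  have der: "((\<lambda>u. - exp (- u) * v i (t - tau x * u) x) has_real_derivative f u) (at u)" for u
  proof -
    have "((\<lambda>u. v i (t - tau x * u) x) has_real_derivative
        (A (v i (t - tau x * u)) x - v i (t - tau x * u) x) / tau x * (- tau x)) (at u)"
      by (rule DERIV_chain2[OF v_deriv]) (use Suc.prems in \<open>auto intro!: derivative_eq_intros\<close>)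
    then have "((\<lambda>u. v i (t - tau x * u) x) has_real_derivative v i (t - tau x * u) x - A (v i (t - tau x * u)) x) (at u)"
      using tx by simp
    then show ?thesis
      unfolding f_def by (auto intro!: derivative_eq_intros simp: algebra_simps)
  qed
  have "emeasure ?W (stay_event tau L i (Suc N) x t) \<le>
    (\<integral>\<^sup>+u. (\<integral>\<^sup>+k. ennreal (if x = i then 1 else 0) * indicator {b..} u +
        indicator {0..b} u * (indicator L (x + k) * ennreal (v i (t - tau x * u) (x + k))) \<partial>measure_pmf \<mu>) \<partial>expo)"
    unfolding emeasure_first_step[OF stay_event_sets]
  proof (intro nn_integral_mono)
    fix u k
    let ?A1 = "if x = i \<and> t < tau x * u then UNIV else {} :: ((nat \<Rightarrow> int) \<times> (nat \<Rightarrow> real)) set"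
    let ?A2 = "if 0 \<le> u \<and> tau x * u \<le> t \<and> x + k \<in> L then stay_event tau L i N (x + k) (t - tau x * u) else {}"
    have sets12: "?A1 \<in> sets ?W" "?A2 \<in> sets ?W"
      using sets.top[of ?W] by auto
    have "emeasure ?W {\<omega>. (case_nat k (fst \<omega>), case_nat u (snd \<omega>)) \<in> stay_event tau L i (Suc N) x t} \<le> emeasure ?W (?A1 \<union> ?A2)"
      by (intro emeasure_mono stay_event_Suc_subset tau sets.Un sets12)
    also have "\<dots> \<le> emeasure ?W ?A1 + emeasure ?W ?A2"
      by (intro emeasure_subadditive sets12)
    also have "\<dots> \<le> ennreal (if x = i then 1 else 0) * indicator {b..} u +
        indicator {0..b} u * (indicator L (x + k) * ennreal (v i (t - tau x * u) (x + k)))"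
    proof (rule add_mono)
      show "emeasure ?W ?A1 \<le> ennreal (if x = i then 1 else 0) * indicator {b..} u"
        using b(2)[of u] W.emeasure_space_1 by (auto split: split_indicator)
      show "emeasure ?W ?A2 \<le> indicator {0..b} u * (indicator L (x + k) * ennreal (v i (t - tau x * u) (x + k)))"
        using b(2)[of u] Suc.IH[of "x + k" "t - tau x * u"] by (auto split: split_indicator)
    qed
    finally show "emeasure ?W {\<omega>. (case_nat k (fst \<omega>), case_nat u (snd \<omega>)) \<in> stay_event tau L i (Suc N) x t} \<le>
      ennreal (if x = i then 1 else 0) * indicator {b..} u +
        indicator {0..b} u * (indicator L (x + k) * ennreal (v i (t - tau x * u) (x + k)))" .
  qed
  also have "\<dots> = (\<integral>\<^sup>+u. ennreal (if x = i then 1 else 0) * indicator {b..} u +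
      indicator {0..b} u * ennreal (A (v i (t - tau x * u)) x) \<partial>expo)"
  proof (intro nn_integral_cong)
    fix u
    show "(\<integral>\<^sup>+k. ennreal (if x = i then 1 else 0) * indicator {b..} u +
        indicator {0..b} u * (indicator L (x + k) * ennreal (v i (t - tau x * u) (x + k))) \<partial>measure_pmf \<mu>)
      = ennreal (if x = i then 1 else 0) * indicator {b..} u +
      indicator {0..b} u * ennreal (A (v i (t - tau x * u)) x)"
    proof (cases "u \<in> {0..b}")
      case True
      then have "0 \<le> v i (t - tau x * u) y" if "y \<in> L" for y
        using b that by (intro v_nonneg) auto
      then show ?thesis using True
        by (subst nn_integral_add)
          (simp_all add: nn_integral_pmf_box[OF fin] measure_pmf.emeasure_space_1[simplified])
    qed (simp add: measure_pmf.emeasure_space_1[simplified])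
  qed
  also have "\<dots> = ennreal (if x = i then 1 else 0) * (\<integral>\<^sup>+u. indicator {b..} u \<partial>expo)
      + (\<integral>\<^sup>+u. indicator {0..b} u * ennreal (A (v i (t - tau x * u)) x) \<partial>expo)"
    by (subst nn_integral_add) (auto simp: nn_integral_cmult)
  also have "(\<integral>\<^sup>+u. indicator {b..} u \<partial>expo) = ennreal (exp (- b))"
    using b by (intro nn_integral_expo_tail)
  also have "(\<integral>\<^sup>+u. indicator {0..b} u * ennreal (A (v i (t - tau x * u)) x) \<partial>expo) =
     (\<integral>\<^sup>+u. ennreal (f u) * indicator {0..b} u \<partial>lborel)"
    by (subst nn_integral_expo)
      (auto intro!: nn_integral_cong simp: f_def ennreal_mult A_nonneg split: split_indicator)
  also have "(\<integral>\<^sup>+u. ennreal (f u) * indicator {0..b} u \<partial>lborel) =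
     ennreal (- exp (- b) * v i (t - tau x * b) x - (- exp (- 0) * v i (t - tau x * 0) x))"
  proof (rule nn_integral_FTC_Icc)
    show "f \<in> borel_measurable borel" unfolding f_def by measurable
    fix u assume u: "u \<in> {0..b}"
    show "((\<lambda>u. - exp (- u) * v i (t - tau x * u) x) has_real_derivative f u) (at u)" by (rule der)
    show "0 \<le> f u" using u A_nonneg unfolding f_def by auto
  qed (use b in auto)
  also have "\<dots> = ennreal (v i t x - exp (- b) * (if x = i then 1 else 0))"
    using tx by (simp add: b_def v_0)
  also have "ennreal (if x = i then 1 else 0) * ennreal (exp (- b)) + \<dots> = ennreal (v i t x)"
  proof -
    \<comment> \<open>\<open>ennreal\<close> truncates negative numbers to 0, so the two parts
      recombine only once this difference is known to be nonnegative; that follows from monotonicity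
      of the same antiderivative.\<close>
    have "0 \<le> v i t x - exp (- b) * (if x = i then 1 else 0)"
    proof -
      have "- exp (- 0) * v i (t - tau x * 0) x \<le> - exp (- b) * v i (t - tau x * b) x"
      proof (rule DERIV_nonneg_imp_nondecreasing[OF b(1)])
        fix u assume "0 \<le> u" "u \<le> b"
        then have "0 \<le> f u" using A_nonneg by (auto simp: f_def)
        then show "\<exists>y. ((\<lambda>u. - exp (- u) * v i (t - tau x * u) x) has_real_derivative y) (at u) \<and> 0 \<le> y"
          using der by blast
      qed
      then show ?thesis using tx by (simp add: b_def v_0)
    qed
    then show ?thesis
      by (subst ennreal_mult[symmetric], simp, simp, subst ennreal_plus[symmetric]) auto
  qed
  finally show ?case .
qed

subsection \<open>Exit probabilities\<close>

text \<open>Up to the factor \<open>e\<close>, \<open>laplace_jumps \<mu> l N tau x\<close> bounds the expected number of jumps (at most \<open>N\<close>)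
  made before time \<open>1/l\<close> by the trap model started at \<open>x\<close>: it is the sum over
  \<open>n \<in> {1..N}\<close> of the Laplace transform at \<open>l\<close> of the \<open>n\<close>-th jump time.\<close>

primrec laplace_jumps :: "int pmf \<Rightarrow> real \<Rightarrow> nat \<Rightarrow> (int \<Rightarrow> real) \<Rightarrow> int \<Rightarrow> ennreal" where
  "laplace_jumps \<mu> l 0 tau x = 0"
| "laplace_jumps \<mu> l (Suc N) tau x =
     inverse (1 + ennreal (l * tau x)) * (1 + (\<integral>\<^sup>+k. laplace_jumps \<mu> l N tau (x + k) \<partial>measure_pmf \<mu>))"

text \<open>A supermartingale bound by first-step induction: G is at least 1 outside
  \<open>L\<close> and its mean grows by at most \<open>\<kappa>\<close> per jump, so the exit
  probability is at most G x plus \<open>\<kappa>\<close> times the expected number of jumps before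
  t. The discount exp(l t) becomes exp(l (t - \<open>tau x\<close> u)) after the first jump, and
  integrating out u yields the factor in \<open>laplace_jumps\<close>. Here \<open>\<kappa>\<close>
  is a drift error, not the Hoelder exponent.\<close>

lemma emeasure_exit_event_le:
  assumes tau: "\<And>x. 0 < tau x" and l: "0 \<le> l" and \<kappa>: "0 \<le> \<kappa>"
    and G: "\<And>x. 0 \<le> G x" "\<And>x. x \<notin> L \<Longrightarrow> 1 \<le> G x"
      "\<And>x. (\<integral>\<^sup>+k. ennreal (G (x + k)) \<partial>measure_pmf \<mu>) \<le> ennreal (G x + \<kappa>)"
  shows "0 \<le> t \<Longrightarrow> emeasure (walk_clock_space \<mu>) (exit_event tau L N x t) \<le>
    ennreal (G x) + ennreal (\<kappa> * exp (l * t)) * laplace_jumps \<mu> l N tau x"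
proof (induction N arbitrary: x t)
  case 0
  then show ?case by (simp add: exit_event_def)
next
  case (Suc N)
  let ?W = "walk_clock_space \<mu>"
  interpret W: prob_space ?W by (rule prob_space_walk_clock)
  interpret E: prob_space expo by (rule prob_space_expo)
  show ?case
  proof (cases "x \<in> L")
    case False
    have "emeasure ?W (exit_event tau L (Suc N) x t) \<le> ennreal 1"
      by (simp add: W.emeasure_le_1)
    also have "\<dots> \<le> ennreal (G x)" using G(2)[OF False] by (intro ennreal_leI)
    finally show ?thesis by (rule order_trans) simp
  next
    case True
    let ?J = "\<lambda>x. laplace_jumps \<mu> l N tau x"
    have tx: "0 < tau x" by (rule tau)
    have "emeasure ?W (exit_event tau L (Suc N) x t) \<le>
      (\<integral>\<^sup>+u. (\<integral>\<^sup>+k. indicator {u. 0 \<le> u \<and> tau x * u \<le> t} u *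
        (ennreal (G (x + k)) + ennreal (\<kappa> * exp (l * (t - tau x * u))) * ?J (x + k)) \<partial>measure_pmf \<mu>) \<partial>expo)"
      unfolding emeasure_first_step[OF exit_event_sets]
    proof (intro nn_integral_mono)
      fix u k
      let ?A = "if 0 \<le> u \<and> tau x * u \<le> t then exit_event tau L N (x + k) (t - tau x * u) else {}"
      have "emeasure ?W {\<omega>. (case_nat k (fst \<omega>), case_nat u (snd \<omega>)) \<in> exit_event tau L (Suc N) x t} \<le> emeasure ?W ?A"
        by (intro emeasure_mono exit_event_Suc_subset tau True) auto
      also have "\<dots> \<le> indicator {u. 0 \<le> u \<and> tau x * u \<le> t} u *
        (ennreal (G (x + k)) + ennreal (\<kappa> * exp (l * (t - tau x * u))) * ?J (x + k))"
        using Suc.IH[of "t - tau x * u" "x + k"] by (auto split: split_indicator)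
      finally show "emeasure ?W {\<omega>. (case_nat k (fst \<omega>), case_nat u (snd \<omega>)) \<in> exit_event tau L (Suc N) x t} \<le>
        indicator {u. 0 \<le> u \<and> tau x * u \<le> t} u *
        (ennreal (G (x + k)) + ennreal (\<kappa> * exp (l * (t - tau x * u))) * ?J (x + k))" .
    qed
    also have "\<dots> \<le> (\<integral>\<^sup>+u. ennreal (G x) + ennreal (\<kappa> * exp (l * t)) * (1 + (\<integral>\<^sup>+k. ?J (x + k) \<partial>measure_pmf \<mu>)) *
        ennreal (exp (- (l * tau x) * u)) \<partial>expo)"
    proof (intro nn_integral_mono)
      fix u
      let ?PJ = "\<integral>\<^sup>+k. ?J (x + k) \<partial>measure_pmf \<mu>"
      show "(\<integral>\<^sup>+k. indicator {u. 0 \<le> u \<and> tau x * u \<le> t} u *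
        (ennreal (G (x + k)) + ennreal (\<kappa> * exp (l * (t - tau x * u))) * ?J (x + k)) \<partial>measure_pmf \<mu>)
        \<le> ennreal (G x) + ennreal (\<kappa> * exp (l * t)) * (1 + ?PJ) * ennreal (exp (- (l * tau x) * u))"
      proof (cases "0 \<le> u \<and> tau x * u \<le> t")
        case u: True
        have ee: "\<kappa> * exp (l * (t - tau x * u)) = (\<kappa> * exp (l * t)) * exp (- (l * tau x) * u)"
          by (simp add: right_diff_distrib exp_diff exp_minus field_simps)
        have "(\<integral>\<^sup>+k. indicator {u. 0 \<le> u \<and> tau x * u \<le> t} u *
            (ennreal (G (x + k)) + ennreal (\<kappa> * exp (l * (t - tau x * u))) * ?J (x + k)) \<partial>measure_pmf \<mu>)
          = (\<integral>\<^sup>+k. ennreal (G (x + k)) \<partial>measure_pmf \<mu>) + ennreal (\<kappa> * exp (l * (t - tau x * u))) * ?PJ"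
          using u by (subst nn_integral_cmult, simp, subst nn_integral_add) (auto simp: nn_integral_cmult)
        also have "\<dots> \<le> ennreal (G x + \<kappa>) + ennreal (\<kappa> * exp (l * (t - tau x * u))) * ?PJ"
          by (intro add_mono G order_refl)
        also have "\<dots> \<le> (ennreal (G x) + ennreal (\<kappa> * exp (l * (t - tau x * u)))) + ennreal (\<kappa> * exp (l * (t - tau x * u))) * ?PJ"
        \<comment> \<open>The drift of the current jump is charged at the discounted rate, which is
          at least \<open>\<kappa>\<close> as long as time remains; it supplies the summand 1 in the
          recursion of \<open>laplace_jumps\<close>.\<close>
        proof (intro add_mono order_refl)
          have "1 \<le> exp (l * (t - tau x * u))" using l u by simp
          then have "\<kappa> * 1 \<le> \<kappa> * exp (l * (t - tau x * u))" using \<kappa> by (intro mult_left_mono) auto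
          then show "ennreal (G x + \<kappa>) \<le> ennreal (G x) + ennreal (\<kappa> * exp (l * (t - tau x * u)))"
            using G(1)[of x] \<kappa> by (subst ennreal_plus[symmetric]) (auto intro!: ennreal_leI)
        qed
        also have "\<dots> = ennreal (G x) + ennreal (\<kappa> * exp (l * t)) * (1 + ?PJ) * ennreal (exp (- (l * tau x) * u))"
          unfolding ee using \<kappa> by (simp add: ennreal_mult distrib_left distrib_right ac_simps)
        finally show ?thesis .
      qed simp
    qed
    also have "\<dots> = ennreal (G x) + ennreal (\<kappa> * exp (l * t)) * (1 + (\<integral>\<^sup>+k. ?J (x + k) \<partial>measure_pmf \<mu>)) *
        inverse (1 + ennreal (l * tau x))"
      using l tx
      by (subst nn_integral_add, simp, simp, subst nn_integral_cmult, simp, subst nn_integral_expo_exp)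
        (auto simp: E.emeasure_space_1[simplified])
    also have "\<dots> = ennreal (G x) + ennreal (\<kappa> * exp (l * t)) * laplace_jumps \<mu> l (Suc N) tau x"
      by (simp add: ac_simps)
    finally show ?thesis .
  qed
qed

text \<open>To be at i at time t the walk either has stayed in \<open>L\<close>, which
  \<open>v\<close> bounds, or has left it by time t. Since G 0 = 0, the exit term consists of
  accumulated drift only. The truncation N is removed by continuity along increasing events.\<close>

lemma (in trap_box) trap_quenched_le:
  assumes tau: "\<And>x. 0 < tau x" and l: "0 \<le> l" and \<kappa>: "0 \<le> \<kappa>" and L0: "0 \<in> L"
    and G: "\<And>x. 0 \<le> G x" "\<And>x. x \<notin> L \<Longrightarrow> 1 \<le> G x" "G 0 = 0"
      "\<And>x. (\<integral>\<^sup>+k. ennreal (G (x + k)) \<partial>measure_pmf \<mu>) \<le> ennreal (G x + \<kappa>)"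
    and w: "0 \<le> w" "\<And>N. laplace_jumps \<mu> l N tau 0 \<le> ennreal w" and t: "0 \<le> t"
  shows "trap_quenched \<mu> tau t i \<le> (if i \<in> L then v i t 0 else 0) + \<kappa> * exp (l * t) * w"
proof -
  let ?W = "walk_clock_space \<mu>"
  interpret W: prob_space ?W by (rule prob_space_walk_clock)
  let ?T = "{(eps, e). \<exists>n. rw_pos eps n = i \<and> jump_time tau eps e n \<le> t \<and> t < jump_time tau eps e (Suc n)}"
  define S where "S N = stay_event tau L i N 0 t" for N
  define X where "X N = exit_event tau L N 0 t" for N
  have S [measurable]: "S N \<in> sets ?W" and X [measurable]: "X N \<in> sets ?W" for N
    by (simp_all add: S_def X_def)
  have rhs0: "0 \<le> (if i \<in> L then v i t 0 else 0)" using v_nonneg[OF L0 t] by simp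
  \<comment> \<open>The event defining \<open>trap_quenched\<close> does not restrict the signs of
    the clocks, hence an almost sure inclusion.\<close>
  have "emeasure ?W ?T \<le> emeasure ?W ((\<Union>N. S N) \<union> (\<Union>N. X N))"
  proof (rule emeasure_mono_AE)
    show "AE \<omega> in ?W. \<omega> \<in> ?T \<longrightarrow> \<omega> \<in> (\<Union>N. S N) \<union> (\<Union>N. X N)"
      using AE_clocks_nonneg
    proof eventually_elim
      case (elim \<omega>)
      show ?case
      proof
        assume "\<omega> \<in> ?T"
        then obtain n where n: "rw_pos (fst \<omega>) n = i" "jump_time tau (fst \<omega>) (snd \<omega>) n \<le> t"
          "t < jump_time tau (fst \<omega>) (snd \<omega>) (Suc n)" by auto
        show "\<omega> \<in> (\<Union>N. S N) \<union> (\<Union>N. X N)"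
        proof (cases "\<forall>m\<le>n. rw_pos (fst \<omega>) m \<in> L")
          case True
          then have "\<omega> \<in> S (Suc n)" using n elim by (auto simp: S_def stay_event_def)
          then show ?thesis by blast
        next
          case False
          then obtain m where m: "m \<le> n" "rw_pos (fst \<omega>) m \<notin> L" by auto
          have "jump_time tau (fst \<omega>) (snd \<omega>) m \<le> jump_time tau (fst \<omega>) (snd \<omega>) n"
            using elim tau m by (intro jump_time_mono) (auto simp: less_imp_le)
          then have "\<omega> \<in> X (Suc n)" using n m elim by (auto simp: X_def exit_event_def intro!: exI[of _ m])
          then show ?thesis by blast
        qed
      qed
    qed
  qed auto
  also have "\<dots> \<le> emeasure ?W (\<Union>N. S N) + emeasure ?W (\<Union>N. X N)"
    by (intro emeasure_subadditive) auto
  also have "\<dots> \<le> ennreal (if i \<in> L then v i t 0 else 0) + ennreal (\<kappa> * exp (l * t) * w)"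
  proof (rule add_mono)
    have "incseq S" unfolding S_def incseq_def stay_event_def by force
    then have "emeasure ?W (\<Union>N. S N) = (SUP N. emeasure ?W (S N))"
      by (intro SUP_emeasure_incseq[symmetric]) auto
    also have "\<dots> \<le> ennreal (if i \<in> L then v i t 0 else 0)"
    proof (rule SUP_least)
      fix N
      show "emeasure ?W (S N) \<le> ennreal (if i \<in> L then v i t 0 else 0)"
      proof (cases "i \<in> L")
        case True
        then show ?thesis using emeasure_stay_event_le[OF tau L0 t] by (simp add: S_def)
      next
        case False
        then have "S N = {}" by (auto simp: S_def stay_event_def)
        then show ?thesis by simp
      qed
    qed
    finally show "emeasure ?W (\<Union>N. S N) \<le> ennreal (if i \<in> L then v i t 0 else 0)" .
    have "incseq X" unfolding X_def incseq_def exit_event_def by force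
    then have "emeasure ?W (\<Union>N. X N) = (SUP N. emeasure ?W (X N))"
      by (intro SUP_emeasure_incseq[symmetric]) auto
    also have "\<dots> \<le> ennreal (\<kappa> * exp (l * t) * w)"
    proof (rule SUP_least)
      fix N
      have "emeasure ?W (X N) \<le> ennreal (G 0) + ennreal (\<kappa> * exp (l * t)) * laplace_jumps \<mu> l N tau 0"
        unfolding X_def by (intro emeasure_exit_event_le tau l \<kappa> G t)
      also have "\<dots> \<le> 0 + ennreal (\<kappa> * exp (l * t)) * ennreal w"
        using w G(3) by (intro add_mono mult_left_mono) auto
      also have "\<dots> = ennreal (\<kappa> * exp (l * t) * w)"
        using \<kappa> w by (simp add: ennreal_mult)
      finally show "emeasure ?W (X N) \<le> ennreal (\<kappa> * exp (l * t) * w)" .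
    qed
    finally show "emeasure ?W (\<Union>N. X N) \<le> ennreal (\<kappa> * exp (l * t) * w)" .
  qed
  also have "\<dots> = ennreal ((if i \<in> L then v i t 0 else 0) + \<kappa> * exp (l * t) * w)"
    using rhs0 \<kappa> w by (intro ennreal_plus[symmetric]) auto
  finally show ?thesis
    unfolding trap_quenched_def W.emeasure_eq_measure
    using rhs0 \<kappa> w by (subst (asm) ennreal_le_iff) auto
qed

subsection \<open>The random environment\<close>

lemma laplace_jumps_shift:
  "laplace_jumps \<mu> l N tau (x + z) = laplace_jumps \<mu> l N (\<lambda>y. tau (y + z)) x"
proof (induction N arbitrary: x)
  case (Suc N)
  have "laplace_jumps \<mu> l N tau (x + z + k) = laplace_jumps \<mu> l N (\<lambda>y. tau (y + z)) (x + k)" for k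
    using Suc[of "x + k"] by (simp add: ac_simps)
  then show ?case by simp
qed simp

lemma inverse_one_plus_le_1: "inverse (1 + (q::ennreal)) \<le> 1"
proof (cases q)
  case (real r)
  then have "1 + q = ennreal (1 + r)" by simp
  then show ?thesis using real by (simp add: inverse_ennreal inverse_le_1_iff del: ennreal_plus)
qed simp

lemma laplace_jumps_le: "laplace_jumps \<mu> l N tau x \<le> of_nat N"
proof (induction N arbitrary: x)
  case (Suc N)
  have "laplace_jumps \<mu> l (Suc N) tau x \<le> 1 * (1 + (\<integral>\<^sup>+k. of_nat N \<partial>measure_pmf \<mu>))"
    unfolding laplace_jumps.simps
    by (intro mult_mono inverse_one_plus_le_1 add_mono order_refl nn_integral_mono Suc) auto
  then show ?case by (simp add: measure_pmf.emeasure_space_1[simplified])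
qed simp

lemma laplace_jumps_mono: "laplace_jumps \<mu> l N tau x \<le> laplace_jumps \<mu> l (Suc N) tau x"
proof (induction N arbitrary: x)
  case (Suc N)
  have "laplace_jumps \<mu> l (Suc N) tau x \<le>
    inverse (1 + ennreal (l * tau x)) * (1 + (\<integral>\<^sup>+k. laplace_jumps \<mu> l (Suc N) tau (x + k) \<partial>measure_pmf \<mu>))"
    unfolding laplace_jumps.simps(2)[of _ _ N tau x]
    by (intro mult_left_mono add_mono order_refl nn_integral_mono Suc) simp
  then show ?case by (simp only: laplace_jumps.simps(2)[of _ _ "Suc N"])
qed simp

section \<open>Dyadic scales\<close>

lemma summable_two_powr:
  assumes "0 < d"
  shows "summable (\<lambda>n. 2 powr (- d * real n))"
proof -
  have "2 powr (- d * real n) = (2 powr (- d)) ^ n" for n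
    by (subst powr_realpow[symmetric]) (simp_all add: powr_powr)
  moreover have "2 powr (- d) < 1" using assms by (simp add: powr_less_one)
  ultimately show ?thesis by (simp add: summable_geometric)
qed

text \<open>The box radius t^r at t = 2^n. Rounding up puts every integer outside the box at
  distance at least 2^(r n) from 0.\<close>

definition radius :: "real \<Rightarrow> nat \<Rightarrow> int" where
  "radius r n = \<lceil>2 powr (r * real n)\<rceil>"

lemma card_radius_le:
  assumes "0 \<le> r"
  shows "real (card {- radius r n..radius r n}) \<le> 5 * 2 powr (r * real n)"
proof -
  have "1 \<le> 2 powr (r * real n)" using assms by (simp add: ge_one_powr_ge_zero)
  moreover have "real_of_int (radius r n) \<le> 2 powr (r * real n) + 1"
    unfolding radius_def by linarith
  moreover have "0 \<le> radius r n"
    unfolding radius_def using \<open>1 \<le> _\<close> by linarith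
  ultimately show ?thesis by simp
qed

text \<open>The interval length at scale t = 2^n. Rounding down keeps the Hoelder bound clean; the
  loss of at most 1 is paid in the mass bounds.\<close>

definition ball_size :: "real \<Rightarrow> nat \<Rightarrow> nat" where
  "ball_size \<alpha> n = nat \<lfloor>2 powr (\<alpha> * real n)\<rfloor>"

lemma ball_size_bounds:
  "2 powr (\<alpha> * real n) - 1 \<le> real (ball_size \<alpha> n)" "real (ball_size \<alpha> n) \<le> 2 powr (\<alpha> * real n)"
proof -
  have "0 \<le> \<lfloor>2 powr (\<alpha> * real n)\<rfloor>" by simp
  then have "real (ball_size \<alpha> n) = of_int \<lfloor>2 powr (\<alpha> * real n)\<rfloor>" by (simp add: ball_size_def)
  then show "2 powr (\<alpha> * real n) - 1 \<le> real (ball_size \<alpha> n)" "real (ball_size \<alpha> n) \<le> 2 powr (\<alpha> * real n)"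
    by linarith+
qed

lemma measurable_nn_integral_pmf:
  fixes f :: "int \<Rightarrow> 'a \<Rightarrow> ennreal"
  assumes "\<And>k. f k \<in> borel_measurable M"
  shows "(\<lambda>x. \<integral>\<^sup>+k. f k x \<partial>measure_pmf \<mu>) \<in> borel_measurable M"
    and "(\<lambda>(x, k). f k x) \<in> borel_measurable (M \<Otimes>\<^sub>M measure_pmf \<mu>)"
proof -
  have "(\<lambda>z. f (snd z) (fst z)) \<in> borel_measurable (M \<Otimes>\<^sub>M measure_pmf \<mu>)"
    by (rule measurable_compose_countable[where f="\<lambda>i z. f i (fst z)" and g=snd])
      (use assms in measurable)
  then show *: "(\<lambda>(x, k). f k x) \<in> borel_measurable (M \<Otimes>\<^sub>M measure_pmf \<mu>)"
    by (simp add: case_prod_beta')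
  show "(\<lambda>x. \<integral>\<^sup>+k. f k x \<partial>measure_pmf \<mu>) \<in> borel_measurable M"
    by (rule measure_pmf.borel_measurable_nn_integral[OF *])
qed

locale iid_env =
  fixes T :: "real measure"
  assumes T_prob: "prob_space T" and T_sets [measurable_cong]: "sets T = sets borel"
begin

abbreviation "env \<equiv> PiM (UNIV :: int set) (\<lambda>_. T)"

lemma T_space: "space T = UNIV"
  using sets_eq_imp_space_eq[OF T_sets] by simp

sublocale T: prob_space T by (rule T_prob)

sublocale env: prob_space env by (intro prob_space_PiM T_prob)

lemma space_env [simp]: "space env = UNIV"
  by (simp add: space_PiM T_space)

lemma borel_measurable_T: "f \<in> borel_measurable borel \<Longrightarrow> f \<in> borel_measurable T"
  using measurable_cong_sets[OF T_sets refl] by blast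

lemma measurable_site [measurable]: "(\<lambda>tau. tau x) \<in> borel_measurable env"
proof -
  have "(\<lambda>tau. tau x) \<in> env \<rightarrow>\<^sub>M T" by measurable
  then show ?thesis by simp
qed

lemma measurable_laplace_jumps [measurable]:
  "(\<lambda>tau. laplace_jumps \<mu> l N tau x) \<in> borel_measurable env"
proof (induction N arbitrary: x)
  case (Suc N)
  have [measurable]: "(\<lambda>tau. \<integral>\<^sup>+k. laplace_jumps \<mu> l N tau (x + k) \<partial>measure_pmf \<mu>) \<in> borel_measurable env"
    by (rule measurable_nn_integral_pmf) (rule Suc)
  show ?case by simp
qed simp

lemma distr_shift_env: "distr env env (\<lambda>tau y. tau (y + z)) = env"
  using distr_PiM_reindex[of UNIV "\<lambda>_. T" "\<lambda>y. y + z" UNIV] T_prob by (simp add: inj_on_def restrict_def)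

lemma nn_integral_laplace_jumps_shift:
  "(\<integral>\<^sup>+tau. laplace_jumps \<mu> l N tau z \<partial>env) = (\<integral>\<^sup>+tau. laplace_jumps \<mu> l N tau 0 \<partial>env)"
proof -
  have m: "(\<lambda>tau y. tau (y + z)) \<in> env \<rightarrow>\<^sub>M env"
    by (rule measurable_PiM_single') (auto simp: T_space)
  have "(\<integral>\<^sup>+tau. laplace_jumps \<mu> l N tau 0 \<partial>env) = (\<integral>\<^sup>+tau. laplace_jumps \<mu> l N tau 0 \<partial>distr env env (\<lambda>tau y. tau (y + z)))"
    by (simp add: distr_shift_env)
  also have "\<dots> = (\<integral>\<^sup>+tau. laplace_jumps \<mu> l N (\<lambda>y. tau (y + z)) 0 \<partial>env)"
    by (rule nn_integral_distr[OF m]) measurable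
  finally show ?thesis by (simp flip: laplace_jumps_shift)
qed

text \<open>Stationarity of the environment seen from the walker makes the sum telescope.\<close>

lemma nn_integral_laplace_jumps_le:
  "(\<integral>\<^sup>+tau. ennreal (l * tau 0) * laplace_jumps \<mu> l N tau 0 \<partial>env) \<le> 1"
proof (cases N)
  case (Suc M)
  let ?J = "\<lambda>N tau. laplace_jumps \<mu> l N tau 0"
  interpret P: pair_sigma_finite "measure_pmf \<mu>" env ..
  have eq: "ennreal (l * tau 0) * ?J N tau + ?J N tau = 1 + (\<integral>\<^sup>+k. laplace_jumps \<mu> l M tau k \<partial>measure_pmf \<mu>)" for tau
  proof -
    have alg: "q * (a * g) + a * g = ((1 + q) * a) * g" for q a g :: ennreal
      by (simp add: distrib_right mult.assoc add.commute)
    have "ennreal (l * tau 0) * ?J N tau + ?J N tau =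
      ((1 + ennreal (l * tau 0)) * inverse (1 + ennreal (l * tau 0))) * (1 + (\<integral>\<^sup>+k. laplace_jumps \<mu> l M tau k \<partial>measure_pmf \<mu>))"
      unfolding Suc laplace_jumps.simps add_0 by (rule alg)
    also have "(1 + ennreal (l * tau 0)) * inverse (1 + ennreal (l * tau 0)) = 1"
      by (rule ennreal_divide_self[unfolded divide_ennreal_def]) (auto simp: less_top[symmetric])
    finally show ?thesis by simp
  qed
  have "(\<integral>\<^sup>+tau. ?J N tau \<partial>env) + (\<integral>\<^sup>+tau. ennreal (l * tau 0) * ?J N tau \<partial>env)
    = (\<integral>\<^sup>+tau. ennreal (l * tau 0) * ?J N tau + ?J N tau \<partial>env)"
    by (subst nn_integral_add) (auto simp: add.commute)
  also have "\<dots> = 1 + (\<integral>\<^sup>+tau. (\<integral>\<^sup>+k. laplace_jumps \<mu> l M tau k \<partial>measure_pmf \<mu>) \<partial>env)"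
    unfolding eq
    by (subst nn_integral_add)
      (auto intro!: measurable_nn_integral_pmf simp: env.emeasure_space_1[simplified])
  also have "(\<integral>\<^sup>+tau. (\<integral>\<^sup>+k. laplace_jumps \<mu> l M tau k \<partial>measure_pmf \<mu>) \<partial>env) =
    (\<integral>\<^sup>+k. (\<integral>\<^sup>+tau. laplace_jumps \<mu> l M tau k \<partial>env) \<partial>measure_pmf \<mu>)"
  proof (rule P.Fubini')
    show "(\<lambda>(k, tau). laplace_jumps \<mu> l M tau k) \<in> borel_measurable (measure_pmf \<mu> \<Otimes>\<^sub>M env)"
      unfolding case_prod_beta'
      by (rule measurable_compose_countable[where f="\<lambda>i z. laplace_jumps \<mu> l M (snd z) i" and g=fst]) measurable
  qed
  also have "\<dots> = (\<integral>\<^sup>+k. (\<integral>\<^sup>+tau. ?J M tau \<partial>env) \<partial>measure_pmf \<mu>)"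
    by (intro nn_integral_cong nn_integral_laplace_jumps_shift)
  also have "\<dots> = (\<integral>\<^sup>+tau. ?J M tau \<partial>env)"
    by (simp add: measure_pmf.emeasure_space_1[simplified])
  also have "1 + \<dots> \<le> (\<integral>\<^sup>+tau. ?J N tau \<partial>env) + 1"
    unfolding Suc add.commute[of 1] by (intro add_mono nn_integral_mono laplace_jumps_mono order_refl)
  finally have "(\<integral>\<^sup>+tau. ?J N tau \<partial>env) + (\<integral>\<^sup>+tau. ennreal (l * tau 0) * ?J N tau \<partial>env) \<le> (\<integral>\<^sup>+tau. ?J N tau \<partial>env) + 1" .
  \<comment> \<open>Cancellation in \<open>ennreal\<close> needs a finite term, which the truncation
    at N jumps provides.\<close>
  moreover have "(\<integral>\<^sup>+tau. ?J N tau \<partial>env) \<le> (\<integral>\<^sup>+tau. of_nat N \<partial>env)"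
    by (intro nn_integral_mono laplace_jumps_le)
  then have "(\<integral>\<^sup>+tau. ?J N tau \<partial>env) \<noteq> \<infinity>"
    by (auto simp: env.emeasure_space_1[simplified] top_unique)
  ultimately show ?thesis by (simp add: ennreal_add_left_cancel_le)
qed simp


lemma nn_integral_SUP_laplace_jumps_le:
  "(\<integral>\<^sup>+tau. ennreal (l * tau 0) * (SUP N. laplace_jumps \<mu> l N tau 0) \<partial>env) \<le> 1"
proof -
  have "(\<integral>\<^sup>+tau. ennreal (l * tau 0) * (SUP N. laplace_jumps \<mu> l N tau 0) \<partial>env) =
    (\<integral>\<^sup>+tau. (SUP N. ennreal (l * tau 0) * laplace_jumps \<mu> l N tau 0) \<partial>env)"
    by (simp add: SUP_mult_left_ennreal)
  also have "\<dots> = (SUP N. \<integral>\<^sup>+tau. ennreal (l * tau 0) * laplace_jumps \<mu> l N tau 0 \<partial>env)"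
    by (intro nn_integral_monotone_convergence_SUP incseq_SucI le_funI mult_left_mono laplace_jumps_mono) auto
  also have "\<dots> \<le> 1" by (intro SUP_least nn_integral_laplace_jumps_le)
  finally show ?thesis .
qed

text \<open>At l = 2^(-n) the expectation of \<open>tau 0\<close> times the jump count is at most
  2^n. Markov's inequality with slack 2^(\<delta> n) has summable failure probabilities. The
  division by \<open>tau 0\<close> is the price of passing from the size-biased law back to the
  original one.\<close>

lemma AE_laplace_jumps_bound:
  assumes T_pos: "AE x in T. 0 < x" and \<delta>: "0 < \<delta>"
  shows "AE tau in env. \<forall>\<^sub>F n in sequentially. \<forall>N.
    laplace_jumps \<mu> (2 powr (- real n)) N tau 0 \<le> ennreal (2 powr ((1 + \<delta>) * real n) / tau 0)"
proof -
  \<comment> \<open>The supremum over N sits inside the variable, so a single exceptional event per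
    n serves all N at once.\<close>
  define u where "u n tau = ennreal (2 powr (- real n) * tau 0) * (SUP N. laplace_jumps \<mu> (2 powr (- real n)) N tau 0)"
    for n and tau :: "int \<Rightarrow> real"
  have u [measurable]: "u n \<in> borel_measurable env" for n unfolding u_def by measurable
  define B where "B n = {tau \<in> space env. 1 \<le> ennreal (2 powr (- \<delta> * real n)) * u n tau}" for n
  have B [measurable]: "B n \<in> sets env" for n unfolding B_def by measurable
  have "emeasure env (B n) \<le> ennreal (2 powr (- \<delta> * real n))" for n
  proof -
    have "emeasure env (B n) \<le> ennreal (2 powr (- \<delta> * real n)) * (\<integral>\<^sup>+tau. u n tau * indicator (space env) tau \<partial>env)"
      unfolding B_def by (rule nn_integral_Markov_inequality) (auto intro: sets.top simp del: space_env)
    also have "\<dots> \<le> ennreal (2 powr (- \<delta> * real n)) * 1"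
      using nn_integral_SUP_laplace_jumps_le[of "2 powr (- real n)" \<mu>] unfolding u_def by (intro mult_left_mono) auto
    finally show ?thesis by simp
  qed
  then have "measure env (B n) \<le> 2 powr (- \<delta> * real n)" for n
    by (simp add: env.emeasure_eq_measure)
  then have "summable (\<lambda>n. measure env (B n))"
    by (intro summable_comparison_test'[OF summable_two_powr[OF \<delta>]]) auto
  then have "AE tau in env. \<forall>\<^sub>F n in sequentially. tau \<in> space env - B n"
    by (intro borel_cantelli_AE1) (auto simp: env.emeasure_finite less_top[symmetric])
  moreover have "AE tau in env. 0 < tau 0"
    by (intro AE_PiM_component T_prob T_pos) auto
  ultimately show ?thesis
  proof eventually_elim
    case (elim tau)
    from elim(1) show ?case
    proof eventually_elim
      case (elim n)
      show ?case
      proof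
        fix N
        obtain j where j: "laplace_jumps \<mu> (2 powr (- real n)) N tau 0 = ennreal j" "0 \<le> j"
          using laplace_jumps_le[of \<mu> "2 powr (- real n)" N tau 0]
          by (cases "laplace_jumps \<mu> (2 powr (- real n)) N tau 0") (auto simp: top_unique)
        have "ennreal (2 powr (- \<delta> * real n)) * (ennreal (2 powr (- real n) * tau 0) * ennreal j) \<le>
          ennreal (2 powr (- \<delta> * real n)) * u n tau"
          unfolding u_def j(1)[symmetric] by (intro mult_left_mono SUP_upper) auto
        also have "\<dots> < 1" using elim by (simp add: B_def not_le)
        finally have "ennreal (2 powr (- \<delta> * real n) * (2 powr (- real n) * tau 0 * j)) < 1"
          using j \<open>0 < tau 0\<close> by (simp add: ennreal_mult)
        then have "2 powr (- \<delta> * real n) * (2 powr (- real n) * tau 0 * j) < 1"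
          using j \<open>0 < tau 0\<close> by (subst (asm) ennreal_less_one_iff) auto
        moreover have "2 powr (- \<delta> * real n) * 2 powr (- real n) = inverse (2 powr ((1 + \<delta>) * real n))"
          unfolding powr_minus[symmetric] powr_add[symmetric] by (simp add: algebra_simps)
        ultimately have "inverse (2 powr ((1 + \<delta>) * real n)) * (tau 0 * j) < 1"
          by (metis mult.assoc)
        then have "j \<le> 2 powr ((1 + \<delta>) * real n) / tau 0"
          using \<open>0 < tau 0\<close> by (simp add: field_simps)
        then show "laplace_jumps \<mu> (2 powr (- real n)) N tau 0 \<le> ennreal (2 powr ((1 + \<delta>) * real n) / tau 0)"
          unfolding j(1) by (rule ennreal_leI)
      qed
    qed
  qed
qed

section \<open>Almost sure bounds on the environment over growing boxes\<close>

lemma AE_eventually_box: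
  assumes r: "0 \<le> r" and P [measurable]: "\<And>n x. Measurable.pred env (P n x)"
    and le: "\<And>n x. env.prob {tau. \<not> P n x tau} \<le> q n"
    and sm: "summable (\<lambda>n. 2 powr (r * real n) * q n)"
  shows "AE tau in env. \<forall>\<^sub>F n in sequentially. \<forall>x\<in>{- radius r n..radius r n}. P n x tau"
proof -
  define B where "B n = (\<Union>x\<in>{- radius r n..radius r n}. {tau. \<not> P n x tau})" for n
  have S [measurable]: "{tau. \<not> P n x tau} \<in> sets env" for n x
  proof -
    have "{tau \<in> space env. \<not> P n x tau} \<in> sets env" by measurable
    then show ?thesis by simp
  qed
  then have B: "B n \<in> sets env" for n unfolding B_def by auto
  have "measure env (B n) \<le> 5 * (2 powr (r * real n) * q n)" for n
  proof -
    have "0 \<le> q n" using le[of n 0] by (meson measure_nonneg order_trans)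
    have "measure env (B n) \<le> (\<Sum>x\<in>{- radius r n..radius r n}. env.prob {tau. \<not> P n x tau})"
      unfolding B_def using S by (intro env.finite_measure_subadditive_finite) auto
    also have "\<dots> \<le> (\<Sum>x\<in>{- radius r n..radius r n}. q n)"
      by (intro sum_mono le)
    also have "\<dots> = real (card {- radius r n..radius r n}) * q n" by simp
    also have "\<dots> \<le> 5 * 2 powr (r * real n) * q n"
      using card_radius_le[OF r] \<open>0 \<le> q n\<close> by (intro mult_right_mono)
    finally show ?thesis by simp
  qed
  then have "summable (\<lambda>n. measure env (B n))"
    by (intro summable_comparison_test'[OF summable_mult[OF sm, of 5]]) auto
  then have "AE tau in env. \<forall>\<^sub>F n in sequentially. tau \<in> space env - B n"
    using B by (intro borel_cantelli_AE1) (auto simp: env.emeasure_finite less_top[symmetric])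
  then show ?thesis
    by eventually_elim (auto elim!: eventually_mono simp: B_def)
qed

lemma prob_site:
  assumes [measurable]: "S \<in> sets borel"
  shows "env.prob {tau. tau x \<in> S} = T.prob S"
proof -
  have "T.prob S = measure (distr env T (\<lambda>tau. tau x)) S"
    by (subst distr_PiM_component) (auto simp: T_prob)
  also have "\<dots> = env.prob {tau. tau x \<in> S}"
    by (subst measure_distr) (auto simp: vimage_def T_sets)
  finally show ?thesis by simp
qed

text \<open>Markov's inequality for the moment of order p gives failure probability of order 2^(-p a
  n) per site; with about 2^(r n) sites the sum converges because r < p a.\<close>

lemma AE_sites_bound:
  assumes p: "0 < p" and moment: "integrable T (\<lambda>x. x powr p)"
    and r: "0 \<le> r" "r < p * a"
  shows "AE tau in env. \<forall>\<^sub>F n in sequentially. \<forall>x\<in>{- radius r n..radius r n}. tau x \<le> 2 powr (a * real n)"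
proof (rule AE_eventually_box)
  let ?m = "\<integral>x. x powr p \<partial>T"
  show "env.prob {tau. \<not> tau x \<le> 2 powr (a * real n)} \<le> ?m * 2 powr (- (p * a) * real n)" for n x
  proof -
    let ?c = "2 powr (a * real n)"
    have "env.prob {tau. \<not> tau x \<le> ?c} = T.prob {y. ?c < y}"
      using prob_site[of "{y. ?c < y}" x] by (simp add: not_le)
    also have "\<dots> \<le> T.prob {y \<in> space T. ?c powr p \<le> y powr p}"
    proof (intro T.finite_measure_mono subsetI)
      fix y assume "y \<in> {y. ?c < y}"
      then show "y \<in> {y \<in> space T. ?c powr p \<le> y powr p}"
        using p powr_mono2[of p ?c y] by (simp add: T_space)
    next
      have "{y. ?c powr p \<le> y powr p} \<in> sets borel" by measurable
      then show "{y \<in> space T. ?c powr p \<le> y powr p} \<in> T.events" by (simp add: T_space T_sets)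
    qed
    also have "\<dots> \<le> ?m / (?c powr p)"
      by (rule integral_Markov_inequality_measure[OF moment, of "{}"]) auto
    also have "\<dots> = ?m * 2 powr (- (p * a) * real n)"
      by (simp add: powr_powr powr_minus field_simps)
    finally show ?thesis .
  qed
  have "summable (\<lambda>n. ?m * 2 powr (- (p * a - r) * real n))"
    using r by (intro summable_mult summable_two_powr) simp
  also have "(\<lambda>n. ?m * 2 powr (- (p * a - r) * real n)) = (\<lambda>n. 2 powr (r * real n) * (?m * 2 powr (- (p * a) * real n)))"
  proof
    fix n
    have "2 powr (- (p * a - r) * real n) = 2 powr (r * real n) * 2 powr (- (p * a) * real n)"
      unfolding powr_add[symmetric] by (simp add: algebra_simps)
    then show "?m * 2 powr (- (p * a - r) * real n) = 2 powr (r * real n) * (?m * 2 powr (- (p * a) * real n))" by simp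
  qed
  finally show "summable (\<lambda>n. 2 powr (r * real n) * (?m * 2 powr (- (p * a) * real n)))" .
qed (use r in auto)


text \<open>Project the infinite product onto the coordinates in J, where the finite product formula
  applies.\<close>

lemma nn_integral_env_prod:
  assumes J: "finite J" and f [measurable]: "f \<in> borel_measurable borel"
  shows "(\<integral>\<^sup>+tau. (\<Prod>y\<in>J. f (tau y)) \<partial>env) = (\<integral>\<^sup>+x. f x \<partial>T) ^ card J"
proof -
  interpret P: product_sigma_finite "\<lambda>_::int. T" ..
  have fT [measurable]: "f \<in> borel_measurable T" using f by (rule borel_measurable_T)
  have eq: "distr env (PiM J (\<lambda>_. T)) (\<lambda>\<omega>. \<lambda>n\<in>J. \<omega> n) = PiM J (\<lambda>_. T)"
    using distr_PiM_reindex[of UNIV "\<lambda>_. T" "\<lambda>y. y" J] T_prob by simp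
  have m: "(\<lambda>\<omega>. \<lambda>n\<in>J. \<omega> n) \<in> env \<rightarrow>\<^sub>M PiM J (\<lambda>_. T)"
    by (rule measurable_restrict_subset) simp
  have "(\<integral>\<^sup>+x. f x \<partial>T) ^ card J = (\<integral>\<^sup>+tau. (\<Prod>y\<in>J. f (tau y)) \<partial>PiM J (\<lambda>_. T))"
    using J by (subst P.product_nn_integral_prod) auto
  also have "\<dots> = (\<integral>\<^sup>+tau. (\<Prod>y\<in>J. f (tau y)) \<partial>distr env (PiM J (\<lambda>_. T)) (\<lambda>\<omega>. \<lambda>n\<in>J. \<omega> n))"
    by (simp add: eq)
  also have "\<dots> = (\<integral>\<^sup>+tau. (\<Prod>y\<in>J. f ((\<lambda>n\<in>J. tau n) y)) \<partial>env)"
  proof (rule nn_integral_distr[OF m, of "\<lambda>tau. \<Prod>y\<in>J. f (tau y)"])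
    have "(\<lambda>tau. f (tau y)) \<in> borel_measurable (PiM J (\<lambda>_. T))" if "y \<in> J" for y
      by (rule measurable_compose[OF measurable_component_singleton[OF that] fT])
    then show "(\<lambda>tau. \<Prod>y\<in>J. f (tau y)) \<in> borel_measurable (distr env (PiM J (\<lambda>_. T)) (\<lambda>\<omega>. \<lambda>n\<in>J. \<omega> n))"
      unfolding eq by (intro borel_measurable_prod_ennreal)
  qed
  also have "\<dots> = (\<integral>\<^sup>+tau. (\<Prod>y\<in>J. f (tau y)) \<partial>env)"
    by (intro nn_integral_cong prod.cong) auto
  finally show ?thesis by simp
qed

lemma laplace_T:
  assumes T_pos: "AE x in T. 0 < x"
  obtains c where "0 < c" "(\<integral>\<^sup>+x. ennreal (exp (- x)) \<partial>T) \<le> ennreal (exp (- c))"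
proof -
  have bd: "AE x in T. norm (exp (- x)) \<le> 1" using T_pos by eventually_elim simp
  have int: "integrable T (\<lambda>x. exp (- x))"
    by (rule T.integrable_const_bound[OF bd], rule borel_measurable_T) simp
  define q where "q = (\<integral>x. exp (- x) \<partial>T)"
  have "(\<integral>x. exp (- x) \<partial>T) < (\<integral>x. 1 \<partial>T)"
  proof (rule T.integral_less_AE_space)
    show "AE x in T. exp (- x) < 1" using T_pos by eventually_elim simp
    show "emeasure T (space T) \<noteq> 0" by (simp add: T.emeasure_space_1)
  qed (use int in auto)
  then have q: "q < 1" by (simp add: q_def T.prob_space)
  have nn: "(\<integral>\<^sup>+x. ennreal (exp (- x)) \<partial>T) = ennreal q"
    unfolding q_def using int by (intro nn_integral_eq_integral) auto
  \<comment> \<open>The maximum with 1/2 keeps the argument of \<open>ln\<close> away from 0 while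
    leaving it below 1.\<close>
  define c where "c = - ln (max q (1/2))"
  have "0 < c" using q by (simp add: c_def)
  moreover have "exp (- c) = max q (1/2)" by (simp add: c_def)
  ultimately show ?thesis using that[of c] nn by (simp add: ennreal_leI)
qed

text \<open>Chernoff's lower tail bound with the exponential moment of -\<open>tau\<close>: of the
  rate c per site, half pays for the threshold and half remains as decay.\<close>

lemma prob_small_sum:
  assumes c: "0 < c" "(\<integral>\<^sup>+x. ennreal (exp (- x)) \<partial>T) \<le> ennreal (exp (- c))" and J: "finite J"
  shows "env.prob {tau. \<not> c / 2 * real (card J) \<le> (\<Sum>y\<in>J. tau y)} \<le> exp (- c / 2 * real (card J))"
proof -
  let ?n = "real (card J)"
  have "emeasure env {tau \<in> space env. 1 \<le> ennreal (exp (c / 2 * ?n)) * (\<Prod>y\<in>J. ennreal (exp (- tau y)))} \<le>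
    ennreal (exp (c / 2 * ?n)) * (\<integral>\<^sup>+tau. (\<Prod>y\<in>J. ennreal (exp (- tau y))) * indicator (space env) tau \<partial>env)"
    by (rule nn_integral_Markov_inequality) (auto intro: sets.top simp del: space_env)
  also have "(\<integral>\<^sup>+tau. (\<Prod>y\<in>J. ennreal (exp (- tau y))) * indicator (space env) tau \<partial>env) = (\<integral>\<^sup>+x. ennreal (exp (- x)) \<partial>T) ^ card J"
    using nn_integral_env_prod[OF J, of "\<lambda>x. ennreal (exp (- x))"] by simp
  also have "ennreal (exp (c / 2 * ?n)) * \<dots> \<le> ennreal (exp (c / 2 * ?n)) * ennreal (exp (- c)) ^ card J"
    using c by (intro mult_left_mono power_mono) auto
  also have "\<dots> = ennreal (exp (c / 2 * ?n) * exp (- c) ^ card J)"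
    by (simp add: ennreal_mult ennreal_power)
  also have "exp (c / 2 * ?n) * exp (- c) ^ card J = exp (- c / 2 * ?n)"
    by (simp add: exp_of_nat_mult[symmetric] exp_add[symmetric])
  finally have le: "emeasure env {tau \<in> space env. 1 \<le> ennreal (exp (c / 2 * ?n)) * (\<Prod>y\<in>J. ennreal (exp (- tau y)))} \<le> ennreal (exp (- c / 2 * ?n))" .
  have "env.prob {tau. \<not> c / 2 * ?n \<le> (\<Sum>y\<in>J. tau y)} \<le>
    env.prob {tau \<in> space env. 1 \<le> ennreal (exp (c / 2 * ?n)) * (\<Prod>y\<in>J. ennreal (exp (- tau y)))}"
  proof (intro env.finite_measure_mono subsetI)
    fix tau :: "int \<Rightarrow> real" assume "tau \<in> {tau. \<not> c / 2 * ?n \<le> (\<Sum>y\<in>J. tau y)}"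
    then have "exp 0 \<le> exp (c / 2 * ?n - (\<Sum>y\<in>J. tau y))" by simp
    also have "\<dots> = exp (c / 2 * ?n) * exp (\<Sum>y\<in>J. - tau y)"
      by (simp add: exp_add[symmetric] sum_negf)
    also have "\<dots> = exp (c / 2 * ?n) * (\<Prod>y\<in>J. exp (- tau y))"
      using J by (simp add: exp_sum)
    finally have "ennreal 1 \<le> ennreal (exp (c / 2 * ?n) * (\<Prod>y\<in>J. exp (- tau y)))"
      by (intro ennreal_leI) simp
    then show "tau \<in> {tau \<in> space env. 1 \<le> ennreal (exp (c / 2 * ?n)) * (\<Prod>y\<in>J. ennreal (exp (- tau y)))}"
      by (simp add: ennreal_mult prod_nonneg prod_ennreal)
  next
    show "{tau \<in> space env. 1 \<le> ennreal (exp (c / 2 * ?n)) * (\<Prod>y\<in>J. ennreal (exp (- tau y)))} \<in> env.events"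
      by measurable
  qed
  also have "\<dots> \<le> exp (- c / 2 * ?n)"
    using le by (simp add: env.emeasure_eq_measure)
  finally show ?thesis .
qed

text \<open>The failure probability is exponentially small in the interval length 2^(\<alpha> n),
  hence beats the polynomial number of sites in the box.\<close>

lemma AE_ball_mass:
  assumes T_pos: "AE x in T. 0 < x" and r: "0 \<le> r" and \<alpha>: "0 < \<alpha>"
  obtains c where "0 < c" "AE tau in env. \<forall>\<^sub>F n in sequentially. \<forall>x\<in>{- radius r n..radius r n}.
    c * real (ball_size \<alpha> n) \<le> (\<Sum>y\<in>{x..<x + int (ball_size \<alpha> n)}. tau y)"
proof -
  obtain c where c: "0 < c" "(\<integral>\<^sup>+x. ennreal (exp (- x)) \<partial>T) \<le> ennreal (exp (- c))"
    using laplace_T[OF T_pos] by blast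
  have "AE tau in env. \<forall>\<^sub>F n in sequentially. \<forall>x\<in>{- radius r n..radius r n}.
    c / 2 * real (ball_size \<alpha> n) \<le> (\<Sum>y\<in>{x..<x + int (ball_size \<alpha> n)}. tau y)"
  proof (rule AE_eventually_box[OF r])
    fix n x
    show "env.prob {tau. \<not> c / 2 * real (ball_size \<alpha> n) \<le> (\<Sum>y\<in>{x..<x + int (ball_size \<alpha> n)}. tau y)}
      \<le> exp (- c / 2 * (2 powr (\<alpha> * real n) - 1))"
    proof (rule order_trans)
      show "env.prob {tau. \<not> c / 2 * real (ball_size \<alpha> n) \<le> (\<Sum>y\<in>{x..<x + int (ball_size \<alpha> n)}. tau y)}
        \<le> exp (- c / 2 * real (ball_size \<alpha> n))"
        using prob_small_sum[OF c, of "{x..<x + int (ball_size \<alpha> n)}"] by simp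
      show "exp (- c / 2 * real (ball_size \<alpha> n)) \<le> exp (- c / 2 * (2 powr (\<alpha> * real n) - 1))"
        using c ball_size_bounds(1)[of \<alpha> n] by simp
    qed
    show "Measurable.pred env (\<lambda>tau. c / 2 * real (ball_size \<alpha> n) \<le> (\<Sum>y\<in>{x..<x + int (ball_size \<alpha> n)}. tau y))"
      by measurable
  next
    \<comment> \<open>With x = 2^(\<alpha> n) the power x^s equals 2^((r+1) n): the number of sites
      times an extra 2^n that makes the series geometric.\<close>
    define s where "s = (r + 1) / \<alpha>"
    have s: "0 < s" using r \<alpha> by (simp add: s_def)
    have lim: "((\<lambda>x::real. x powr s * exp (- c / 2 * (x - 1))) \<longlongrightarrow> 0) at_top"
      using c s by real_asymp
    have "filterlim (\<lambda>n. 2 powr (\<alpha> * real n)) at_top sequentially"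
      using \<alpha> by real_asymp
    from filterlim_compose[OF lim this]
    have "\<forall>\<^sub>F n in sequentially. (2 powr (\<alpha> * real n)) powr s * exp (- c / 2 * (2 powr (\<alpha> * real n) - 1)) < 1"
      by (rule order_tendstoD) simp
    then have "\<forall>\<^sub>F n in sequentially. norm (2 powr (r * real n) * exp (- c / 2 * (2 powr (\<alpha> * real n) - 1))) \<le> 2 powr (- 1 * real n)"
    proof eventually_elim
      case (elim n)
      have "(2 powr (\<alpha> * real n)) powr s = 2 powr ((r + 1) * real n)"
        using \<alpha> by (simp add: powr_powr s_def mult.commute)
      also have "\<dots> = 2 powr (r * real n) * 2 powr (real n)"
        unfolding powr_add[symmetric] by (simp add: algebra_simps)
      finally show ?case using elim by (simp add: powr_minus field_simps)
    qed
    then show "summable (\<lambda>n. 2 powr (r * real n) * exp (- c / 2 * (2 powr (\<alpha> * real n) - 1)))"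
      by (rule summable_comparison_test_ev) (rule summable_two_powr, simp)
  qed
  then show ?thesis using that[of "c / 2"] c by simp
qed

end

subsection \<open>Moments, drift and heat kernel estimate\<close>

text \<open>Decompose |k| into dyadic shells: the shell above 2^n contributes order 2^(\<gamma> n)
  times a tail of order 2^(-\<beta> n).\<close>

lemma integrable_moment_of_tails:
  fixes \<mu> :: "int pmf"
  assumes \<gamma>: "0 < \<gamma>" "\<gamma> < \<beta>"
    and left_tail: "((\<lambda>x::real. x powr \<beta> * measure_pmf.prob \<mu> {k. real_of_int k < - x})
                      \<longlongrightarrow> c_minus) at_top"
    and right_tail: "((\<lambda>x::real. x powr \<beta> * measure_pmf.prob \<mu> {k. real_of_int k > x})
                      \<longlongrightarrow> c_plus) at_top"
  shows "integrable (measure_pmf \<mu>) (\<lambda>k. \<bar>real_of_int k\<bar> powr \<gamma>)"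
proof (rule integrableI_nonneg)
  define Q where "Q x = measure_pmf.prob \<mu> {k. x < \<bar>real_of_int k\<bar>}" for x
  have "((\<lambda>x::real. x powr \<beta> * measure_pmf.prob \<mu> {k. real_of_int k < - x} +
      x powr \<beta> * measure_pmf.prob \<mu> {k. real_of_int k > x}) \<longlongrightarrow> c_minus + c_plus) at_top"
    by (intro tendsto_add left_tail right_tail)
  moreover have "filterlim (\<lambda>n. 2 powr real n) at_top sequentially" by real_asymp
  ultimately have "(\<lambda>n. (2 powr real n) powr \<beta> * measure_pmf.prob \<mu> {k. real_of_int k < - (2 powr real n)} +
      (2 powr real n) powr \<beta> * measure_pmf.prob \<mu> {k. real_of_int k > 2 powr real n}) \<longlonglongrightarrow> c_minus + c_plus"
    by (rule filterlim_compose)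
  then have "Bseq (\<lambda>n. (2 powr real n) powr \<beta> * measure_pmf.prob \<mu> {k. real_of_int k < - (2 powr real n)} +
      (2 powr real n) powr \<beta> * measure_pmf.prob \<mu> {k. real_of_int k > 2 powr real n})"
    by (intro convergent_imp_Bseq convergentI)
  then obtain C where C: "0 < C" "\<And>n. norm ((2 powr real n) powr \<beta> * measure_pmf.prob \<mu> {k. real_of_int k < - (2 powr real n)} +
      (2 powr real n) powr \<beta> * measure_pmf.prob \<mu> {k. real_of_int k > 2 powr real n}) \<le> C"
    by (auto simp: Bseq_def)
  have Q: "Q (2 powr real n) \<le> C * 2 powr (- \<beta> * real n)" for n
  proof -
    let ?x = "2 powr real n"
    have "Q ?x \<le> measure_pmf.prob \<mu> ({k. real_of_int k < - ?x} \<union> {k. real_of_int k > ?x})"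
      unfolding Q_def by (intro measure_pmf.finite_measure_mono) auto
    also have "\<dots> \<le> measure_pmf.prob \<mu> {k. real_of_int k < - ?x} + measure_pmf.prob \<mu> {k. real_of_int k > ?x}"
      by (intro measure_Un_le) auto
    finally have "?x powr \<beta> * Q ?x \<le> ?x powr \<beta> * (measure_pmf.prob \<mu> {k. real_of_int k < - ?x} + measure_pmf.prob \<mu> {k. real_of_int k > ?x})"
      by (intro mult_left_mono) auto
    also have "\<dots> \<le> C" using C(2)[of n] by (simp add: distrib_left)
    finally have "?x powr \<beta> * Q ?x \<le> C" .
    moreover have "?x powr \<beta> = 2 powr (\<beta> * real n)" by (simp add: powr_powr mult.commute)
    ultimately show ?thesis by (simp add: powr_minus field_simps)
  qed
  have le_suminf: "F n \<le> (\<Sum>n. F n)" for F :: "nat \<Rightarrow> ennreal" and n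
    using sum_le_suminf[OF summableI, of "{n}" F] by simp
  have pw: "ennreal (\<bar>real_of_int k\<bar> powr \<gamma>) \<le>
    1 + (\<Sum>n. ennreal (2 powr (\<gamma> * (real n + 1))) * indicator {k. 2 powr real n < \<bar>real_of_int k\<bar>} k)" for k
  proof (cases "\<bar>real_of_int k\<bar> \<le> 1")
    case True
    then have "\<bar>real_of_int k\<bar> powr \<gamma> \<le> 1 powr \<gamma>" using \<gamma> by (intro powr_mono2) auto
    then have "ennreal (\<bar>real_of_int k\<bar> powr \<gamma>) \<le> ennreal 1" by (intro ennreal_leI) simp
    then show ?thesis by (simp add: add_increasing2)
  next
    case False
    obtain m0 where "\<bar>real_of_int k\<bar> < 2 ^ m0"
      using real_arch_pow[of 2 "\<bar>real_of_int k\<bar>"] by auto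
    then have ex: "\<exists>m. \<bar>real_of_int k\<bar> \<le> 2 powr real m"
      by (intro exI[of _ m0]) (simp add: powr_realpow)
    \<comment> \<open>The least dyadic exponent reaching |k|; it is positive since |k| > 1, and its
      predecessor n then satisfies 2^n < |k|.\<close>
    define m where "m = (LEAST m. \<bar>real_of_int k\<bar> \<le> 2 powr real m)"
    have m: "\<bar>real_of_int k\<bar> \<le> 2 powr real m" unfolding m_def by (rule LeastI_ex[OF ex])
    have "m \<noteq> 0" using m False by (intro notI) simp
    then obtain n where n: "m = Suc n" by (cases m) auto
    have n': "2 powr real n < \<bar>real_of_int k\<bar>"
      using not_less_Least[of n "\<lambda>m. \<bar>real_of_int k\<bar> \<le> 2 powr real m"] n unfolding m_def[symmetric] by simp
    have "\<bar>real_of_int k\<bar> powr \<gamma> \<le> (2 powr real m) powr \<gamma>" using m \<gamma> by (intro powr_mono2) auto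
    also have "\<dots> = 2 powr (\<gamma> * (real n + 1))" by (simp add: powr_powr n mult.commute add.commute)
    finally have "ennreal (\<bar>real_of_int k\<bar> powr \<gamma>) \<le> ennreal (2 powr (\<gamma> * (real n + 1))) * indicator {k. 2 powr real n < \<bar>real_of_int k\<bar>} k"
      using n' by (simp add: ennreal_leI)
    also have "\<dots> \<le> (\<Sum>n. ennreal (2 powr (\<gamma> * (real n + 1))) * indicator {k. 2 powr real n < \<bar>real_of_int k\<bar>} k)"
      by (rule le_suminf)
    finally show ?thesis by (simp add: add_increasing)
  qed
  have "(\<integral>\<^sup>+k. ennreal (\<bar>real_of_int k\<bar> powr \<gamma>) \<partial>measure_pmf \<mu>) \<le>
    (\<integral>\<^sup>+k. 1 + (\<Sum>n. ennreal (2 powr (\<gamma> * (real n + 1))) * indicator {k. 2 powr real n < \<bar>real_of_int k\<bar>} k) \<partial>measure_pmf \<mu>)"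
    by (intro nn_integral_mono pw)
  also have "\<dots> = 1 + (\<Sum>n. ennreal (2 powr (\<gamma> * (real n + 1))) * emeasure (measure_pmf \<mu>) {k. 2 powr real n < \<bar>real_of_int k\<bar>})"
    by (subst nn_integral_add)
      (auto simp: nn_integral_suminf nn_integral_cmult_indicator measure_pmf.emeasure_space_1[simplified])
  also have "\<dots> \<le> 1 + (\<Sum>n. ennreal (2 powr \<gamma> * C * 2 powr (- (\<beta> - \<gamma>) * real n)))"
  proof (intro add_left_mono suminf_le summableI)
    fix n
    have "ennreal (2 powr (\<gamma> * (real n + 1))) * emeasure (measure_pmf \<mu>) {k. 2 powr real n < \<bar>real_of_int k\<bar>}
      = ennreal (2 powr (\<gamma> * (real n + 1)) * Q (2 powr real n))"
      by (simp add: Q_def measure_pmf.emeasure_eq_measure ennreal_mult)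
    also have "\<dots> \<le> ennreal (2 powr (\<gamma> * (real n + 1)) * (C * 2 powr (- \<beta> * real n)))"
      by (intro ennreal_leI mult_left_mono Q) auto
    also have "2 powr (\<gamma> * (real n + 1)) * (C * 2 powr (- \<beta> * real n)) = C * 2 powr (\<gamma> * (real n + 1) + - \<beta> * real n)"
      by (simp only: powr_add mult_ac)
    also have "\<gamma> * (real n + 1) + - \<beta> * real n = \<gamma> + - (\<beta> - \<gamma>) * real n" by (simp add: algebra_simps)
    also have "C * 2 powr (\<gamma> + - (\<beta> - \<gamma>) * real n) = 2 powr \<gamma> * C * 2 powr (- (\<beta> - \<gamma>) * real n)"
      by (simp only: powr_add mult_ac)
    finally show "ennreal (2 powr (\<gamma> * (real n + 1))) * emeasure (measure_pmf \<mu>) {k. 2 powr real n < \<bar>real_of_int k\<bar>} \<le>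
      ennreal (2 powr \<gamma> * C * 2 powr (- (\<beta> - \<gamma>) * real n))" .
  qed
  also have "\<dots> < \<infinity>"
  proof -
    have "summable (\<lambda>n. 2 powr \<gamma> * C * 2 powr (- (\<beta> - \<gamma>) * real n))"
      using \<gamma> by (intro summable_mult summable_two_powr) simp
    then have "(\<Sum>n. ennreal (2 powr \<gamma> * C * 2 powr (- (\<beta> - \<gamma>) * real n))) \<noteq> top"
      using C by (subst suminf_ennreal2) auto
    then show ?thesis by (simp add: less_top)
  qed
  finally show "(\<integral>\<^sup>+k. ennreal (\<bar>real_of_int k\<bar> powr \<gamma>) \<partial>measure_pmf \<mu>) < \<infinity>" .
qed auto

text \<open>A bounded smooth Lyapunov function: it vanishes at 0 and is at least 1/2 for |y| at
  least 1, so twice \<open>escape\<close> of x/R serves as G for the box of radius R.\<close>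

definition escape :: "real \<Rightarrow> real" where
  "escape y = y\<^sup>2 / (1 + y\<^sup>2)"

lemma escape_eq: "escape y = 1 - 1 / (1 + y\<^sup>2)"
proof -
  have "1 + y\<^sup>2 \<noteq> 0" using zero_le_power2[of y] by linarith
  then show ?thesis by (simp add: escape_def field_simps)
qed

lemma escape_bounds: "0 \<le> escape y" "escape y \<le> 1"
proof -
  show "0 \<le> escape y" by (simp add: escape_def)
  have "0 \<le> 1 / (1 + y\<^sup>2)" by simp
  then show "escape y \<le> 1" unfolding escape_eq by linarith
qed

text \<open>For |h| at most 1 the second order remainder is at most h^2, hence at most |h|^\<gamma>.
  For larger h, the change of \<open>escape\<close> is at most 1 and the linear term at most |h|,
  and each is at most |h|^\<gamma>.\<close>

lemma escape_taylor:
  assumes \<gamma>: "1 \<le> \<gamma>" "\<gamma> \<le> 2"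
  shows "escape (y + h) \<le> escape y + 2 * y / (1 + y\<^sup>2)\<^sup>2 * h + 2 * \<bar>h\<bar> powr \<gamma>"
proof (cases "\<bar>h\<bar> \<le> 1")
  case True
  define a b where "a = 1 + y\<^sup>2" and "b = 1 + (y + h)\<^sup>2"
  have ab: "1 \<le> a" "1 \<le> b" by (auto simp: a_def b_def)
  \<comment> \<open>The remainder of a rational function is computed exactly, so no derivative
    estimates are involved.\<close>
  have "escape (y + h) - escape y - 2 * y / a\<^sup>2 * h = h\<^sup>2 * (1 - 3 * y\<^sup>2 - 2 * y * h) / (a\<^sup>2 * b)"
  proof -
    have "escape (y + h) = 1 - 1 / b" "escape y = 1 - 1 / a"
      by (simp_all add: escape_eq a_def b_def)
    then have "escape (y + h) - escape y - 2 * y / a\<^sup>2 * h = 1 / a - 1 / b - 2 * y * h / a\<^sup>2" by simp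
    also have "\<dots> = (a * b - a\<^sup>2 - 2 * y * h * b) / (a\<^sup>2 * b)"
      using ab by (simp add: field_simps power2_eq_square)
    also have "a * b - a\<^sup>2 - 2 * y * h * b = h\<^sup>2 * (1 - 3 * y\<^sup>2 - 2 * y * h)"
      unfolding a_def b_def by (simp add: power2_eq_square algebra_simps)
    finally show ?thesis .
  qed
  also have "\<dots> \<le> h\<^sup>2"
  proof -
    \<comment> \<open>The difference of the two sides is the perfect square (2 y + h)^2.\<close>
    have "1 - 3 * y\<^sup>2 - 2 * y * h \<le> b"
    proof -
      have "b - (1 - 3 * y\<^sup>2 - 2 * y * h) = (2 * y + h)\<^sup>2"
        unfolding b_def by (simp add: power2_eq_square algebra_simps)
      then show ?thesis using zero_le_power2[of "2 * y + h"] by linarith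
    qed
    also have "b \<le> a\<^sup>2 * b"
      using mult_right_mono[OF one_le_power[OF ab(1), of 2], of b] ab by simp
    finally have "h\<^sup>2 * (1 - 3 * y\<^sup>2 - 2 * y * h) \<le> h\<^sup>2 * (a\<^sup>2 * b)" by (intro mult_left_mono) auto
    then show ?thesis using ab by (simp add: divide_le_eq)
  qed
  also have "h\<^sup>2 \<le> \<bar>h\<bar> powr \<gamma>"
  proof (cases "h = 0")
    case False
    then have "h\<^sup>2 = \<bar>h\<bar> powr 2" by (simp add: powr_numeral)
    also have "\<dots> \<le> \<bar>h\<bar> powr \<gamma>" using True False \<gamma> by (intro powr_mono') auto
    finally show ?thesis .
  qed simp
  finally show ?thesis unfolding a_def using powr_ge_zero[of "\<bar>h\<bar>" \<gamma>] by linarith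
next
  case False
  have "\<bar>2 * y\<bar> \<le> (1 + y\<^sup>2)\<^sup>2"
  proof -
    have "\<bar>2 * y\<bar> \<le> 1 + y\<^sup>2"
      using zero_le_power2[of "\<bar>y\<bar> - 1"] by (simp add: power2_eq_square algebra_simps)
    also have "\<dots> \<le> (1 + y\<^sup>2)\<^sup>2" by (rule self_le_power) auto
    finally show ?thesis .
  qed
  then have "\<bar>2 * y / (1 + y\<^sup>2)\<^sup>2\<bar> \<le> 1"
    by (simp add: abs_mult divide_le_eq_1 add_nonneg_pos)
  then have "\<bar>2 * y / (1 + y\<^sup>2)\<^sup>2 * h\<bar> \<le> 1 * \<bar>h\<bar>"
    unfolding abs_mult by (intro mult_right_mono) auto
  moreover have "\<bar>h\<bar> powr 1 \<le> \<bar>h\<bar> powr \<gamma>" using False \<gamma> by (intro powr_mono) auto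
  then have "\<bar>h\<bar> \<le> \<bar>h\<bar> powr \<gamma>" "1 \<le> \<bar>h\<bar> powr \<gamma>" using False by auto
  ultimately show ?thesis using escape_bounds[of y] escape_bounds[of "y + h"] by linarith
qed

text \<open>The linear Taylor term has mean zero because the walk is centred; the remainder,
  rescaled by R, is of order R^(-\<gamma>) times the moment of order
  \<open>\<gamma>\<close>.\<close>

lemma escape_drift:
  fixes \<mu> :: "int pmf"
  assumes integ: "integrable (measure_pmf \<mu>) real_of_int"
    and mean0: "measure_pmf.expectation \<mu> real_of_int = 0"
    and \<gamma>: "1 \<le> \<gamma>" "\<gamma> \<le> 2" and mom: "integrable (measure_pmf \<mu>) (\<lambda>k. \<bar>real_of_int k\<bar> powr \<gamma>)"
    and R: "0 < R"
  shows "(\<integral>\<^sup>+k. ennreal (2 * escape (real_of_int (x + k) / R)) \<partial>measure_pmf \<mu>) \<le>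
    ennreal (2 * escape (real_of_int x / R) + 4 * (\<integral>k. \<bar>real_of_int k\<bar> powr \<gamma> \<partial>measure_pmf \<mu>) * R powr (- \<gamma>))"
proof -
  define y where "y = real_of_int x / R"
  define d where "d = 2 * y / (1 + y\<^sup>2)\<^sup>2 / R"
  define m where "m = (\<integral>k. \<bar>real_of_int k\<bar> powr \<gamma> \<partial>measure_pmf \<mu>)"
  have int_e: "integrable (measure_pmf \<mu>) (\<lambda>k. 2 * escape (real_of_int (x + k) / R))"
    using escape_bounds by (intro measure_pmf.integrable_const_bound[where B=2] AE_I2) auto
  have "(\<integral>\<^sup>+k. ennreal (2 * escape (real_of_int (x + k) / R)) \<partial>measure_pmf \<mu>) =
     ennreal (\<integral>k. 2 * escape (real_of_int (x + k) / R) \<partial>measure_pmf \<mu>)"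
    using int_e escape_bounds by (intro nn_integral_eq_integral) auto
  also have "\<dots> \<le> ennreal (\<integral>k. 2 * (escape y + d * real_of_int k + 2 * R powr (- \<gamma>) * \<bar>real_of_int k\<bar> powr \<gamma>) \<partial>measure_pmf \<mu>)"
  proof (intro ennreal_leI integral_mono int_e)
    show "integrable (measure_pmf \<mu>) (\<lambda>k. 2 * (escape y + d * real_of_int k + 2 * R powr (- \<gamma>) * \<bar>real_of_int k\<bar> powr \<gamma>))"
      using integ mom by simp
    fix k :: int
    have "real_of_int (x + k) / R = y + real_of_int k / R" by (simp add: y_def add_divide_distrib)
    moreover have "\<bar>real_of_int k / R\<bar> powr \<gamma> = R powr (- \<gamma>) * \<bar>real_of_int k\<bar> powr \<gamma>"
      using R by (simp add: abs_divide powr_divide powr_minus field_simps)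
    ultimately have "escape (real_of_int (x + k) / R) \<le> escape y + d * real_of_int k + 2 * R powr (- \<gamma>) * \<bar>real_of_int k\<bar> powr \<gamma>"
      using escape_taylor[OF \<gamma>, of y "real_of_int k / R"] by (simp add: d_def)
    then show "2 * escape (real_of_int (x + k) / R) \<le> 2 * (escape y + d * real_of_int k + 2 * R powr (- \<gamma>) * \<bar>real_of_int k\<bar> powr \<gamma>)"
      by simp
  qed
  also have "(\<integral>k. 2 * (escape y + d * real_of_int k + 2 * R powr (- \<gamma>) * \<bar>real_of_int k\<bar> powr \<gamma>) \<partial>measure_pmf \<mu>)
    = 2 * escape y + 4 * m * R powr (- \<gamma>)"
    using integ mom mean0 by (simp add: m_def algebra_simps measure_pmf.prob_space[simplified])
  finally show ?thesis unfolding y_def m_def .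
qed

context trap_box
begin

lemma k_outside: "i \<in> L \<Longrightarrow> z \<notin> L \<Longrightarrow> k i m z = 0"
  by (cases m) (auto simp: k_0 k_Suc lazy_step_def)

text \<open>At a step m of small energy, a value above \<eta> at some x would keep the function
  above \<eta>/2 on an interval of length \<open>\<rho>\<close>, by the Hoelder bound and
  \<open>small\<close>. Its \<open>tau\<close>-mass would then exceed M, by \<open>mass\<close> and
  \<open>big\<close>, although the total weighted mass is at most \<open>tau i\<close>.\<close>

lemma v_small:
  assumes holder: "\<And>f x y s. (\<And>z. z \<notin> L \<Longrightarrow> f z = 0) \<Longrightarrow> 0 < s \<Longrightarrow>
      f x - f y \<le> s * energy \<mu> L f + C * \<bar>real_of_int (x - y)\<bar> powr \<kappa> / s"
    and C: "0 \<le> C" "0 \<le> \<kappa>" and L0: "0 \<in> L" and i: "i \<in> L" "tau i \<le> M"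
    and mass: "\<And>x. x \<in> L \<Longrightarrow> c1 * real \<rho> \<le> (\<Sum>y\<in>{x..<x + int \<rho>}. tau y)"
    and tau_all: "\<And>x. 0 < tau x"
    and t: "8 \<le> t" and \<eta>: "0 < \<eta>" and s: "0 < s"
    and small: "s * (8 * M / t) + C * real \<rho> powr \<kappa> / s \<le> \<eta> / 2"
    and big: "M < \<eta> / 2 * (c1 * real \<rho>)"
  shows "v i t 0 \<le> exp (- t / 4) + \<eta>"
proof -
  \<comment> \<open>Small enough for the Poisson bound in \<open>v_le\<close>, yet at least ct/8
    because ct is at least 8. Dividing the budget \<open>c * tau i\<close> by N then gives 8 M/t,
    free of c.\<close>
  define N where "N = nat \<lfloor>c * t / 4\<rfloor>"
  have ct: "8 \<le> c * t" using mult_mono[OF c_ge_1 t] c_ge_1 by simp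
  then have "real N = of_int \<lfloor>c * t / 4\<rfloor>" by (simp add: N_def)
  then have N: "real N \<le> c * t / 4" "c * t / 8 \<le> real N" using ct by linarith+
  then have N0: "0 < N" using ct by (intro Nat.gr0I) auto
  obtain m where m: "m < N" "energy \<mu> L (k i m) \<le> c * tau i / real N"
    using exists_small_energy[OF i(1) N0] by blast
  have ti: "0 < tau i" using tau_all by simp
  have "c * tau i / real N \<le> c * tau i / (c * t / 8)"
    using N ct ti c_ge_1 by (intro divide_left_mono mult_pos_pos) auto
  also have "\<dots> = 8 * tau i / t" using c_ge_1 t by simp
  also have "\<dots> \<le> 8 * M / t" using i t by (intro divide_right_mono) auto
  finally have en: "energy \<mu> L (k i m) \<le> 8 * M / t" using m by simp
  have "k i m x \<le> \<eta>" if x: "x \<in> L" for x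
  proof (rule ccontr)
    assume neg: "\<not> k i m x \<le> \<eta>"
    let ?B = "{x..<x + int \<rho>}"
    have low: "\<eta> / 2 \<le> k i m y" if y: "y \<in> ?B" for y
    proof -
      have "k i m x - k i m y \<le> s * energy \<mu> L (k i m) + C * \<bar>real_of_int (x - y)\<bar> powr \<kappa> / s"
        using i s by (intro holder k_outside)
      also have "\<dots> \<le> s * (8 * M / t) + C * real \<rho> powr \<kappa> / s"
        using en s C y by (intro add_mono mult_left_mono divide_right_mono powr_mono2) auto
      also have "\<dots> \<le> \<eta> / 2" by (rule small)
      finally show ?thesis using neg by simp
    qed
    \<comment> \<open>The interval might have stuck out of the box, but the iterate vanishes outside
      \<open>L\<close> and is at least \<eta>/2 > 0 here.\<close>
    then have sub: "?B \<subseteq> L" using k_outside[OF i(1)] \<eta> by force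
    have "\<eta> / 2 * (c1 * real \<rho>) \<le> \<eta> / 2 * (\<Sum>y\<in>?B. tau y)"
      using mass[OF x] \<eta> by (intro mult_left_mono) auto
    also have "\<dots> \<le> (\<Sum>y\<in>?B. tau y * k i m y)"
      unfolding sum_distrib_left using low tau_all
      by (intro sum_mono) (subst mult.commute, intro mult_left_mono, auto simp: less_imp_le)
    also have "\<dots> \<le> (\<Sum>y\<in>L. tau y * k i m y)"
      using fin sub tau_all k_nonneg by (intro sum_mono2) (auto simp: less_imp_le)
    also have "\<dots> \<le> tau i" using i by (intro sum_tau_k_le)
    finally show False using big i by simp
  qed
  \<comment> \<open>The good step m precedes N, so the maximum principle covers all steps from N
    on.\<close>
  then have "k i m' 0 \<le> \<eta>" if "N \<le> m'" for m'
    by (rule k_le_later[of i m]) (use that m \<eta> L0 in auto)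
  then show ?thesis using L0 t \<eta> N by (intro v_le) auto
qed

end

subsection \<open>Conclusion\<close>

text \<open>Roles at time t: traps in the box are below t^a, the radius is t^r,
  \<open>\<gamma>\<close> is a finite moment of the walk, t^(1+\<delta>) bounds the jumps up to a
  factor, \<open>\<kappa>\<close> is twice the Hoelder order, and t^\<alpha> is the interval length.
  Choose a between 1/(p\<beta>) and 1/\<beta>, then r between 1/\<beta> and p a; in the limit
  \<kappa> = \<beta> - 1 and \<alpha> = a the last constraint reads a\<beta> < 1.\<close>

lemma exponents_exist:
  fixes \<beta> p :: real
  assumes "1 < \<beta>" "\<beta> \<le> 2" "1 < p"
  obtains a r \<gamma> \<kappa> \<alpha> \<delta> where "0 < a" "0 \<le> r" "r < p * a" "1 \<le> \<gamma>" "\<gamma> < \<beta>" "1 + \<delta> < \<gamma> * r" "0 < \<delta>"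
    "\<beta> - 1 < \<kappa>" "0 \<le> \<kappa>" "\<kappa> \<le> 2" "a < \<alpha>" "\<alpha> * \<kappa> + a < 1"
proof -
  have "1 / (p * \<beta>) < 1 / \<beta>" using assms by (simp add: field_simps)
  then obtain a where a: "1 / (p * \<beta>) < a" "a < 1 / \<beta>" using dense by blast
  have a0: "0 < a" using a assms by (smt (verit) divide_pos_pos mult_pos_pos)
  have "1 / \<beta> < p * a" using a assms by (simp add: field_simps)
  then obtain r where r: "1 / \<beta> < r" "r < p * a" using dense by blast
  have r0: "0 < r" using r assms by (smt (verit) divide_pos_pos)
  have "1 / r < \<beta>" using r r0 assms by (simp add: field_simps)
  then have "max 1 (1 / r) < \<beta>" using assms by simp
  then obtain \<gamma> where \<gamma>: "max 1 (1 / r) < \<gamma>" "\<gamma> < \<beta>" using dense by blast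
  have gr: "1 < \<gamma> * r" using \<gamma> r0 by (simp add: field_simps)
  \<comment> \<open>A common perturbation of \<open>\<alpha>\<close> and \<open>\<kappa>\<close>.
    The cross terms amount to at most 3\<zeta>, which is at most half of the available gap 1 -
    a\<beta>.\<close>
  define \<zeta> where "\<zeta> = min 1 ((1 - a * \<beta>) / 6)"
  have ab: "a * \<beta> < 1" using a assms by (simp add: field_simps)
  have \<zeta>: "0 < \<zeta>" "\<zeta> \<le> 1" "6 * \<zeta> \<le> 1 - a * \<beta>" using ab by (auto simp: \<zeta>_def min_def)
  have a1: "a \<le> 1" using a assms by (smt (verit) divide_le_eq_1)
  have "(a + \<zeta>) * (\<beta> - 1 + \<zeta>) = a * (\<beta> - 1) + \<zeta> * (a + (\<beta> - 1) + \<zeta>)" by (simp add: algebra_simps)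
  also have "\<dots> \<le> a * (\<beta> - 1) + \<zeta> * 3"
    using a1 \<zeta> assms by (intro add_left_mono mult_left_mono) auto
  also have "\<dots> < 1 - a" using \<zeta> by (simp add: algebra_simps)
  finally have "(a + \<zeta>) * (\<beta> - 1 + \<zeta>) + a < 1" by simp
  moreover have "1 + (\<gamma> * r - 1) / 2 < \<gamma> * r" using gr by (simp add: field_simps)
  ultimately show ?thesis
    using that[of a r \<gamma> "(\<gamma> * r - 1) / 2" "\<beta> - 1 + \<zeta>" "a + \<zeta>"] a0 r0 r \<gamma> gr \<zeta> assms by simp
qed

lemma two_powr_tendsto_0: "0 < d \<Longrightarrow> (\<lambda>n. 2 powr (- d * real n)) \<longlonglongrightarrow> 0"
  by (intro summable_LIMSEQ_zero summable_two_powr)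

text \<open>The deterministic half of the proof, for one fixed environment. The bounds at dyadic
  scale n serve every t in [2^n/2, 2^n], since t matters only up to a factor 2.\<close>

lemma trap_quenched_tendsto_0:
  fixes \<mu> :: "int pmf" and tau :: "int \<Rightarrow> real"
  assumes tau: "\<And>x. 0 < tau x"
    and C: "0 \<le> C"
    and holder: "\<And>L f x y s. finite L \<Longrightarrow> (\<And>z. z \<notin> L \<Longrightarrow> f z = 0) \<Longrightarrow> 0 < s \<Longrightarrow>
      f x - f y \<le> s * energy \<mu> L f + C * \<bar>real_of_int (x - y)\<bar> powr \<kappa> / s"
    and integ: "integrable (measure_pmf \<mu>) real_of_int"
    and mean0: "measure_pmf.expectation \<mu> real_of_int = 0"
    and \<gamma>: "1 \<le> \<gamma>" "\<gamma> \<le> 2" and mom: "integrable (measure_pmf \<mu>) (\<lambda>k. \<bar>real_of_int k\<bar> powr \<gamma>)"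
    and jumps: "\<forall>\<^sub>F n in sequentially. \<forall>N.
      laplace_jumps \<mu> (2 powr (- real n)) N tau 0 \<le> ennreal (2 powr ((1 + \<delta>) * real n) / tau 0)"
    and sites: "\<forall>\<^sub>F n in sequentially. \<forall>x\<in>{- radius r n..radius r n}. tau x \<le> 2 powr (a * real n)"
    and mass: "\<forall>\<^sub>F n in sequentially. \<forall>x\<in>{- radius r n..radius r n}.
      c1 * real (ball_size \<alpha> n) \<le> (\<Sum>y\<in>{x..<x + int (ball_size \<alpha> n)}. tau y)"
    and c1: "0 < c1"
    and ex: "0 < a" "0 \<le> \<kappa>" "1 + \<delta> < \<gamma> * r" "a < \<alpha>" "\<alpha> * \<kappa> + a < 1"
  shows "((\<lambda>t. SUP i. trap_quenched \<mu> tau t i) \<longlongrightarrow> 0) at_top"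
proof (rule tendstoI)
  fix e :: real assume e: "0 < e"
  define \<eta> where "\<eta> = e / 8"
  have \<eta>: "0 < \<eta>" using e by (simp add: \<eta>_def)
  define mm where "mm = (\<integral>k. \<bar>real_of_int k\<bar> powr \<gamma> \<partial>measure_pmf \<mu>)"
  have mm: "0 \<le> mm" unfolding mm_def by (intro integral_nonneg_AE) auto
  \<comment> \<open>The three smallness conditions at scale n: \<open>F1\<close> for the Hoelder
    error, \<open>F2\<close> for the mass comparison, \<open>F3\<close> for leaving the box.\<close>
  have "(\<lambda>n. C * 64 / \<eta> * 2 powr (- (1 - \<alpha> * \<kappa> - a) * real n)) \<longlonglongrightarrow> C * 64 / \<eta> * 0"
    using ex by (intro tendsto_mult tendsto_const two_powr_tendsto_0) auto
  then have F1: "\<forall>\<^sub>F n in sequentially. C * 64 / \<eta> * 2 powr (- (1 - \<alpha> * \<kappa> - a) * real n) < \<eta> / 4"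
    by (rule order_tendstoD) (use \<eta> in simp)
  have "(\<lambda>n. 2 powr (- (\<alpha> - a) * real n) + \<eta> * c1 / 2 * 2 powr (- \<alpha> * real n)) \<longlonglongrightarrow> 0 + \<eta> * c1 / 2 * 0"
    using ex by (intro tendsto_mult tendsto_add tendsto_const two_powr_tendsto_0) auto
  then have F2: "\<forall>\<^sub>F n in sequentially. 2 powr (- (\<alpha> - a) * real n) + \<eta> * c1 / 2 * 2 powr (- \<alpha> * real n) < \<eta> * c1 / 2"
    by (rule order_tendstoD) (use \<eta> c1 in simp)
  have "(\<lambda>n. 4 * mm * exp 1 / tau 0 * 2 powr (- (\<gamma> * r - (1 + \<delta>)) * real n)) \<longlonglongrightarrow> 4 * mm * exp 1 / tau 0 * 0"
    using ex by (intro tendsto_mult tendsto_const two_powr_tendsto_0) auto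
  then have F3: "\<forall>\<^sub>F n in sequentially. 4 * mm * exp 1 / tau 0 * 2 powr (- (\<gamma> * r - (1 + \<delta>)) * real n) < \<eta>"
    by (rule order_tendstoD) (use \<eta> in simp)
  have level: "\<forall>\<^sub>F n in sequentially. \<forall>t. 2 powr real n / 2 \<le> t \<and> t \<le> 2 powr real n \<and> 8 \<le> t \<longrightarrow>
      (\<forall>i. trap_quenched \<mu> tau t i \<le> exp (- t / 4) + \<eta> + \<eta>)"
    using jumps sites mass F1 F2 F3
  proof eventually_elim
    case (elim n)
    show ?case
    proof (intro allI impI)
      fix t i assume "2 powr real n / 2 \<le> t \<and> t \<le> 2 powr real n \<and> 8 \<le> t"
      then have t: "2 powr real n / 2 \<le> t" "t \<le> 2 powr real n" "8 \<le> t" by auto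
      define R where "R = 2 powr (r * real n)"
      define L where "L = {- radius r n..radius r n}"
      \<comment> \<open>Any rate that makes the chain lazy on the finite box will do, since the
        bound of \<open>v_small\<close> does not contain c.\<close>
      define c where "c = 1 + (\<Sum>x\<in>L. 2 / tau x)"
      define \<rho> where "\<rho> = ball_size \<alpha> n"
      define M where "M = 2 powr (a * real n)"
      \<comment> \<open>Chosen so that the energy term is at most \<eta>/4: on this window 8 M/t is
        at most 16 times 2^((a-1) n), and 64 = 4 * 16.\<close>
      define s where "s = \<eta> / (64 * 2 powr ((a - 1) * real n))"
      have R: "0 < R" by (simp add: R_def)
      have rad: "R \<le> real_of_int (radius r n)" unfolding R_def radius_def by linarith
      have L0: "0 \<in> L" using R rad unfolding L_def by simp
      have tau0: "0 < tau 0" by (rule tau)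
      interpret B: trap_box \<mu> L tau c
      proof
        show "finite L" by (simp add: L_def)
        show "1 \<le> c" unfolding c_def using tau by (simp add: sum_nonneg less_imp_le)
        fix x assume x: "x \<in> L"
        show "0 < tau x" by (rule tau)
        have "2 / tau x \<le> (\<Sum>x\<in>L. 2 / tau x)"
          using x tau \<open>finite L\<close> by (intro member_le_sum) (auto simp: less_imp_le)
        then have "2 / tau x \<le> c" by (simp add: c_def)
        then show "2 \<le> c * tau x" using tau[of x] by (simp add: field_simps)
      qed
      have G2: "1 \<le> 2 * escape (real_of_int x / R)" if "x \<notin> L" for x
      proof -
        have "R \<le> \<bar>real_of_int x\<bar>" using that rad unfolding L_def by auto
        then have "1 \<le> \<bar>real_of_int x / R\<bar>" using R by (simp add: abs_divide)
        then have "1 \<le> \<bar>real_of_int x / R\<bar>\<^sup>2" by (rule one_le_power)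
        then have "1 \<le> (real_of_int x / R)\<^sup>2" unfolding power2_abs .
        then have "1 / (1 + (real_of_int x / R)\<^sup>2) \<le> 1 / 2" by (intro divide_left_mono) auto
        then show ?thesis unfolding escape_eq by simp
      qed
      have main: "trap_quenched \<mu> tau t i \<le> (if i \<in> L then B.v i t 0 else 0) +
        (4 * mm * R powr (- \<gamma>)) * exp (2 powr (- real n) * t) * (2 powr ((1 + \<delta>) * real n) / tau 0)"
      proof (rule B.trap_quenched_le[where G="\<lambda>x. 2 * escape (real_of_int x / R)"])
        show "0 \<le> 2 * escape (real_of_int x / R)" for x using escape_bounds by simp
        show "2 * escape (real_of_int 0 / R) = 0" by (simp add: escape_def)
        show "(\<integral>\<^sup>+k. ennreal (2 * escape (real_of_int (x + k) / R)) \<partial>measure_pmf \<mu>) \<le>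
          ennreal (2 * escape (real_of_int x / R) + 4 * mm * R powr (- \<gamma>))" for x
          unfolding mm_def by (rule escape_drift[OF integ mean0 \<gamma> mom R])
        show "laplace_jumps \<mu> (2 powr (- real n)) N tau 0 \<le> ennreal (2 powr ((1 + \<delta>) * real n) / tau 0)" for N
          using elim by blast
      qed (use tau mm L0 G2 t tau0 in \<open>auto simp: less_imp_le\<close>)
      have "(4 * mm * R powr (- \<gamma>)) * exp (2 powr (- real n) * t) * (2 powr ((1 + \<delta>) * real n) / tau 0)
        \<le> (4 * mm * R powr (- \<gamma>)) * exp 1 * (2 powr ((1 + \<delta>) * real n) / tau 0)"
      \<comment> \<open>With l = 2^(-n) the product l t is at most 1 on the window, so the discount
        costs only a factor e.\<close>
      proof (intro mult_right_mono mult_left_mono)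
        have "2 powr (- real n) * t \<le> 2 powr (- real n) * 2 powr (real n)" using t by (intro mult_left_mono) auto
        also have "\<dots> = 1" by (simp add: powr_minus)
        finally show "exp (2 powr (- real n) * t) \<le> exp 1" by simp
      qed (use mm tau0 in auto)
      also have "\<dots> = 4 * mm * exp 1 / tau 0 * (R powr (- \<gamma>) * 2 powr ((1 + \<delta>) * real n))" by simp
      also have "R powr (- \<gamma>) * 2 powr ((1 + \<delta>) * real n) = 2 powr (- (\<gamma> * r - (1 + \<delta>)) * real n)"
        unfolding R_def powr_powr powr_add[symmetric] by (simp add: algebra_simps)
      also have "4 * mm * exp 1 / tau 0 * \<dots> < \<eta>" using elim by blast
      finally have tail: "(4 * mm * R powr (- \<gamma>)) * exp (2 powr (- real n) * t) * (2 powr ((1 + \<delta>) * real n) / tau 0) \<le> \<eta>"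
        by simp
      have "(if i \<in> L then B.v i t 0 else 0) \<le> exp (- t / 4) + \<eta>"
      proof (cases "i \<in> L")
        case True
        have "B.v i t 0 \<le> exp (- t / 4) + \<eta>"
        proof (rule B.v_small[where C=C and \<kappa>=\<kappa> and M=M and \<rho>=\<rho> and s=s and ?c1.0=c1])
          show "f x - f y \<le> s * energy \<mu> L f + C * \<bar>real_of_int (x - y)\<bar> powr \<kappa> / s"
            if "\<And>z. z \<notin> L \<Longrightarrow> f z = 0" "0 < s" for f x y s
            using that by (intro holder B.fin)
          show "tau i \<le> M" using elim True by (auto simp: M_def L_def)
          show "c1 * real \<rho> \<le> (\<Sum>y\<in>{x..<x + int \<rho>}. tau y)" if "x \<in> L" for x
            using elim that by (auto simp: \<rho>_def L_def)
          show s: "0 < s" using \<eta> by (simp add: s_def)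
          have "8 * M / t \<le> 8 * M / (2 powr real n / 2)"
            using t by (intro divide_left_mono) (auto simp: M_def)
          also have "\<dots> = 16 * (M / 2 powr real n)" by simp
          also have "M / 2 powr real n = 2 powr ((a - 1) * real n)"
            unfolding M_def powr_diff[symmetric] by (simp add: algebra_simps)
          finally have "s * (8 * M / t) \<le> s * (16 * 2 powr ((a - 1) * real n))"
            using s by (intro mult_left_mono) auto
          also have "\<dots> = \<eta> / 4" by (simp add: s_def)
          finally have A1: "s * (8 * M / t) \<le> \<eta> / 4" .
          have "C * real \<rho> powr \<kappa> / s \<le> C * (2 powr (\<alpha> * real n)) powr \<kappa> / s"
            using s C ex ball_size_bounds(2)[of \<alpha> n] unfolding \<rho>_def
            by (intro divide_right_mono mult_left_mono powr_mono2) auto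
          also have "\<dots> = C * 64 / \<eta> * (2 powr (\<alpha> * real n * \<kappa>) * 2 powr ((a - 1) * real n))"
            by (simp add: s_def powr_powr)
          also have "2 powr (\<alpha> * real n * \<kappa>) * 2 powr ((a - 1) * real n) = 2 powr (- (1 - \<alpha> * \<kappa> - a) * real n)"
            unfolding powr_add[symmetric] by (simp add: algebra_simps)
          also have "C * 64 / \<eta> * \<dots> < \<eta> / 4" using elim by blast
          finally show "s * (8 * M / t) + C * real \<rho> powr \<kappa> / s \<le> \<eta> / 2" using A1 by linarith
          \<comment> \<open>Condition \<open>F2\<close> multiplied through by 2^(\<alpha> n); its
            second term accounts for the rounding in \<open>ball_size\<close>.\<close>
          have "(2 powr (- (\<alpha> - a) * real n) + \<eta> * c1 / 2 * 2 powr (- \<alpha> * real n)) * 2 powr (\<alpha> * real n) < \<eta> * c1 / 2 * 2 powr (\<alpha> * real n)"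
            using elim by (intro mult_strict_right_mono) auto
          also have "(2 powr (- (\<alpha> - a) * real n) + \<eta> * c1 / 2 * 2 powr (- \<alpha> * real n)) * 2 powr (\<alpha> * real n)
            = 2 powr (- (\<alpha> - a) * real n + \<alpha> * real n) + \<eta> * c1 / 2 * 2 powr (- \<alpha> * real n + \<alpha> * real n)"
            unfolding powr_add by (simp only: distrib_right mult.assoc)
          also have "\<dots> = M + \<eta> * c1 / 2" by (simp add: M_def algebra_simps)
          finally have "M < \<eta> * c1 / 2 * (2 powr (\<alpha> * real n) - 1)" by (simp add: algebra_simps)
          also have "\<dots> \<le> \<eta> * c1 / 2 * real \<rho>"
            using ball_size_bounds(1)[of \<alpha> n] \<eta> c1 unfolding \<rho>_def by (intro mult_left_mono) auto
          finally show "M < \<eta> / 2 * (c1 * real \<rho>)" by simp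
        qed (use C ex L0 True tau t \<eta> in auto)
        then show ?thesis using True by simp
      qed (use \<eta> in \<open>simp add: add_nonneg_nonneg\<close>)
      then show "trap_quenched \<mu> tau t i \<le> exp (- t / 4) + \<eta> + \<eta>" using main tail by linarith
    qed
  qed
  \<comment> \<open>The scale assigned to t: rounding log t up places t in the window
    [2^n/2, 2^n].\<close>
  have "filterlim (\<lambda>t::real. nat \<lceil>log 2 t\<rceil>) sequentially at_top"
    unfolding filterlim_at_top
  proof
    fix Z :: nat
    show "\<forall>\<^sub>F t::real in at_top. Z \<le> nat \<lceil>log 2 t\<rceil>"
      using eventually_ge_at_top[of "2 powr real Z"]
    proof eventually_elim
      case (elim t)
      have "0 < t" using elim by (rule less_le_trans[rotated]) simp
      then have "real Z \<le> log 2 t" using elim by (simp add: le_log_iff)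
      then show ?case by linarith
    qed
  qed
  then have "\<forall>\<^sub>F t in at_top. \<forall>s. 2 powr real (nat \<lceil>log 2 t\<rceil>) / 2 \<le> s \<and> s \<le> 2 powr real (nat \<lceil>log 2 t\<rceil>) \<and> 8 \<le> s \<longrightarrow>
      (\<forall>i. trap_quenched \<mu> tau s i \<le> exp (- s / 4) + \<eta> + \<eta>)"
    using level by (rule filterlim_iff[THEN iffD1, rule_format])
  moreover have "\<forall>\<^sub>F t::real in at_top. exp (- t / 4) < \<eta>"
  proof -
    have "((\<lambda>t::real. exp (- t / 4)) \<longlongrightarrow> 0) at_top" by real_asymp
    then show ?thesis by (rule order_tendstoD) (use \<eta> in simp)
  qed
  moreover have "\<forall>\<^sub>F t::real in at_top. 8 \<le> t" by (rule eventually_ge_at_top)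
  ultimately show "\<forall>\<^sub>F t in at_top. dist (SUP i. trap_quenched \<mu> tau t i) 0 < e"
  proof eventually_elim
    case (elim t)
    have nn: "0 \<le> trap_quenched \<mu> tau t i" for i by (simp add: trap_quenched_def)
    define n where "n = nat \<lceil>log 2 t\<rceil>"
    have "0 \<le> log 2 t" using elim by simp
    then have n: "log 2 t \<le> real n" "real n - 1 \<le> log 2 t"
      unfolding n_def by linarith+
    have "t = 2 powr (log 2 t)" using elim by simp
    then have "t \<le> 2 powr real n" "2 powr (real n - 1) \<le> t"
      using n by (metis powr_mono one_le_numeral)+
    then have "2 powr real n / 2 \<le> t" by (simp add: powr_diff)
    then have le: "trap_quenched \<mu> tau t i \<le> exp (- t / 4) + \<eta> + \<eta>" for i
      using elim \<open>t \<le> 2 powr real n\<close> unfolding n_def by blast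
    then have "(SUP i. trap_quenched \<mu> tau t i) \<le> exp (- t / 4) + \<eta> + \<eta>"
      by (intro cSUP_least) auto
    also have "\<dots> < e" using elim \<eta> by (simp add: \<eta>_def)
    finally have "(SUP i. trap_quenched \<mu> tau t i) < e" .
    moreover have "0 \<le> (SUP i. trap_quenched \<mu> tau t i)"
      using le by (intro cSUP_upper2[where x=0] nn bdd_aboveI2) auto
    ultimately show ?case by simp
  qed
qed

theorem theorem8:
  fixes \<mu> :: "int pmf" and \<beta> c_minus c_plus p :: real and T :: "real measure"
  assumes beta: "1 < \<beta>" "\<beta> \<le> 2"
    and cpos: "c_minus > 0" "c_plus > 0"
    and integ: "integrable (measure_pmf \<mu>) real_of_int"
    and mean0: "measure_pmf.expectation \<mu> real_of_int = 0"
    and aperiodic: "\<And>t::real. measure_pmf.expectation \<mu> (\<lambda>k. cis (t * real_of_int k)) = 1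
                      \<longleftrightarrow> (\<exists>m::int. t = 2 * pi * real_of_int m)"
    and left_tail: "((\<lambda>x::real. x powr \<beta> * measure_pmf.prob \<mu> {k. real_of_int k < - x})
                      \<longlongrightarrow> c_minus) at_top"
    and right_tail: "((\<lambda>x::real. x powr \<beta> * measure_pmf.prob \<mu> {k. real_of_int k > x})
                      \<longlongrightarrow> c_plus) at_top"
    and T_prob: "prob_space T" and T_sets: "sets T = sets borel"
    and T_pos: "AE x in T. 0 < x"
    and p: "1 < p" "p \<le> 2"
    and moment: "integrable T (\<lambda>x. x powr p)"
  shows "AE tau in PiM (UNIV :: int set) (\<lambda>_. T).
           ((\<lambda>t. SUP i. trap_quenched \<mu> tau t i) \<longlongrightarrow> 0) at_top"
proof -
  interpret E: iid_env T by (rule iid_env.intro[OF T_prob T_sets])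
  obtain a r \<gamma> \<kappa> \<alpha> \<delta> where ex: "0 < a" "0 \<le> r" "r < p * a" "1 \<le> \<gamma>" "\<gamma> < \<beta>" "1 + \<delta> < \<gamma> * r" "0 < \<delta>"
    "\<beta> - 1 < \<kappa>" "0 \<le> \<kappa>" "\<kappa> \<le> 2" "a < \<alpha>" "\<alpha> * \<kappa> + a < 1"
    using exponents_exist[OF beta p(1)] by metis
  obtain c where c: "0 < c" "\<And>\<theta>. 0 \<le> \<theta> \<Longrightarrow> \<theta> \<le> pi \<Longrightarrow> c * \<theta> powr \<beta> \<le> cf_gap \<mu> \<theta>"
    using cf_gap_lower_bound[of \<beta> c_plus \<mu>] beta cpos(2) aperiodic right_tail by (smt (verit))
  obtain C where C: "0 \<le> C"
    "\<And>L f x y s. finite L \<Longrightarrow> (\<And>z. z \<notin> L \<Longrightarrow> f z = 0) \<Longrightarrow> 0 < s \<Longrightarrow>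
      f x - f y \<le> s * energy \<mu> L f + C * \<bar>real_of_int (x - y)\<bar> powr \<kappa> / s"
    using holder_energy[OF c ex(8,9,10)] by metis
  have mom: "integrable (measure_pmf \<mu>) (\<lambda>k. \<bar>real_of_int k\<bar> powr \<gamma>)"
    using ex by (intro integrable_moment_of_tails[OF _ _ left_tail right_tail]) auto
  obtain c1 where c1: "0 < c1" "AE tau in E.env. \<forall>\<^sub>F n in sequentially. \<forall>x\<in>{- radius r n..radius r n}.
    c1 * real (ball_size \<alpha> n) \<le> (\<Sum>y\<in>{x..<x + int (ball_size \<alpha> n)}. tau y)"
    using E.AE_ball_mass[OF T_pos ex(2), of \<alpha>] ex by auto
  have "AE tau in E.env. 0 < tau x" for x
    by (intro AE_PiM_component T_prob T_pos) auto
  then have "AE tau in E.env. \<forall>x. 0 < tau x" by (simp add: AE_all_countable)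
  moreover note c1(2)
  moreover have "AE tau in E.env. \<forall>\<^sub>F n in sequentially. \<forall>x\<in>{- radius r n..radius r n}. tau x \<le> 2 powr (a * real n)"
    using p ex by (intro E.AE_sites_bound[OF _ moment]) auto
  moreover have "AE tau in E.env. \<forall>\<^sub>F n in sequentially. \<forall>N.
    laplace_jumps \<mu> (2 powr (- real n)) N tau 0 \<le> ennreal (2 powr ((1 + \<delta>) * real n) / tau 0)"
    by (rule E.AE_laplace_jumps_bound[OF T_pos ex(7)])
  ultimately show ?thesis
  proof eventually_elim
    case (elim tau)
    show ?case
      by (rule trap_quenched_tendsto_0[where C=C and \<kappa>=\<kappa> and \<gamma>=\<gamma> and \<delta>=\<delta> and r=r and a=a and \<alpha>=\<alpha> and ?c1.0=c1])
        (use elim C c1 ex integ mean0 mom beta in auto)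
  qed
qed

end
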